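(* Let $\Delta>0$ and $c>0$ be constants, and let $(G_n)_{n\ge 1}$ be a sequence of finite graphs such that every vertex of every $G_n$ has degree at most $\Delta$ and the Cheeger constants satisfy $h(G_n)\ge c$ for all $n$. Suppose that $G_n$ converges locally weakly to $(G,\rho)$, where $(G,\rho)$ is a random infinite rooted graph with law $\mu$ on $\mathcal{G}$. Then $(G,\rho)$ is an ergodic (equivalently, extremal) unimodular random graph; that is, $\mu$ is unimodular and extremal, and for every rerooting-invariant function $f:\mathcal{G}\to\mathbb{R}$ the random variable $f(G)$ is almost surely equal to a constant. In particular, the critical probability $p_c(G)$ of Bernoulli bond percolation on $G$ is almost surely equal to a constant.
   Context: Rooted graphs. A rooted graph $(G,o)$ is a connected graph $G$ with a distinguished vertex $o$. Two rooted graphs are isomorphic, $(G,o)\cong(G',o')$, if there is a graph isomorphism from $G$ onto $G'$ taking $o$ to $o'$. $\mathcal{G}$ is the space of isomorphism classes of rooted connected graphs with all degrees at most $\Delta$. $B_G(o,r)$ is the closed ball of radius $r$ around $o$ in $G$ for the graph distance, viewed as a graph rooted at $o$. $\mathcal{G}$ carries the metric $D((G_1,o_1),(G_2,o_2))=\frac{1}{1+t}$ with $t=\sup\{s: B_{G_1}(o_1,s)\cong B_{G_2}(o_2,s)\}$ (so $D=0$ if $t=\infty$), which makes it a compact separable metric space, and the corresponding Borel $\sigma$-field. A random rooted graph is a sample from a Borel probability measure $\mu$ on $\mathcal{G}$; it is infinite if the sampled graph is almost surely infinite. Local weak convergence. For each $n$, let $U_n$ be a uniformly chosen random vertex of the finite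 graph $G_n$. $G_n$ converges locally weakly to $(G,\rho)$ (or to its law $\mu$) if for every $R>0$ and every finite rooted graph $(H,\rho')$, $\mathbb{P}\big((B_{G_n}(U_n,R),U_n)\cong(H,\rho')\big)\to\mathbb{P}\big((B_G(\rho,R),\rho)\cong(H,\rho')\big)$ as $n\to\infty$. Cheeger constant. For a finite graph $G=(V,E)$, $h(G)=\min_{A\subseteq V}\{|E(A,V\setminus A)|/|A| : 0<|A|\le |V|/2\}$, where $E(A,B)$ is the set of edges with one endpoint in $A$ and the other in $B$. Unimodularity, extremality, ergodicity. A Borel probability measure $\mu$ on $\mathcal{G}$ is unimodular if it satisfies the mass-transport principle: for every Borel function $F\ge 0$ on the space of isomorphism classes of doubly rooted connected graphs $(G,x,y)$ with degrees at most $\Delta$ (with the analogous local topology), $\mathbb{E}_\mu\big[\sum_{x\in V(G)}F(G,\rho,x)\big]=\mathbb{E}_\mu\big[\sum_{x\in V(G)}F(G,x,\rho)\big]$. The class $\mathcal{U}$ of unimodular probability measures on $\mathcal{G}$ is convex; an element of $\mathcal{U}$ is extremal if it cannot be written as a (nontrivial) convex combination of other elements of $\mathcal{U}$. Let $\mathcal{I}$ be the $\sigma$-field of Borel events in $\mathcal{G}$ that are invariant under non-rooted isomorphisms (i.e. do not depend on the position of the root). $\mu$ is ergodic if $\mathcal{I}$ contains only sets of $\mu$-measure $0$ or $1$. It is a known theorem (Aldous–Lyons) that a unimodular $\mu$ is extremal if and only if it is ergodic. Rerooting-invariant functions. A Borel measurable function $f:\mathcal{G}\to\mathbb{R}$ is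 rerooting-invariant if $f((\tau,v))=f((\tau,v'))$ for every graph $\tau$ and any two vertices $v,v'$ of $\tau$; one then writes $f(\tau)$. Percolation. $\mathbb{P}_p$ denotes Bernoulli bond percolation with parameter $p$: each edge is independently open with probability $p$ and closed with probability $1-p$. For an infinite graph $\tau$ with bounded degrees, $p_c(\tau)=\inf\{p\in[0,1]:\mathbb{P}_p(\text{there exists an infinite open component})>0\}$. *)

theory Defs
  imports "HOL-Probability.Probability"
begin

section \<open>Graphs\<close>

record 'a ugraph =
  Verts :: "'a set"
  Edges :: "'a set set"

text \<open>Simple undirected graphs, finite or infinite; possibly disconnected.\<close>
definition ugraph :: "'a ugraph \<Rightarrow> bool" where
  "ugraph G \<longleftrightarrow> (\<forall>e\<in>Edges G. \<exists>u\<in>Verts G. \<exists>v\<in>Verts G. u \<noteq> v \<and> e = {u, v})"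

definition adj :: "'a ugraph \<Rightarrow> 'a rel" where
  "adj G = {(u, v). {u, v} \<in> Edges G}"

definition graph_connected :: "'a ugraph \<Rightarrow> bool" where
  "graph_connected G \<longleftrightarrow> (\<forall>u\<in>Verts G. \<forall>v\<in>Verts G. (u, v) \<in> (adj G)\<^sup>*)"

text \<open>Finiteness is demanded explicitly because an infinite set has \<open>card\<close> equal to \<open>0\<close>.\<close>
definition degrees_le :: "nat \<Rightarrow> 'a ugraph \<Rightarrow> bool" where
  "degrees_le \<Delta> G \<longleftrightarrow>
     (\<forall>v\<in>Verts G. finite {w. {v, w} \<in> Edges G} \<and> card {w. {v, w} \<in> Edges G} \<le> \<Delta>)"

definition graph_dist :: "'a ugraph \<Rightarrow> 'a \<Rightarrow> 'a \<Rightarrow> enat" where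
  "graph_dist G u v = (INF n \<in> {n. (u, v) \<in> adj G ^^ n}. enat n)"

definition induced_subgraph :: "'a ugraph \<Rightarrow> 'a set \<Rightarrow> 'a ugraph" where
  "induced_subgraph G W = \<lparr>Verts = Verts G \<inter> W, Edges = {e \<in> Edges G. e \<subseteq> W}\<rparr>"

definition graph_iso :: "('a \<Rightarrow> 'b) \<Rightarrow> 'a ugraph \<Rightarrow> 'b ugraph \<Rightarrow> bool" where
  "graph_iso \<phi> G H \<longleftrightarrow> bij_betw \<phi> (Verts G) (Verts H) \<and>
     (\<forall>u\<in>Verts G. \<forall>v\<in>Verts G. {u, v} \<in> Edges G \<longleftrightarrow> {\<phi> u, \<phi> v} \<in> Edges H)"

definition edge_boundary :: "'a ugraph \<Rightarrow> 'a set \<Rightarrow> 'a set set" where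
  "edge_boundary G A = {e \<in> Edges G. \<exists>a\<in>A. \<exists>b\<in>Verts G - A. e = {a, b}}"

text \<open>The infimum is a minimum over a finite set. If \<open>G\<close> has a single vertex there is no admissible
  \<open>A\<close>, and the value is \<open>\<infinity>\<close>.\<close>
definition cheeger :: "'a ugraph \<Rightarrow> ereal" where
  "cheeger G = (INF A \<in> {A. A \<subseteq> Verts G \<and> 0 < card A \<and> real (card A) \<le> real (card (Verts G)) / 2}.
     ereal (real (card (edge_boundary G A)) / real (card A)))"


section \<open>Rooted graphs and the local topology\<close>

text \<open>A graph with a list of roots: a rooted graph \<open>(G, o)\<close> is \<open>(G, [o])\<close> and a doubly rooted graph
  \<open>(G, x, y)\<close> is \<open>(G, [x, y])\<close>, so that both spaces and their topologies are instances of the same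
  definitions.\<close>
type_synonym 'a rooted = "'a ugraph \<times> 'a list"

definition rooted_iso :: "'a rooted \<Rightarrow> 'b rooted \<Rightarrow> bool" (infix "\<cong>\<^sub>r" 50) where
  "R \<cong>\<^sub>r S \<longleftrightarrow> set (snd R) \<subseteq> Verts (fst R) \<and>
     (\<exists>\<phi>. graph_iso \<phi> (fst R) (fst S) \<and> map \<phi> (snd R) = snd S)"

text \<open>Closed ball of radius \<open>r\<close>: the subgraph induced by the vertices at distance at most \<open>r\<close>
  from some root (from the root, when there is only one), with the same roots.\<close>
definition rooted_ball :: "'a rooted \<Rightarrow> nat \<Rightarrow> 'a rooted" where
  "rooted_ball R r =
     (induced_subgraph (fst R) {v. \<exists>x\<in>set (snd R). graph_dist (fst R) x v \<le> enat r}, snd R)"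

text \<open>Connected graphs with bounded degrees are countable, so each isomorphism class has
  representatives whose vertices are natural numbers.\<close>
definition rooted_graphs :: "nat \<Rightarrow> nat \<Rightarrow> nat rooted set" where
  "rooted_graphs \<Delta> k = {(G, xs). ugraph G \<and> graph_connected G \<and> degrees_le \<Delta> G \<and>
     set xs \<subseteq> Verts G \<and> length xs = k}"

definition iso_rel :: "nat rooted rel" where
  "iso_rel = {(R, S). R \<in> (\<Union>\<Delta> k. rooted_graphs \<Delta> k) \<and> S \<in> (\<Union>\<Delta> k. rooted_graphs \<Delta> k) \<and> R \<cong>\<^sub>r S}"

abbreviation iso_class :: "nat rooted \<Rightarrow> nat rooted set" where
  "iso_class R \<equiv> iso_rel `` {R}"

text \<open>\<open>rooted_classes \<Delta> 1\<close> is the space of isomorphism classes of rooted graphs,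
  \<open>rooted_classes \<Delta> 2\<close> the one of doubly rooted graphs.\<close>
definition rooted_classes :: "nat \<Rightarrow> nat \<Rightarrow> nat rooted set set" where
  "rooted_classes \<Delta> k = rooted_graphs \<Delta> k // iso_rel"

definition graph_of :: "nat rooted set \<Rightarrow> nat ugraph" where
  "graph_of X = fst (SOME R. R \<in> X)"

definition roots_of :: "nat rooted set \<Rightarrow> nat list" where
  "roots_of X = snd (SOME R. R \<in> X)"

definition agreement_radius :: "nat rooted set \<Rightarrow> nat rooted set \<Rightarrow> enat" where
  "agreement_radius X Y =
     Sup {enat s |s. \<exists>R\<in>X. \<exists>S\<in>Y. rooted_ball R s \<cong>\<^sub>r rooted_ball S s}"

definition local_dist :: "nat rooted set \<Rightarrow> nat rooted set \<Rightarrow> real" where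
  "local_dist X Y =
     (case agreement_radius X Y of enat t \<Rightarrow> 1 / (1 + real t) | \<infinity> \<Rightarrow> 0)"

definition local_topology :: "nat \<Rightarrow> nat \<Rightarrow> nat rooted set topology" where
  "local_topology \<Delta> k = Metric_space.mtopology (rooted_classes \<Delta> k) local_dist"

definition local_borel :: "nat \<Rightarrow> nat \<Rightarrow> nat rooted set measure" where
  "local_borel \<Delta> k = sigma (rooted_classes \<Delta> k) {U. openin (local_topology \<Delta> k) U}"


section \<open>Random rooted graphs\<close>

definition random_rooted_graph :: "nat \<Rightarrow> nat rooted set measure \<Rightarrow> bool" where
  "random_rooted_graph \<Delta> \<mu> \<longleftrightarrow> prob_space \<mu> \<and> sets \<mu> = sets (local_borel \<Delta> 1)"

definition converges_locally_weakly :: "(nat \<Rightarrow> 'a ugraph) \<Rightarrow> nat rooted set measure \<Rightarrow> bool" where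
  "converges_locally_weakly G \<mu> \<longleftrightarrow>
     (\<forall>R>0. \<forall>H :: nat ugraph. \<forall>h\<in>Verts H. ugraph H \<and> graph_connected H \<and> finite (Verts H) \<longrightarrow>
       (\<lambda>n. measure_pmf.prob (pmf_of_set (Verts (G n))) {u. rooted_ball (G n, [u]) R \<cong>\<^sub>r (H, [h])})
       \<longlonglongrightarrow>
       measure \<mu> {X \<in> space \<mu>. rooted_ball (graph_of X, roots_of X) R \<cong>\<^sub>r (H, [h])})"

definition unimodular :: "nat \<Rightarrow> nat rooted set measure \<Rightarrow> bool" where
  "unimodular \<Delta> \<mu> \<longleftrightarrow> random_rooted_graph \<Delta> \<mu> \<and>
     (\<forall>F :: nat rooted set \<Rightarrow> ennreal. F \<in> borel_measurable (local_borel \<Delta> 2) \<longrightarrow>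
       (\<integral>\<^sup>+X. (\<integral>\<^sup>+x. F (iso_class (graph_of X, [hd (roots_of X), x])) \<partial>count_space (Verts (graph_of X))) \<partial>\<mu>) =
       (\<integral>\<^sup>+X. (\<integral>\<^sup>+x. F (iso_class (graph_of X, [x, hd (roots_of X)])) \<partial>count_space (Verts (graph_of X))) \<partial>\<mu>))"

definition extremal_unimodular :: "nat \<Rightarrow> nat rooted set measure \<Rightarrow> bool" where
  "extremal_unimodular \<Delta> \<mu> \<longleftrightarrow> unimodular \<Delta> \<mu> \<and>
     (\<forall>\<nu>\<^sub>1 \<nu>\<^sub>2 t. unimodular \<Delta> \<nu>\<^sub>1 \<and> unimodular \<Delta> \<nu>\<^sub>2 \<and> 0 < t \<and> t < 1 \<and>
        (\<forall>A\<in>sets \<mu>. measure \<mu> A = t * measure \<nu>\<^sub>1 A + (1 - t) * measure \<nu>\<^sub>2 A)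
        \<longrightarrow> \<nu>\<^sub>1 = \<mu> \<and> \<nu>\<^sub>2 = \<mu>)"

definition invariant_events :: "nat \<Rightarrow> nat rooted set set set" where
  "invariant_events \<Delta> = {A \<in> sets (local_borel \<Delta> 1).
     \<forall>X\<in>A. \<forall>Y\<in>rooted_classes \<Delta> 1. (\<exists>\<phi>. graph_iso \<phi> (graph_of X) (graph_of Y)) \<longrightarrow> Y \<in> A}"

definition ergodic :: "nat \<Rightarrow> nat rooted set measure \<Rightarrow> bool" where
  "ergodic \<Delta> \<mu> \<longleftrightarrow> (\<forall>A\<in>invariant_events \<Delta>. measure \<mu> A = 0 \<or> measure \<mu> A = 1)"

definition rerooting_invariant :: "nat \<Rightarrow> (nat rooted set \<Rightarrow> real) \<Rightarrow> bool" where
  "rerooting_invariant \<Delta> f \<longleftrightarrow>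
     (\<forall>G v w. (G, [v]) \<in> rooted_graphs \<Delta> 1 \<and> (G, [w]) \<in> rooted_graphs \<Delta> 1 \<longrightarrow>
        f (iso_class (G, [v])) = f (iso_class (G, [w])))"


section \<open>Bernoulli bond percolation\<close>

text \<open>A configuration marks the open edges with \<open>True\<close>.\<close>
definition bond_percolation :: "'a ugraph \<Rightarrow> real \<Rightarrow> ('a set \<Rightarrow> bool) measure" where
  "bond_percolation G p = (\<Pi>\<^sub>M e\<in>Edges G. measure_pmf (bernoulli_pmf p))"

definition open_subgraph :: "'a ugraph \<Rightarrow> ('a set \<Rightarrow> bool) \<Rightarrow> 'a ugraph" where
  "open_subgraph G \<omega> = \<lparr>Verts = Verts G, Edges = {e \<in> Edges G. \<omega> e}\<rparr>"

definition has_infinite_component :: "'a ugraph \<Rightarrow> bool" where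
  "has_infinite_component G \<longleftrightarrow> (\<exists>v\<in>Verts G. infinite {w. (v, w) \<in> (adj G)\<^sup>*})"

definition p_crit :: "'a ugraph \<Rightarrow> real" where
  "p_crit G = Inf {p \<in> {0..1}. 0 < measure (bond_percolation G p)
     {\<omega> \<in> space (bond_percolation G p). has_infinite_component (open_subgraph G \<omega>)}}"


section \<open>\<open>local_dist\<close> is a metric\<close>

definition reach :: "'a rooted \<Rightarrow> nat \<Rightarrow> 'a set" where
  "reach R r = {v. \<exists>x\<in>set (snd R). \<exists>n\<le>r. (x, v) \<in> adj (fst R) ^^ n}"

lemma graph_dist_le_iff: "graph_dist G x v \<le> enat r \<longleftrightarrow> (\<exists>n\<le>r. (x, v) \<in> adj G ^^ n)"
proof
  assume a: "graph_dist G x v \<le> enat r"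
  let ?A = "enat ` {n. (x, v) \<in> adj G ^^ n}"
  have ne: "?A \<noteq> {}"
  proof
    assume "?A = {}"
    then have "graph_dist G x v = \<infinity>" unfolding graph_dist_def by (simp add: top_enat_def)
    then show False using a by simp
  qed
  then have "Inf ?A \<in> ?A" using wellorder_InfI by (metis all_not_in_conv)
  then show "\<exists>n\<le>r. (x, v) \<in> adj G ^^ n" using a unfolding graph_dist_def by auto
next
  assume "\<exists>n\<le>r. (x, v) \<in> adj G ^^ n"
  then obtain n where "n \<le> r" "(x, v) \<in> adj G ^^ n" by blast
  then show "graph_dist G x v \<le> enat r"
    unfolding graph_dist_def by (intro INF_lower2[of n]) auto
qed

lemma rooted_ball_eq: "rooted_ball R r = (induced_subgraph (fst R) (reach R r), snd R)"
  unfolding rooted_ball_def reach_def graph_dist_le_iff ..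

lemma reach_step:
  "y \<in> reach R r \<Longrightarrow> {y, z} \<in> Edges (fst R) \<Longrightarrow> z \<in> reach R (Suc r)"
  unfolding reach_def adj_def by (fastforce intro: relpow_Suc_I)

lemma reach_mono: "r \<le> s \<Longrightarrow> reach R r \<subseteq> reach R s"
  unfolding reach_def by (auto intro: le_trans)

lemma reach_0: "reach R 0 = set (snd R)"
  unfolding reach_def by auto

lemma reach_Suc_cases:
  assumes "z \<in> reach R (Suc r)"
  shows "z \<in> reach R r \<or> (\<exists>y\<in>reach R r. {y, z} \<in> Edges (fst R))"
proof -
  obtain x n where x: "x \<in> set (snd R)" and n: "n \<le> Suc r" "(x, z) \<in> adj (fst R) ^^ n"
    using assms unfolding reach_def by blast
  show ?thesis
  proof (cases "n = Suc r")
    case True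
    then obtain y where "(x, y) \<in> adj (fst R) ^^ r" "{y, z} \<in> Edges (fst R)"
      using n unfolding adj_def by auto
    then show ?thesis using x unfolding reach_def by blast
  next
    case False
    then show ?thesis using x n unfolding reach_def by (auto simp: le_Suc_eq)
  qed
qed

definition well_rooted :: "'a rooted \<Rightarrow> bool" where
  "well_rooted R \<longleftrightarrow> ugraph (fst R) \<and> set (snd R) \<subseteq> Verts (fst R)"

lemma edge_verts:
  assumes "ugraph G" "{u, v} \<in> Edges G"
  shows "u \<in> Verts G \<and> v \<in> Verts G"
proof -
  obtain a b where "a \<in> Verts G" "b \<in> Verts G" "{u, v} = {a, b}"
    using assms unfolding ugraph_def by blast
  then show ?thesis by (auto simp: doubleton_eq_iff)
qed

lemma reach_verts: "well_rooted R \<Longrightarrow> reach R r \<subseteq> Verts (fst R)"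
proof (induction r)
  case 0 then show ?case by (simp add: reach_0 well_rooted_def)
next
  case (Suc r)
  show ?case
  proof
    fix z assume "z \<in> reach R (Suc r)"
    then show "z \<in> Verts (fst R)"
      using reach_Suc_cases[of z R r] Suc edge_verts[of "fst R" _ z] unfolding well_rooted_def by blast
  qed
qed

lemma well_rooted_ball:
  assumes "well_rooted R"
  shows "well_rooted (rooted_ball R s)"
proof -
  let ?G = "fst R" and ?B = "induced_subgraph (fst R) (reach R s)"
  have "ugraph ?B" unfolding ugraph_def
  proof
    fix e assume "e \<in> Edges ?B"
    then have e: "e \<in> Edges ?G" "e \<subseteq> reach R s" by (auto simp: induced_subgraph_def)
    then obtain u v where "u \<in> Verts ?G" "v \<in> Verts ?G" "u \<noteq> v" "e = {u, v}"
      using assms unfolding well_rooted_def ugraph_def by blast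
    moreover from this e have "u \<in> Verts ?B" "v \<in> Verts ?B" by (auto simp: induced_subgraph_def)
    ultimately show "\<exists>u\<in>Verts ?B. \<exists>v\<in>Verts ?B. u \<noteq> v \<and> e = {u, v}" by blast
  qed
  moreover have "set (snd R) \<subseteq> Verts ?B"
    using assms reach_mono[of 0 s R] by (auto simp: reach_0 well_rooted_def induced_subgraph_def)
  ultimately show ?thesis by (simp add: well_rooted_def rooted_ball_eq)
qed

lemma rooted_iso_refl: "well_rooted R \<Longrightarrow> R \<cong>\<^sub>r R"
  unfolding rooted_iso_def graph_iso_def well_rooted_def by (auto intro: exI[of _ id])

lemma rooted_iso_sym: assumes "R \<cong>\<^sub>r S" shows "S \<cong>\<^sub>r R"
proof -
  obtain \<phi> where b: "bij_betw \<phi> (Verts (fst R)) (Verts (fst S))"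
    and e: "\<forall>u\<in>Verts (fst R). \<forall>v\<in>Verts (fst R). {u, v} \<in> Edges (fst R) \<longleftrightarrow> {\<phi> u, \<phi> v} \<in> Edges (fst S)"
    and m: "map \<phi> (snd R) = snd S" and r: "set (snd R) \<subseteq> Verts (fst R)"
    using assms unfolding rooted_iso_def graph_iso_def by blast
  let ?i = "inv_into (Verts (fst R)) \<phi>"
  have 1: "bij_betw ?i (Verts (fst S)) (Verts (fst R))" using b by (rule bij_betw_inv_into)
  have 2: "{u, v} \<in> Edges (fst S) \<longleftrightarrow> {?i u, ?i v} \<in> Edges (fst R)"
    if "u \<in> Verts (fst S)" "v \<in> Verts (fst S)" for u v
    using e[rule_format, of "?i u" "?i v"] that b 1
    by (simp add: bij_betw_apply bij_betw_inv_into_right)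
  have 3: "map ?i (snd S) = snd R"
    unfolding m[symmetric] map_map using b r
    by (intro map_idI) (auto simp: bij_betw_inv_into_left subset_eq)
  have 4: "set (snd S) \<subseteq> Verts (fst S)"
    using r b unfolding m[symmetric] by (auto intro: bij_betw_apply)
  show ?thesis unfolding rooted_iso_def graph_iso_def using 1 2 3 4 by blast
qed

lemma rooted_iso_trans: assumes "R \<cong>\<^sub>r S" "S \<cong>\<^sub>r T" shows "R \<cong>\<^sub>r T"
proof -
  obtain \<phi> \<psi> where "graph_iso \<phi> (fst R) (fst S)" "map \<phi> (snd R) = snd S"
    "graph_iso \<psi> (fst S) (fst T)" "map \<psi> (snd S) = snd T" "set (snd R) \<subseteq> Verts (fst R)"
    using assms unfolding rooted_iso_def by blast
  then show ?thesis unfolding rooted_iso_def graph_iso_def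
    by (intro conjI exI[of _ "\<psi> \<circ> \<phi>"])
       (auto intro: bij_betw_trans simp: bij_betw_apply simp flip: map_map)
qed

lemma reach_image:
  assumes e: "\<And>u v. u \<in> reach R s \<Longrightarrow> v \<in> reach R s \<Longrightarrow> {u, v} \<in> Edges (fst R) \<Longrightarrow> {\<phi> u, \<phi> v} \<in> Edges (fst S)"
    and m: "map \<phi> (snd R) = snd S" and "r \<le> s"
  shows "\<phi> ` reach R r \<subseteq> reach S r"
  using \<open>r \<le> s\<close>
proof (induction r)
  case 0 show ?case using m by (simp add: reach_0 flip: m)
next
  case (Suc r)
  show ?case
  proof clarify
    fix z assume z: "z \<in> reach R (Suc r)"
    from reach_Suc_cases[OF this] show "\<phi> z \<in> reach S (Suc r)"
    proof
      assume "z \<in> reach R r" then show ?thesis using Suc reach_mono[of r "Suc r" S] by auto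
    next
      assume "\<exists>y\<in>reach R r. {y, z} \<in> Edges (fst R)"
      then obtain y where y: "y \<in> reach R r" "{y, z} \<in> Edges (fst R)" by blast
      have "{\<phi> y, \<phi> z} \<in> Edges (fst S)"
        using e[of y z] y z Suc.prems reach_mono[of r s R] reach_mono[of "Suc r" s R] by auto
      moreover have "\<phi> y \<in> reach S r" using Suc y by auto
      ultimately show ?thesis by (metis reach_step)
    qed
  qed
qed

lemma ball_iso_gen:
  assumes ok: "well_rooted R" "well_rooted S"
    and V: "reach R s \<subseteq> V" "reach S s \<subseteq> W"
    and i: "graph_iso \<phi> (induced_subgraph (fst R) V) (induced_subgraph (fst S) W)"
    and m: "map \<phi> (snd R) = snd S" and rs: "r \<le> s"
  shows "graph_iso \<phi> (induced_subgraph (fst R) (reach R r)) (induced_subgraph (fst S) (reach S r))"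
proof -
  let ?A = "Verts (fst R) \<inter> V" and ?B = "Verts (fst S) \<inter> W"
  have b: "bij_betw \<phi> ?A ?B" using i by (simp add: graph_iso_def induced_subgraph_def)
  have e: "{u, v} \<in> Edges (fst R) \<longleftrightarrow> {\<phi> u, \<phi> v} \<in> Edges (fst S)" if "u \<in> ?A" "v \<in> ?A" for u v
    using i that bij_betw_apply[OF b that(1)] bij_betw_apply[OF b that(2)]
    by (auto simp: graph_iso_def induced_subgraph_def)
  let ?i = "inv_into ?A \<phi>"
  have RA: "reach R s \<subseteq> ?A" and SB: "reach S s \<subseteq> ?B" using V reach_verts ok by blast+
  have 1: "\<phi> ` reach R r \<subseteq> reach S r"
    by (rule reach_image[OF _ m rs]) (use e RA in blast)
  have m': "map ?i (snd S) = snd R"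
    unfolding m[symmetric] map_map using b RA reach_mono[of 0 s R]
    by (intro map_idI) (auto simp: reach_0 bij_betw_inv_into_left subset_eq)
  have 2: "?i ` reach S r \<subseteq> reach R r"
  proof (rule reach_image[OF _ m' rs])
    fix u v assume uv: "u \<in> reach S s" "v \<in> reach S s" "{u, v} \<in> Edges (fst S)"
    then have B: "u \<in> ?B" "v \<in> ?B" using SB by blast+
    then have A: "?i u \<in> ?A" "?i v \<in> ?A"
      using bij_betw_apply[OF bij_betw_inv_into[OF b]] by blast+
    show "{?i u, ?i v} \<in> Edges (fst R)"
      using e[OF A] uv(3) bij_betw_inv_into_right[OF b] B by simp
  qed
  have rR: "reach R r \<subseteq> ?A" and rS: "reach S r \<subseteq> ?B"
    using RA SB reach_mono[OF rs, of R] reach_mono[OF rs, of S] by blast+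
  have "\<phi> ` reach R r = reach S r"
  proof
    show "reach S r \<subseteq> \<phi> ` reach R r"
    proof
      fix w assume w: "w \<in> reach S r"
      then have "\<phi> (?i w) = w" using rS bij_betw_inv_into_right[OF b] by blast
      then show "w \<in> \<phi> ` reach R r" using 2 w by (auto intro!: image_eqI[of w \<phi> "?i w"])
    qed
  qed (rule 1)
  then have "bij_betw \<phi> (reach R r) (reach S r)" using bij_betw_subset[OF b rR] by simp
  moreover have "Verts (fst R) \<inter> reach R r = reach R r" "Verts (fst S) \<inter> reach S r = reach S r"
    using rR rS by auto
  moreover have "{u, v} \<in> Edges (fst R) \<and> {u, v} \<subseteq> reach R r \<longleftrightarrow>
      {\<phi> u, \<phi> v} \<in> Edges (fst S) \<and> {\<phi> u, \<phi> v} \<subseteq> reach S r"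
    if "u \<in> reach R r" "v \<in> reach R r" for u v
    using e[of u v] that rR 1 by blast
  ultimately show ?thesis unfolding graph_iso_def induced_subgraph_def by simp
qed

lemma ball_mono_iso:
  assumes "well_rooted R" "well_rooted S" "rooted_ball R s \<cong>\<^sub>r rooted_ball S s" "r \<le> s"
  shows "rooted_ball R r \<cong>\<^sub>r rooted_ball S r"
  using assms ball_iso_gen[of R S s "reach R s" "reach S s" _ r] well_rooted_ball[of R r]
  unfolding well_rooted_def rooted_iso_def rooted_ball_eq by auto

lemma induced_UNIV: "induced_subgraph (G :: 'a ugraph) UNIV = G"
  unfolding induced_subgraph_def by simp

lemma iso_ball:
  assumes "well_rooted R" "well_rooted S" "R \<cong>\<^sub>r S"
  shows "rooted_ball R r \<cong>\<^sub>r rooted_ball S r"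
  using assms ball_iso_gen[of R S r UNIV UNIV _ r] well_rooted_ball[of R r]
  unfolding well_rooted_def rooted_iso_def rooted_ball_eq induced_UNIV by auto

lemma reach_finite:
  assumes "well_rooted R" "degrees_le \<Delta> (fst R)" shows "finite (reach R r)"
proof (induction r)
  case 0 show ?case by (simp add: reach_0)
next
  case (Suc r)
  have "reach R (Suc r) \<subseteq> reach R r \<union> (\<Union>y\<in>reach R r. {z. {y, z} \<in> Edges (fst R)})"
    using reach_Suc_cases by fastforce
  moreover have "finite (\<dots>)" using Suc assms reach_verts[OF assms(1)]
    by (auto simp: degrees_le_def)
  ultimately show ?case by (rule finite_subset)
qed

lemma reach_all:
  assumes "well_rooted R" "graph_connected (fst R)" "snd R \<noteq> []" "v \<in> Verts (fst R)"
  shows "\<exists>r. v \<in> reach R r"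
proof -
  obtain x where x: "x \<in> set (snd R)" using assms(3) by (cases "snd R") auto
  then have "(x, v) \<in> (adj (fst R))\<^sup>*" using assms unfolding graph_connected_def well_rooted_def by blast
  then obtain n where "(x, v) \<in> adj (fst R) ^^ n" using rtrancl_power by blast
  then show ?thesis using x unfolding reach_def by blast
qed

lemma iso_of_ball_isos:
  fixes R S :: "nat rooted"
  assumes R: "well_rooted R" "graph_connected (fst R)" "snd R \<noteq> []" "degrees_le \<Delta> (fst R)"
    and S: "well_rooted S" "graph_connected (fst S)" "snd S \<noteq> []" "degrees_le \<Delta> (fst S)"
    and all: "\<And>s. rooted_ball R s \<cong>\<^sub>r rooted_ball S s"
  shows "R \<cong>\<^sub>r S"
proof -
  obtain \<phi> where \<phi>: "\<And>s. graph_iso (\<phi> s) (induced_subgraph (fst R) (reach R s)) (induced_subgraph (fst S) (reach S s))"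
    and m: "\<And>s. map (\<phi> s) (snd R) = snd S"
    using all unfolding rooted_iso_def rooted_ball_eq by simp metis
  have int: "Verts (fst R) \<inter> reach R r = reach R r" "Verts (fst S) \<inter> reach S r = reach S r" for r
    using reach_verts R(1) S(1) by blast+
  have b: "bij_betw (\<phi> s) (reach R r) (reach S r)" if "r \<le> s" for r s
    using ball_iso_gen[OF R(1) S(1) subset_refl subset_refl \<phi> m that]
    by (simp add: graph_iso_def induced_subgraph_def int)
  have e: "{u, v} \<in> Edges (fst R) \<longleftrightarrow> {\<phi> s u, \<phi> s v} \<in> Edges (fst S)"
    if "u \<in> reach R s" "v \<in> reach R s" for u v s
    using \<phi>[of s] that bij_betw_apply[OF b[OF order_refl] that(1)] bij_betw_apply[OF b[OF order_refl] that(2)]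
    by (auto simp: graph_iso_def induced_subgraph_def int)
  define P where "P n s \<longleftrightarrow> (n \<in> Verts (fst R) \<longrightarrow> (\<exists>c. \<forall>\<^sub>F i in sequentially. \<phi> (s i) n = c))" for n and s :: "nat \<Rightarrow> nat"
  have PD: "\<exists>c. \<forall>\<^sub>F i in sequentially. \<phi> (s i) n = c" if "P n s" "n \<in> Verts (fst R)" for n s
    using that unfolding P_def by blast
  interpret subseqs P
  proof
    fix n and s :: "nat \<Rightarrow> nat" assume s: "strict_mono s"
    show "\<exists>r'. strict_mono r' \<and> P n (s \<circ> r')"
    proof (cases "n \<in> Verts (fst R)")
      case False then show ?thesis unfolding P_def by (intro exI[of _ id]) (auto simp: strict_mono_def)
    next
      case True
      then obtain r where r: "n \<in> reach R r" using reach_all[OF R(1-3)] by blast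
      have "\<phi> (s i) n \<in> reach S r" if "i \<in> {r..}" for i
      proof (rule bij_betw_apply[OF b r])
        show "r \<le> s i" using that seq_suble[OF s, of i] by simp
      qed
      then have "(\<lambda>i. \<phi> (s i) n) ` {r..} \<subseteq> reach S r" by blast
      then have "finite ((\<lambda>i. \<phi> (s i) n) ` {r..})"
        by (rule finite_subset) (rule reach_finite[OF S(1) S(4)])
      from pigeonhole_infinite[OF infinite_Ici this] obtain a where
        a: "infinite {i \<in> {r..}. \<phi> (s i) n = \<phi> (s a) n}" by blast
      let ?I = "{i \<in> {r..}. \<phi> (s i) n = \<phi> (s a) n}"
      have "strict_mono (enumerate ?I)" using a by (rule strict_mono_enumerate)
      moreover have "\<phi> (s (enumerate ?I i)) n = \<phi> (s a) n" for i
        using enumerate_in_set[OF a, of i] by blast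
      ultimately show ?thesis unfolding P_def o_def by (intro exI[of _ "enumerate ?I"]) simp
    qed
  qed
  have diag: "P k (diagseq \<circ> ((+) (Suc k)))" for k
  proof (rule diagseq_holds)
    fix r s :: "nat \<Rightarrow> nat" and n assume r: "strict_mono r" and "P n s"
    then show "P n (s \<circ> r)" unfolding P_def o_def
      using eventually_compose_filterlim[OF _ filterlim_subseq[OF r]] by blast
  qed
  have lim: "\<exists>c. \<forall>\<^sub>F i in sequentially. \<phi> (diagseq i) k = c" if k: "k \<in> Verts (fst R)" for k
  proof -
    obtain c where "\<forall>\<^sub>F i in sequentially. \<phi> (diagseq (i + Suc k)) k = c"
      using PD[OF diag k] by (simp only: o_def add.commute[of "Suc k"]) blast
    then have "\<forall>\<^sub>F i in sequentially. \<phi> (diagseq i) k = c"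
      by (rule eventually_sequentially_seg[of "\<lambda>i. \<phi> (diagseq i) k = c" "Suc k", THEN iffD1])
    then show ?thesis ..
  qed
  then obtain \<psi> where \<psi>: "\<And>k. k \<in> Verts (fst R) \<Longrightarrow> \<forall>\<^sub>F i in sequentially. \<phi> (diagseq i) k = \<psi> k"
    using bchoice[of "Verts (fst R)" "\<lambda>k c. \<forall>\<^sub>F i in sequentially. \<phi> (diagseq i) k = c"] by blast
  have pick: "\<exists>s\<ge>N. \<forall>v\<in>F. \<phi> s v = \<psi> v" if "finite F" "F \<subseteq> Verts (fst R)" for N F
  proof -
    have "\<forall>\<^sub>F i in sequentially. \<forall>v\<in>F. \<phi> (diagseq i) v = \<psi> v"
      using that \<psi> by (intro eventually_ball_finite) auto
    moreover have "\<forall>\<^sub>F i in sequentially. diagseq i \<ge> N"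
      using eventually_ge_at_top[of N] by eventually_elim (rule le_trans[OF _ seq_suble[OF subseq_diagseq]])
    ultimately have "\<forall>\<^sub>F i in sequentially. diagseq i \<ge> N \<and> (\<forall>v\<in>F. \<phi> (diagseq i) v = \<psi> v)"
      by eventually_elim auto
    then obtain i where "diagseq i \<ge> N \<and> (\<forall>v\<in>F. \<phi> (diagseq i) v = \<psi> v)"
      unfolding eventually_sequentially by blast
    then show ?thesis by blast
  qed
  have agree: "\<exists>s\<ge>r. \<forall>v\<in>reach R r. \<phi> s v = \<psi> v" for r
    by (rule pick[OF reach_finite[OF R(1,4)] reach_verts[OF R(1)]])
  have both_reached: "\<exists>r. u \<in> reach R r \<and> v \<in> reach R r" if uv: "u \<in> Verts (fst R)" "v \<in> Verts (fst R)" for u v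
  proof -
    obtain a c where "u \<in> reach R a" "v \<in> reach R c" using reach_all[OF R(1-3)] uv by blast
    then have "u \<in> reach R (max a c)" "v \<in> reach R (max a c)"
      using reach_mono[of a "max a c" R] reach_mono[of c "max a c" R] by auto
    then show ?thesis by blast
  qed
  have bpsi: "bij_betw \<psi> (reach R r) (reach S r)" for r
  proof -
    obtain s where s: "s \<ge> r" "\<forall>v\<in>reach R r. \<phi> s v = \<psi> v" using agree by blast
    have "bij_betw \<psi> (reach R r) (reach S r) \<longleftrightarrow> bij_betw (\<phi> s) (reach R r) (reach S r)"
      using s by (intro bij_betw_cong) simp
    then show ?thesis using b[OF s(1)] by simp
  qed
  have "inj_on \<psi> (Verts (fst R))"
  proof (rule inj_onI)
    fix u v assume uv: "u \<in> Verts (fst R)" "v \<in> Verts (fst R)" "\<psi> u = \<psi> v"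
    then obtain r where "u \<in> reach R r" "v \<in> reach R r" using both_reached by blast
    then show "u = v" using inj_onD[OF bij_betw_imp_inj_on[OF bpsi] uv(3)] by blast
  qed
  moreover have "\<psi> ` Verts (fst R) = Verts (fst S)"
  proof
    show "\<psi> ` Verts (fst R) \<subseteq> Verts (fst S)"
    proof
      fix w assume "w \<in> \<psi> ` Verts (fst R)"
      then obtain v where v: "v \<in> Verts (fst R)" "w = \<psi> v" by blast
      then obtain r where "v \<in> reach R r" using reach_all[OF R(1-3)] by blast
      then show "w \<in> Verts (fst S)"
        using v bij_betw_apply[OF bpsi] reach_verts[OF S(1)] by blast
    qed
    show "Verts (fst S) \<subseteq> \<psi> ` Verts (fst R)"
    proof
      fix w assume "w \<in> Verts (fst S)"
      then obtain r where "w \<in> reach S r" using reach_all[OF S(1-3)] by blast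
      then have "w \<in> \<psi> ` reach R r" using bpsi by (simp add: bij_betw_def)
      then show "w \<in> \<psi> ` Verts (fst R)" using reach_verts[OF R(1)] by blast
    qed
  qed
  moreover have "{u, v} \<in> Edges (fst R) \<longleftrightarrow> {\<psi> u, \<psi> v} \<in> Edges (fst S)"
    if uv: "u \<in> Verts (fst R)" "v \<in> Verts (fst R)" for u v
  proof -
    obtain r where r: "u \<in> reach R r" "v \<in> reach R r" using both_reached[OF uv] by blast
    obtain s where s: "s \<ge> r" "\<forall>v\<in>reach R r. \<phi> s v = \<psi> v" using agree by blast
    have "u \<in> reach R s" "v \<in> reach R s" using r reach_mono[OF s(1), of R] by blast+
    from e[OF this] show ?thesis using s r by simp
  qed
  moreover have "map \<psi> (snd R) = snd S"
  proof -
    obtain s where "\<forall>v\<in>reach R 0. \<phi> s v = \<psi> v" using agree by blast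
    then show ?thesis unfolding m[of s, symmetric] by (intro map_cong) (auto simp: reach_0)
  qed
  ultimately show ?thesis using R(1) unfolding rooted_iso_def graph_iso_def bij_betw_def well_rooted_def by blast
qed

lemma rooted_graphs_well_rooted: "R \<in> rooted_graphs \<Delta> k \<Longrightarrow> well_rooted R"
  unfolding rooted_graphs_def well_rooted_def by auto

lemma iso_class_iff:
  assumes "R \<in> rooted_graphs \<Delta> k"
  shows "S \<in> iso_class R \<longleftrightarrow> (\<exists>\<Delta> k. S \<in> rooted_graphs \<Delta> k) \<and> R \<cong>\<^sub>r S"
  using assms unfolding iso_rel_def by auto

lemma iso_class_self: "R \<in> rooted_graphs \<Delta> k \<Longrightarrow> R \<in> iso_class R"
  using iso_class_iff[of R \<Delta> k R] rooted_iso_refl[OF rooted_graphs_well_rooted, of R \<Delta> k] by blast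

lemma rooted_classes_cases:
  assumes "X \<in> rooted_classes \<Delta> k"
  obtains R where "R \<in> rooted_graphs \<Delta> k" "X = iso_class R"
  using assms unfolding rooted_classes_def quotient_def by blast

lemma agree_iff:
  assumes R: "R \<in> rooted_graphs \<Delta> k" and S: "S \<in> rooted_graphs \<Delta> k"
  shows "(\<exists>R'\<in>iso_class R. \<exists>S'\<in>iso_class S. rooted_ball R' s \<cong>\<^sub>r rooted_ball S' s) \<longleftrightarrow>
    rooted_ball R s \<cong>\<^sub>r rooted_ball S s"
proof
  assume "\<exists>R'\<in>iso_class R. \<exists>S'\<in>iso_class S. rooted_ball R' s \<cong>\<^sub>r rooted_ball S' s"
  then obtain R' S' where *: "R' \<in> iso_class R" "S' \<in> iso_class S"
    "rooted_ball R' s \<cong>\<^sub>r rooted_ball S' s" by blast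
  have R': "well_rooted R'" "R \<cong>\<^sub>r R'"
    using *(1) rooted_graphs_well_rooted unfolding iso_class_iff[OF R] by blast+
  have S': "well_rooted S'" "S \<cong>\<^sub>r S'"
    using *(2) rooted_graphs_well_rooted unfolding iso_class_iff[OF S] by blast+
  note 1 = iso_ball[OF rooted_graphs_well_rooted[OF R] R', of s]
  note 2 = rooted_iso_sym[OF iso_ball[OF rooted_graphs_well_rooted[OF S] S', of s]]
  show "rooted_ball R s \<cong>\<^sub>r rooted_ball S s"
    by (rule rooted_iso_trans[OF rooted_iso_trans[OF 1 *(3)] 2])
next
  assume "rooted_ball R s \<cong>\<^sub>r rooted_ball S s"
  then show "\<exists>R'\<in>iso_class R. \<exists>S'\<in>iso_class S. rooted_ball R' s \<cong>\<^sub>r rooted_ball S' s"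
    using iso_class_self[OF R] iso_class_self[OF S] by blast
qed

lemma iso_class_eq:
  assumes R: "R \<in> rooted_graphs \<Delta> k" and S: "S \<in> rooted_graphs \<Delta> k" and RS: "R \<cong>\<^sub>r S"
  shows "iso_class R = iso_class S"
proof (rule set_eqI)
  fix T :: "nat rooted"
  have "R \<cong>\<^sub>r T \<longleftrightarrow> S \<cong>\<^sub>r T"
    using rooted_iso_trans[OF RS, of T] rooted_iso_trans[OF rooted_iso_sym[OF RS], of T] by blast
  then show "T \<in> iso_class R \<longleftrightarrow> T \<in> iso_class S"
    unfolding iso_class_iff[OF R] iso_class_iff[OF S] by simp
qed

definition dist_of_radius :: "enat \<Rightarrow> real" where
  "dist_of_radius t = (case t of enat t \<Rightarrow> 1 / (1 + real t) | \<infinity> \<Rightarrow> 0)"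

lemma dist_of_radius_nonneg: "dist_of_radius t \<ge> 0" by (auto simp: dist_of_radius_def split: enat.split)
lemma dist_of_radius_eq_0: "dist_of_radius t = 0 \<longleftrightarrow> t = \<infinity>" by (auto simp: dist_of_radius_def split: enat.split)
lemma dist_of_radius_antimono: "s \<le> t \<Longrightarrow> dist_of_radius t \<le> dist_of_radius s"
  by (cases s; cases t) (auto simp: dist_of_radius_def frac_le)

lemma local_dist_alt: "local_dist X Y = dist_of_radius (agreement_radius X Y)"
  by (simp add: local_dist_def dist_of_radius_def)

lemma agreement_sym: "agreement_radius X Y = agreement_radius Y X"
  unfolding agreement_radius_def by (rule arg_cong[where f = Sup]) (blast intro: rooted_iso_sym)

lemma agreement_radius_eq:
  assumes "R \<in> rooted_graphs \<Delta> k" "S \<in> rooted_graphs \<Delta> k"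
  shows "agreement_radius (iso_class R) (iso_class S) = Sup (enat ` {s. rooted_ball R s \<cong>\<^sub>r rooted_ball S s})"
  unfolding agreement_radius_def agree_iff[OF assms] by (rule arg_cong[where f = Sup]) blast

lemma agreement_down_closed:
  assumes R: "R \<in> rooted_graphs \<Delta> k" and S: "S \<in> rooted_graphs \<Delta> k"
    and n: "enat n < Sup (enat ` {s. rooted_ball R s \<cong>\<^sub>r rooted_ball S s})"
  shows "rooted_ball R n \<cong>\<^sub>r rooted_ball S n"
proof -
  obtain s where s: "rooted_ball R s \<cong>\<^sub>r rooted_ball S s" "n < s"
    using n unfolding less_Sup_iff by auto
  show ?thesis
    by (rule ball_mono_iso[OF rooted_graphs_well_rooted[OF R] rooted_graphs_well_rooted[OF S] s(1)])
       (use s(2) in simp)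
qed

theorem Metric_space_local_dist: assumes "k > 0" shows "Metric_space (rooted_classes \<Delta> k) local_dist"
proof
  fix X Y
  show "0 \<le> local_dist X Y" by (simp add: local_dist_alt dist_of_radius_nonneg)
  show "local_dist X Y = local_dist Y X" by (simp add: local_dist_alt agreement_sym)
next
  fix X Y assume "X \<in> rooted_classes \<Delta> k" "Y \<in> rooted_classes \<Delta> k"
  then obtain R S where RS: "R \<in> rooted_graphs \<Delta> k" "X = iso_class R"
    "S \<in> rooted_graphs \<Delta> k" "Y = iso_class S" by (auto elim!: rooted_classes_cases)
  let ?A = "{s. rooted_ball R s \<cong>\<^sub>r rooted_ball S s}"
  show "local_dist X Y = 0 \<longleftrightarrow> X = Y"
  proof
    assume "local_dist X Y = 0"
    then have inf: "Sup (enat ` ?A) = \<infinity>"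
      unfolding agreement_radius_eq[OF RS(1,3), symmetric] RS(2,4)[symmetric]
      by (simp add: local_dist_alt dist_of_radius_eq_0)
    have balls: "rooted_ball R n \<cong>\<^sub>r rooted_ball S n" for n
      by (rule agreement_down_closed[OF RS(1,3)]) (unfold inf, simp)
    have "graph_connected (fst R)" "snd R \<noteq> []" "degrees_le \<Delta> (fst R)"
      "graph_connected (fst S)" "snd S \<noteq> []" "degrees_le \<Delta> (fst S)"
      using RS(1,3) assms unfolding rooted_graphs_def by auto
    then have "R \<cong>\<^sub>r S"
      using iso_of_ball_isos[OF rooted_graphs_well_rooted[OF RS(1)] _ _ _
          rooted_graphs_well_rooted[OF RS(3)] _ _ _ balls] by simp
    from iso_class_eq[OF RS(1,3) this] show "X = Y" using RS(2,4) by simp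
  next
    assume "X = Y"
    then have "agreement_radius X Y = Sup (range enat)"
      unfolding \<open>X = Y\<close>[symmetric] RS(2) agreement_radius_eq[OF RS(1) RS(1)]
      by (simp add: rooted_iso_refl[OF well_rooted_ball[OF rooted_graphs_well_rooted[OF RS(1)]]])
    also have "\<dots> = \<infinity>"
    proof (cases "Sup (range enat)")
      case (enat n)
      then have "enat (Suc n) \<le> enat n" by (metis SUP_upper UNIV_I)
      then show ?thesis by simp
    qed simp
    finally show "local_dist X Y = 0" by (simp add: local_dist_alt dist_of_radius_eq_0)
  qed
next
  fix X Y Z assume "X \<in> rooted_classes \<Delta> k" "Y \<in> rooted_classes \<Delta> k" "Z \<in> rooted_classes \<Delta> k"
  then obtain R S T where RST: "R \<in> rooted_graphs \<Delta> k" "X = iso_class R"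
    "S \<in> rooted_graphs \<Delta> k" "Y = iso_class S" "T \<in> rooted_graphs \<Delta> k" "Z = iso_class T"
    by (auto elim!: rooted_classes_cases)
  have "min (agreement_radius X Y) (agreement_radius Y Z) \<le> agreement_radius X Z"
  proof (rule ccontr)
    assume "\<not> ?thesis"
    then have lt: "agreement_radius X Z < agreement_radius X Y" "agreement_radius X Z < agreement_radius Y Z"
      by (simp_all add: not_le)
    then obtain a b where a: "a > agreement_radius X Z" "a \<in> enat ` {s. rooted_ball R s \<cong>\<^sub>r rooted_ball S s}"
      and b: "b > agreement_radius X Z" "b \<in> enat ` {s. rooted_ball S s \<cong>\<^sub>r rooted_ball T s}"
      unfolding RST(2,4,6) agreement_radius_eq[OF RST(1,3)] agreement_radius_eq[OF RST(3,5)]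
        less_Sup_iff by blast
    then obtain s t where st: "a = enat s" "b = enat t" "rooted_ball R s \<cong>\<^sub>r rooted_ball S s"
      "rooted_ball S t \<cong>\<^sub>r rooted_ball T t" by auto
    let ?m = "min s t"
    note ok = rooted_graphs_well_rooted[OF RST(1)] rooted_graphs_well_rooted[OF RST(3)]
      rooted_graphs_well_rooted[OF RST(5)]
    have "rooted_ball R ?m \<cong>\<^sub>r rooted_ball T ?m"
      by (rule rooted_iso_trans[OF ball_mono_iso[OF ok(1,2) st(3) min.cobounded1]
            ball_mono_iso[OF ok(2,3) st(4) min.cobounded2]])
    then have "enat ?m \<le> agreement_radius X Z"
      unfolding RST(2,6) agreement_radius_eq[OF RST(1,5)] by (intro Sup_upper) simp
    moreover have "enat ?m > agreement_radius X Z" using a b st by (auto simp: min_def)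
    ultimately show False by simp
  qed
  then have "local_dist X Z \<le> max (local_dist X Y) (local_dist Y Z)"
    using dist_of_radius_antimono[of "agreement_radius X Y" "agreement_radius X Z"]
      dist_of_radius_antimono[of "agreement_radius Y Z" "agreement_radius X Z"]
    unfolding local_dist_alt by (auto simp: min_le_iff_disj le_max_iff_disj)
  then show "local_dist X Z \<le> local_dist X Y + local_dist Y Z"
    using dist_of_radius_nonneg[of "agreement_radius X Y"] dist_of_radius_nonneg[of "agreement_radius Y Z"] unfolding local_dist_alt by linarith
qed

end

theory Submission
  imports Defs
begin

text \<open>Events determined by a ball of finite radius form an algebra generating the Borel sets, and
  their probabilities are limits of empirical frequencies in the finite graphs. Counting pairs of
  vertices in a finite graph in two ways gives the mass-transport principle for local functions,
  hence for all.

  If \<open>A\<close> is an event that almost surely no edge leaves, approximate it within \<open>\<epsilon>\<close> by a local event \<open>A'\<close>.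
  By mass transport the expected number of edges at the root leaving \<open>A'\<close> is \<open>O(\<epsilon>)\<close>. In the finite
  graphs this is the density of the edge boundary of the set of vertices satisfying \<open>A'\<close>, so the
  Cheeger bound forces \<open>min (\<mu> A') (1 - \<mu> A') = O(\<epsilon>)\<close>, and \<open>\<mu> A \<in> {0, 1}\<close>. This gives ergodicity; for
  extremality it is applied to the superlevel sets of the density of a unimodular measure that is
  absolutely continuous with respect to \<open>\<mu>\<close>.\<close>

section \<open>Isomorphisms of balls\<close>

text \<open>The zero-one law asks that almost surely no edge leaves \<open>A\<close>, not that
  \<open>A\<close> is invariant. A density is determined only up to null sets, so its superlevel
  sets cannot be expected to be invariant pointwise; the weaker hypothesis lets one isoperimetric
  estimate serve ergodicity and extremality alike, and extremality is reached without the
  equivalence of the two notions.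

  A class is read through an arbitrarily chosen representative, so every quantity computed from a
  graph has to be shown to depend on the class alone. For quantities visible in a ball this follows
  by moving further roots along an isomorphism of balls, at the price of a larger radius.

  The space contains only connected graphs on the natural numbers. The finite graphs, whose vertices
  may have any type, are therefore relabelled, and the Cheeger bound makes them connected.

  The critical probability is an infimum over uncountably many parameters. Its measurability comes
  from approximations that are polynomials in the parameter, from compactness of parameter
  intervals, and from expressing "some vertex" by a transported mass.\<close>

lemma sym_adj: "sym (adj G)"
  unfolding adj_def sym_def by (auto simp: insert_commute)

lemma sym_relpow: "sym r \<Longrightarrow> sym (r ^^ n)"
proof (induction n)
  case (Suc n)
  show ?case
  proof (rule symI)
    fix a b assume "(a, b) \<in> r ^^ Suc n"
    then obtain c where "(a, c) \<in> r ^^ n" "(c, b) \<in> r" by auto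
    then show "(b, a) \<in> r ^^ Suc n"
      using Suc by (metis relpow_Suc_I2 symD)
  qed
qed (simp add: sym_Id)

text \<open>\<open>graph_iso\<close> compares edges between given vertices only;
  \<open>ugraph\<close> on both sides keeps all neighbours inside the vertex sets.\<close>

lemma graph_iso_neighbours:
  assumes "ugraph G" "ugraph H" "graph_iso \<phi> G H" "v \<in> Verts G"
  shows "{w. {\<phi> v, w} \<in> Edges H} = \<phi> ` {w. {v, w} \<in> Edges G}"
proof -
  have b: "bij_betw \<phi> (Verts G) (Verts H)"
    and e: "\<And>u w. u \<in> Verts G \<Longrightarrow> w \<in> Verts G \<Longrightarrow> {u, w} \<in> Edges G \<longleftrightarrow> {\<phi> u, \<phi> w} \<in> Edges H"
    using assms(3) unfolding graph_iso_def by auto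
  show ?thesis
  proof (intro equalityI subsetI)
    fix w assume "w \<in> {w. {\<phi> v, w} \<in> Edges H}"
    then have w: "{\<phi> v, w} \<in> Edges H" by simp
    then have "w \<in> Verts H" using edge_verts[OF assms(2)] by blast
    then obtain w' where "w' \<in> Verts G" "w = \<phi> w'" using b unfolding bij_betw_def by blast
    then show "w \<in> \<phi> ` {w. {v, w} \<in> Edges G}" using e[OF assms(4)] w by blast
  next
    fix w assume "w \<in> \<phi> ` {w. {v, w} \<in> Edges G}"
    then obtain w' where w': "{v, w'} \<in> Edges G" "w = \<phi> w'" by blast
    then show "w \<in> {w. {\<phi> v, w} \<in> Edges H}"
      using e[OF assms(4), of w'] edge_verts[OF assms(1)] by blast
  qed
qed

lemma degrees_le_iso:
  assumes "ugraph G" "ugraph H" "graph_iso \<phi> G H" "degrees_le \<Delta> G"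
  shows "degrees_le \<Delta> H"
  unfolding degrees_le_def
proof
  fix v assume "v \<in> Verts H"
  then obtain u where u: "u \<in> Verts G" "v = \<phi> u"
    using assms(3) unfolding graph_iso_def bij_betw_def by blast
  have "finite {w. {u, w} \<in> Edges G}" "card {w. {u, w} \<in> Edges G} \<le> \<Delta>"
    using assms(4) u unfolding degrees_le_def by auto
  then show "finite {w. {v, w} \<in> Edges H} \<and> card {w. {v, w} \<in> Edges H} \<le> \<Delta>"
    unfolding u(2) graph_iso_neighbours[OF assms(1-3) u(1)]
    using card_image_le le_trans by blast
qed

text \<open>\<open>iso_rel\<close> is one relation for all degree bounds and all numbers of roots.
  Both are isomorphism invariants, so a class that meets \<open>rooted_graphs \<Delta> k\<close>
  stays inside it.\<close>

lemma rooted_graphs_iso: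
  assumes R: "R \<in> rooted_graphs \<Delta> k" and S: "S \<in> rooted_graphs \<Delta>' k'" and RS: "R \<cong>\<^sub>r S"
  shows "S \<in> rooted_graphs \<Delta> k"
proof -
  obtain \<phi> where \<phi>: "graph_iso \<phi> (fst R) (fst S)" "map \<phi> (snd R) = snd S"
    using RS unfolding rooted_iso_def by blast
  have u: "ugraph (fst R)" "ugraph (fst S)" "degrees_le \<Delta> (fst R)"
    using R S unfolding rooted_graphs_def by auto
  have "degrees_le \<Delta> (fst S)" by (rule degrees_le_iso[OF u(1,2) \<phi>(1) u(3)])
  moreover have "length (snd S) = k" using R \<phi>(2)[symmetric] unfolding rooted_graphs_def by auto
  ultimately show ?thesis using S unfolding rooted_graphs_def by auto
qed

section \<open>Representatives of isomorphism classes\<close>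

lemma iso_class_in_rooted_classes [intro]: "R \<in> rooted_graphs \<Delta> k \<Longrightarrow> iso_class R \<in> rooted_classes \<Delta> k"
  unfolding rooted_classes_def by (rule quotientI)

lemma rep_in_iso_class:
  assumes "R \<in> rooted_graphs \<Delta> k"
  shows "(graph_of (iso_class R), roots_of (iso_class R)) \<in> iso_class R"
  unfolding graph_of_def roots_of_def using someI[of "\<lambda>S. S \<in> iso_class R", OF iso_class_self[OF assms]] by simp

lemma rep_iso:
  assumes "R \<in> rooted_graphs \<Delta> k"
  shows "R \<cong>\<^sub>r (graph_of (iso_class R), roots_of (iso_class R))"
  using rep_in_iso_class[OF assms] iso_class_iff[OF assms] by blast

lemma rep_rooted_graph:
  assumes "X \<in> rooted_classes \<Delta> k"
  shows "(graph_of X, roots_of X) \<in> rooted_graphs \<Delta> k"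
proof -
  obtain R where R: "R \<in> rooted_graphs \<Delta> k" "X = iso_class R"
    using rooted_classes_cases[OF assms] .
  then show ?thesis
    using rep_in_iso_class[OF R(1)] rooted_graphs_iso[OF R(1)] unfolding iso_class_iff[OF R(1)] by blast
qed

lemma iso_class_rep:
  assumes "X \<in> rooted_classes \<Delta> k"
  shows "iso_class (graph_of X, roots_of X) = X"
proof -
  obtain R where R: "R \<in> rooted_graphs \<Delta> k" "X = iso_class R"
    using rooted_classes_cases[OF assms] .
  show ?thesis
    using iso_class_eq[OF R(1) rep_rooted_graph[OF assms]] rep_iso[OF R(1)] R(2) by simp
qed

lemma rooted_graphs_1E:
  assumes "R \<in> rooted_graphs \<Delta> 1"
  obtains G v where "R = (G, [v])"
  using assms unfolding rooted_graphs_def by (auto simp: length_Suc_conv)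

lemma rooted_graphs_2E:
  assumes "R \<in> rooted_graphs \<Delta> 2"
  obtains G v w where "R = (G, [v, w])"
  using assms unfolding rooted_graphs_def by (auto simp: length_Suc_conv numeral_2_eq_2)

lemma rep_roots_1:
  assumes "X \<in> rooted_classes \<Delta> 1"
  shows "roots_of X = [hd (roots_of X)]" "hd (roots_of X) \<in> Verts (graph_of X)"
proof -
  obtain G v where "(graph_of X, roots_of X) = (G, [v])"
    using rooted_graphs_1E[OF rep_rooted_graph[OF assms]] .
  then show "roots_of X = [hd (roots_of X)]" by simp
  then have "hd (roots_of X) \<in> set (roots_of X)" by (metis list.set_intros(1))
  then show "hd (roots_of X) \<in> Verts (graph_of X)"
    using rep_rooted_graph[OF assms] unfolding rooted_graphs_def by auto
qed

section \<open>Restricting an isomorphism of balls to smaller balls around other roots\<close>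

lemma reach_trans:
  assumes "set xs \<subseteq> reach R q"
  shows "reach (fst R, xs) r \<subseteq> reach R (q + r)"
proof
  fix v assume "v \<in> reach (fst R, xs) r"
  then obtain x n where x: "x \<in> set xs" "n \<le> r" "(x, v) \<in> adj (fst R) ^^ n"
    unfolding reach_def by auto
  then obtain y m where y: "y \<in> set (snd R)" "m \<le> q" "(y, x) \<in> adj (fst R) ^^ m"
    using assms unfolding reach_def by blast
  have "(y, v) \<in> adj (fst R) ^^ (m + n)"
    using x y by (auto simp: relpow_add)
  then show "v \<in> reach R (q + r)" unfolding reach_def using x y by (metis (mono_tags, lifting) add_mono mem_Collect_eq)
qed

text \<open>Paths of length at most \<open>s\<close> from a root stay inside the ball of radius
  \<open>s\<close>, so the isomorphism and its inverse both preserve distances from the roots up to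
  \<open>s\<close>.\<close>

lemma ball_iso_mono_reach:
  assumes ok: "well_rooted R" "well_rooted S"
    and i: "graph_iso \<phi> (fst (rooted_ball R s)) (fst (rooted_ball S s))"
    and m: "map \<phi> (snd R) = snd S" and rs: "r \<le> s"
  shows "bij_betw \<phi> (reach R r) (reach S r)"
proof -
  have "graph_iso \<phi> (induced_subgraph (fst R) (reach R r)) (induced_subgraph (fst S) (reach S r))"
    using ball_iso_gen[OF ok subset_refl subset_refl _ m rs] i by (simp add: rooted_ball_eq)
  moreover have "Verts (fst R) \<inter> reach R r = reach R r" "Verts (fst S) \<inter> reach S r = reach S r"
    using reach_verts ok by blast+
  ultimately show ?thesis by (simp add: graph_iso_def induced_subgraph_def)
qed

text \<open>The source of all locality statements about pairs of vertices: new roots within distance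
  \<open>q\<close> of the old ones are carried along by \<open>\<phi>\<close>, and
  \<open>q + r \<le> s\<close> ensures that the balls of radius \<open>r\<close> around them are
  seen completely.\<close>

lemma subroot_ball_iso:
  assumes ok: "well_rooted R" "well_rooted S"
    and i: "graph_iso \<phi> (fst (rooted_ball R s)) (fst (rooted_ball S s))"
    and m: "map \<phi> (snd R) = snd S"
    and xs: "set xs \<subseteq> reach R q" "q + r \<le> s"
  shows "rooted_ball (fst R, xs) r \<cong>\<^sub>r rooted_ball (fst S, map \<phi> xs) r"
proof -
  let ?R = "(fst R, xs)" and ?S = "(fst S, map \<phi> xs)"
  have S: "set (map \<phi> xs) \<subseteq> reach S q"
    using bij_betw_apply[OF ball_iso_mono_reach[OF ok i m, of q]] xs by auto
  have w: "well_rooted ?R" "well_rooted ?S"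
    using ok subset_trans[OF xs(1) reach_verts[OF ok(1)]] subset_trans[OF S reach_verts[OF ok(2)]]
    unfolding well_rooted_def by auto
  have 1: "reach ?R r \<subseteq> reach R s" "reach ?S r \<subseteq> reach S s"
    using subset_trans[OF reach_trans[OF xs(1)] reach_mono[OF xs(2)]]
      subset_trans[OF reach_trans[OF S] reach_mono[OF xs(2)]] by auto
  have 2: "graph_iso \<phi> (induced_subgraph (fst ?R) (reach R s)) (induced_subgraph (fst ?S) (reach S s))"
    using i by (simp add: rooted_ball_eq)
  have 3: "map \<phi> (snd ?R) = snd ?S" by simp
  have "graph_iso \<phi> (induced_subgraph (fst ?R) (reach ?R r)) (induced_subgraph (fst ?S) (reach ?S r))"
    by (rule ball_iso_gen[OF w 1 2 3 order_refl])
  then show ?thesis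
    using well_rooted_ball[OF w(1), of r] unfolding rooted_iso_def rooted_ball_eq well_rooted_def by auto
qed

lemma ball_isoE:
  assumes "rooted_ball R s \<cong>\<^sub>r rooted_ball S s"
  obtains \<phi> where "graph_iso \<phi> (fst (rooted_ball R s)) (fst (rooted_ball S s))" "map \<phi> (snd R) = snd S"
  using assms unfolding rooted_iso_def rooted_ball_eq by auto

lemma reach_sym: "v \<in> reach (G, [u]) r \<longleftrightarrow> u \<in> reach (G, [v]) r"
proof -
  have "(a, b) \<in> adj G ^^ n \<Longrightarrow> (b, a) \<in> adj G ^^ n" for a b n
    using sym_relpow[OF sym_adj] by (metis symD)
  then show ?thesis unfolding reach_def by auto
qed

text \<open>Each step outwards multiplies the count by at most \<open>1 + \<Delta>\<close>. The
  bound is uniform over all graphs, which makes transported masses bounded and leaves finitely many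
  balls of each radius.\<close>

lemma card_reach_le:
  assumes "well_rooted R" "degrees_le \<Delta> (fst R)"
  shows "card (reach R r) \<le> length (snd R) * (1 + \<Delta>) ^ r"
proof (induction r)
  case 0 show ?case by (simp add: reach_0 card_length)
next
  case (Suc r)
  let ?N = "\<lambda>y. {z. {y, z} \<in> Edges (fst R)}"
  have N: "finite (?N y) \<and> card (?N y) \<le> \<Delta>" if "y \<in> reach R r" for y
    using that assms reach_verts[OF assms(1)] unfolding degrees_le_def by blast
  have fin: "finite (reach R r)" by (rule reach_finite[OF assms])
  have "reach R (Suc r) \<subseteq> reach R r \<union> (\<Union>y\<in>reach R r. ?N y)"
    using reach_Suc_cases by fastforce
  moreover have "finite \<dots>" using fin N by blast
  ultimately have "card (reach R (Suc r)) \<le> card (reach R r \<union> (\<Union>y\<in>reach R r. ?N y))"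
    by (rule card_mono[rotated])
  also have "\<dots> \<le> card (reach R r) + (\<Sum>y\<in>reach R r. card (?N y))"
    using card_Un_le card_UN_le[OF fin, of ?N] by (meson add_left_mono le_trans)
  also have "\<dots> \<le> card (reach R r) + (\<Sum>y\<in>reach R r. \<Delta>)"
    using N by (intro add_left_mono sum_mono) auto
  also have "\<dots> = card (reach R r) * (1 + \<Delta>)" by simp
  also have "\<dots> \<le> length (snd R) * (1 + \<Delta>) ^ r * (1 + \<Delta>)" by (rule mult_right_mono[OF Suc]) simp
  finally show ?case by (simp add: algebra_simps)
qed

text \<open>Local weak convergence is tested against connected finite graphs only, so balls must be
  known to be connected before it applies to them. Shortest paths to the root witness this.\<close>

lemma graph_connected_ball:
  assumes "well_rooted (G, [v])"
  shows "graph_connected (fst (rooted_ball (G, [v]) r))"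
proof -
  let ?R = "(G, [v])"
  let ?B = "rooted_ball ?R r"
  have "id ` reach ?R r \<subseteq> reach ?B r"
    by (rule reach_image[where s = r]) (auto simp: rooted_ball_eq induced_subgraph_def)
  then have *: "(v, w) \<in> (adj (fst ?B))\<^sup>*" if "w \<in> Verts (fst ?B)" for w
  proof -
    have "w \<in> reach ?R r" using that by (simp add: rooted_ball_eq induced_subgraph_def)
    then have "w \<in> reach ?B r" using \<open>id ` _ \<subseteq> _\<close> by auto
    then obtain n where "(v, w) \<in> adj (fst ?B) ^^ n" unfolding reach_def by (auto simp: rooted_ball_eq)
    then show ?thesis by (rule relpow_imp_rtrancl)
  qed
  show ?thesis unfolding graph_connected_def
  proof (intro ballI)
    fix a b assume "a \<in> Verts (fst ?B)" "b \<in> Verts (fst ?B)"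
    then show "(a, b) \<in> (adj (fst ?B))\<^sup>*"
      using symD[OF sym_rtrancl[OF sym_adj] *] * rtrancl_trans by metis
  qed
qed

text \<open>Serves two ends: balls are copied to an initial segment of the natural numbers in order
  to count their types, and the given finite graphs are moved to the vertex type of the
  space.\<close>

definition relabel :: "('a \<Rightarrow> 'b) \<Rightarrow> 'a ugraph \<Rightarrow> 'b ugraph" where
  "relabel f G = \<lparr>Verts = f ` Verts G, Edges = (`) f ` Edges G\<rparr>"

lemma ugraph_relabel:
  assumes "ugraph G" "inj_on f (Verts G)" shows "ugraph (relabel f G)"
  unfolding ugraph_def
proof
  fix e assume "e \<in> Edges (relabel f G)"
  then obtain d where d: "d \<in> Edges G" "e = f ` d" by (auto simp: relabel_def)
  then obtain u v where "u \<in> Verts G" "v \<in> Verts G" "u \<noteq> v" "d = {u, v}"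
    using assms(1) unfolding ugraph_def by blast
  then show "\<exists>u\<in>Verts (relabel f G). \<exists>v\<in>Verts (relabel f G). u \<noteq> v \<and> e = {u, v}"
    using d inj_on_eq_iff[OF assms(2)]
    by (intro bexI[where x = "f u"] bexI[where x = "f v"]) (simp_all add: relabel_def)
qed

lemma graph_iso_relabel:
  assumes "ugraph G" "inj_on f (Verts G)" shows "graph_iso f G (relabel f G)"
proof -
  have "{u, v} \<in> Edges G" if uv: "u \<in> Verts G" "v \<in> Verts G" "{f u, f v} \<in> Edges (relabel f G)" for u v
  proof -
    obtain d where d: "d \<in> Edges G" "{f u, f v} = f ` d"
      using uv(3) by (auto simp: relabel_def)
    have "d \<subseteq> Verts G" using d(1) assms(1) unfolding ugraph_def by auto
    moreover have "f ` {u, v} = f ` d" using d(2) by simp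
    ultimately have "{u, v} = d" using uv inj_on_image_eq_iff[OF assms(2), of "{u, v}" d] by auto
    then show ?thesis using d(1) by simp
  qed
  moreover have "{f u, f v} \<in> Edges (relabel f G)" if "{u, v} \<in> Edges G" for u v
  proof -
    have "f ` {u, v} \<in> Edges (relabel f G)" using that unfolding relabel_def by (simp del: image_insert)
    then show ?thesis by simp
  qed
  moreover have "bij_betw f (Verts G) (Verts (relabel f G))"
    using assms(2) by (simp add: relabel_def bij_betw_def)
  ultimately show ?thesis unfolding graph_iso_def by blast
qed

section \<open>Local events\<close>

text \<open>For \<open>k > 0\<close> these sets are clopen in the local topology. Quantifying over
  all representatives avoids any dependence on the chosen one.\<close>

definition local_event :: "nat \<Rightarrow> nat \<Rightarrow> nat \<Rightarrow> nat rooted set set \<Rightarrow> bool" where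
  "local_event \<Delta> k r B \<longleftrightarrow> B \<subseteq> rooted_classes \<Delta> k \<and>
     (\<forall>R\<in>rooted_graphs \<Delta> k. \<forall>S\<in>rooted_graphs \<Delta> k.
        rooted_ball R r \<cong>\<^sub>r rooted_ball S r \<longrightarrow> iso_class R \<in> B \<longrightarrow> iso_class S \<in> B)"

lemma local_eventD:
  assumes "local_event \<Delta> k r B" "R \<in> rooted_graphs \<Delta> k" "S \<in> rooted_graphs \<Delta> k"
    "rooted_ball R r \<cong>\<^sub>r rooted_ball S r"
  shows "iso_class R \<in> B \<longleftrightarrow> iso_class S \<in> B"
  using assms rooted_iso_sym[OF assms(4)] unfolding local_event_def by blast

lemma local_event_subset: "local_event \<Delta> k r B \<Longrightarrow> B \<subseteq> rooted_classes \<Delta> k"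
  unfolding local_event_def by simp

lemma local_event_mono:
  assumes "local_event \<Delta> k r B" "r \<le> s" shows "local_event \<Delta> k s B"
  unfolding local_event_def
proof (intro conjI ballI impI local_event_subset[OF assms(1)])
  fix R S assume *: "R \<in> rooted_graphs \<Delta> k" "S \<in> rooted_graphs \<Delta> k"
    "rooted_ball R s \<cong>\<^sub>r rooted_ball S s" "iso_class R \<in> B"
  have "rooted_ball R r \<cong>\<^sub>r rooted_ball S r"
    by (rule ball_mono_iso[OF rooted_graphs_well_rooted[OF *(1)] rooted_graphs_well_rooted[OF *(2)] *(3) assms(2)])
  then show "iso_class S \<in> B" using local_eventD[OF assms(1) *(1,2)] *(4) by blast
qed

lemma local_event_Un: "local_event \<Delta> k r A \<Longrightarrow> local_event \<Delta> k r B \<Longrightarrow> local_event \<Delta> k r (A \<union> B)"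
  unfolding local_event_def by blast

lemma local_event_Int: "local_event \<Delta> k r A \<Longrightarrow> local_event \<Delta> k r B \<Longrightarrow> local_event \<Delta> k r (A \<inter> B)"
  unfolding local_event_def by blast

lemma local_event_Compl: "local_event \<Delta> k r A \<Longrightarrow> local_event \<Delta> k r (rooted_classes \<Delta> k - A)"
  unfolding local_event_def using rooted_iso_sym by blast

lemma local_event_empty: "local_event \<Delta> k r {}"
  unfolding local_event_def by blast

lemma local_event_UN:
  "finite I \<Longrightarrow> (\<And>i. i \<in> I \<Longrightarrow> \<exists>r. local_event \<Delta> k r (B i)) \<Longrightarrow> \<exists>r. local_event \<Delta> k r (\<Union>i\<in>I. B i)"
proof (induction I rule: finite_induct)
  case empty show ?case using local_event_empty by auto
next
  case (insert i I)
  then obtain r s where "local_event \<Delta> k r (B i)" "local_event \<Delta> k s (\<Union>i\<in>I. B i)" by blast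
  then have "local_event \<Delta> k (max r s) (B i)" "local_event \<Delta> k (max r s) (\<Union>i\<in>I. B i)"
    by (auto intro: local_event_mono)
  then show ?case using local_event_Un by fastforce
qed

text \<open>The strict bound puts \<open>r\<close> below the agreement radius, and agreement at some
  larger radius restricts to \<open>r\<close>.\<close>

lemma local_dist_less_imp_ball_iso:
  assumes R: "R \<in> rooted_graphs \<Delta> k" and S: "S \<in> rooted_graphs \<Delta> k"
    and d: "local_dist (iso_class R) (iso_class S) < 1 / (1 + real r)"
  shows "rooted_ball R r \<cong>\<^sub>r rooted_ball S r"
proof (rule agreement_down_closed[OF R S])
  show "enat r < Sup (enat ` {s. rooted_ball R s \<cong>\<^sub>r rooted_ball S s})"
    using d unfolding local_dist_def agreement_radius_eq[OF R S]
    by (cases "Sup (enat ` {s. rooted_ball R s \<cong>\<^sub>r rooted_ball S s})")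
       (auto simp: divide_simps split: if_splits)
qed

lemma ball_iso_imp_local_dist_le:
  assumes R: "R \<in> rooted_graphs \<Delta> k" and S: "S \<in> rooted_graphs \<Delta> k"
    and i: "rooted_ball R r \<cong>\<^sub>r rooted_ball S r"
  shows "local_dist (iso_class R) (iso_class S) \<le> 1 / (1 + real r)"
proof -
  have "enat r \<le> agreement_radius (iso_class R) (iso_class S)"
    unfolding agreement_radius_eq[OF R S] using i by (intro Sup_upper) simp
  from dist_of_radius_antimono[OF this] show ?thesis
    by (simp add: local_dist_alt dist_of_radius_def)
qed

lemma openin_local_event:
  assumes "k > 0" "local_event \<Delta> k r B"
  shows "openin (local_topology \<Delta> k) B"
proof -
  interpret Metric_space "rooted_classes \<Delta> k" local_dist
    by (rule Metric_space_local_dist[OF assms(1)])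
  show ?thesis unfolding local_topology_def openin_mtopology
  proof (intro conjI allI impI local_event_subset[OF assms(2)])
    fix X assume X: "X \<in> B"
    have "mball X (1 / (1 + real r)) \<subseteq> B"
    proof
      fix Y assume "Y \<in> mball X (1 / (1 + real r))"
      then have XY: "X \<in> rooted_classes \<Delta> k" "Y \<in> rooted_classes \<Delta> k" "local_dist X Y < 1 / (1 + real r)"
        by auto
      obtain R S where RS: "R \<in> rooted_graphs \<Delta> k" "X = iso_class R" "S \<in> rooted_graphs \<Delta> k" "Y = iso_class S"
        using XY by (auto elim!: rooted_classes_cases)
      show "Y \<in> B"
        using local_eventD[OF assms(2) RS(1,3) local_dist_less_imp_ball_iso[OF RS(1,3)]] XY(3) X
        unfolding RS(2,4) by blast
    qed
    then show "\<exists>e>0. mball X e \<subseteq> B" by (intro exI[of _ "1 / (1 + real r)"]) auto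
  qed
qed

text \<open>\<open>B r\<close> collects the classes for which every graph with the same ball of
  radius \<open>r\<close> lies in \<open>U\<close>. A metric ball inside \<open>U\<close> contains
  all graphs that agree up to a large radius, so these sets exhaust \<open>U\<close>.\<close>

lemma openin_eq_Union_local_events:
  assumes "k > 0" "openin (local_topology \<Delta> k) U"
  shows "\<exists>B. U = (\<Union>r. B r) \<and> (\<forall>r. local_event \<Delta> k r (B r))"
proof -
  interpret Metric_space "rooted_classes \<Delta> k" local_dist
    by (rule Metric_space_local_dist[OF assms(1)])
  let ?B = "\<lambda>r. {iso_class R |R. R \<in> rooted_graphs \<Delta> k \<and>
    (\<forall>S\<in>rooted_graphs \<Delta> k. rooted_ball R r \<cong>\<^sub>r rooted_ball S r \<longrightarrow> iso_class S \<in> U)}"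
  have "local_event \<Delta> k r (?B r)" for r
    unfolding local_event_def
  proof (intro conjI ballI impI)
    show "?B r \<subseteq> rooted_classes \<Delta> k" by auto
    fix R S assume RS: "R \<in> rooted_graphs \<Delta> k" "S \<in> rooted_graphs \<Delta> k"
      "rooted_ball R r \<cong>\<^sub>r rooted_ball S r" "iso_class R \<in> ?B r"
    then obtain R' where R': "R' \<in> rooted_graphs \<Delta> k" "iso_class R = iso_class R'"
      "\<forall>S\<in>rooted_graphs \<Delta> k. rooted_ball R' r \<cong>\<^sub>r rooted_ball S r \<longrightarrow> iso_class S \<in> U" by blast
    have "R' \<cong>\<^sub>r R" using iso_class_self[OF RS(1)] unfolding R'(2) iso_class_iff[OF R'(1)] by blast
    then have "rooted_ball R' r \<cong>\<^sub>r rooted_ball R r"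
      using iso_ball rooted_graphs_well_rooted R'(1) RS(1) by blast
    then have "\<forall>T\<in>rooted_graphs \<Delta> k. rooted_ball S r \<cong>\<^sub>r rooted_ball T r \<longrightarrow> iso_class T \<in> U"
      using R'(3) rooted_iso_trans RS(3) by blast
    then show "iso_class S \<in> ?B r" using RS(2) by blast
  qed
  moreover have "U = (\<Union>r. ?B r)"
  proof (intro equalityI subsetI)
    fix X assume X: "X \<in> U"
    then obtain e where e: "e > 0" "mball X e \<subseteq> U" "X \<in> rooted_classes \<Delta> k"
      using assms(2) unfolding local_topology_def openin_mtopology by blast
    obtain R where R: "R \<in> rooted_graphs \<Delta> k" "X = iso_class R" using e(3) by (rule rooted_classes_cases)
    obtain r where r: "1 / (1 + real r) < e"
      using reals_Archimedean[OF e(1)] by (auto simp: inverse_eq_divide)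
    have "iso_class S \<in> U" if "S \<in> rooted_graphs \<Delta> k" "rooted_ball R r \<cong>\<^sub>r rooted_ball S r" for S
    proof -
      have "iso_class S \<in> mball X e"
        using ball_iso_imp_local_dist_le[OF R(1) that] r e(3) iso_class_in_rooted_classes[OF that(1)]
        unfolding R(2) in_mball by linarith
      then show ?thesis using e(2) by blast
    qed
    then show "X \<in> (\<Union>r. ?B r)" using R by blast
  next
    fix X assume "X \<in> (\<Union>r. ?B r)"
    then obtain r R where "X = iso_class R" "R \<in> rooted_graphs \<Delta> k"
      "\<forall>S\<in>rooted_graphs \<Delta> k. rooted_ball R r \<cong>\<^sub>r rooted_ball S r \<longrightarrow> iso_class S \<in> U" by blast
    then show "X \<in> U"
      using rooted_iso_refl[OF well_rooted_ball[OF rooted_graphs_well_rooted]] by blast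
  qed
  ultimately show ?thesis by (intro exI[of _ ?B]) blast
qed

section \<open>Local events as generators of the Borel sets\<close>

lemma space_local_borel [simp]: "space (local_borel \<Delta> k) = rooted_classes \<Delta> k"
  unfolding local_borel_def by (rule space_measure_of_conv)

lemma local_events_subset: "{B. \<exists>r. local_event \<Delta> k r B} \<subseteq> Pow (rooted_classes \<Delta> k)"
  using local_event_subset by blast

lemma Int_stable_local_events: "Int_stable {B. \<exists>r. local_event \<Delta> k r B}"
proof (rule Int_stableI)
  fix A B assume "A \<in> {B. \<exists>r. local_event \<Delta> k r B}" "B \<in> {B. \<exists>r. local_event \<Delta> k r B}"
  then obtain r s where "local_event \<Delta> k r A" "local_event \<Delta> k s B" by blast
  then have "local_event \<Delta> k (max r s) A" "local_event \<Delta> k (max r s) B"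
    by (auto intro: local_event_mono)
  then show "A \<inter> B \<in> {B. \<exists>r. local_event \<Delta> k r B}" using local_event_Int by blast
qed

lemma sets_local_borel:
  assumes "k > 0"
  shows "sets (local_borel \<Delta> k) = sigma_sets (rooted_classes \<Delta> k) {B. \<exists>r. local_event \<Delta> k r B}"
proof -
  interpret Metric_space "rooted_classes \<Delta> k" local_dist
    by (rule Metric_space_local_dist[OF assms])
  have top: "openin (local_topology \<Delta> k) U \<Longrightarrow> U \<subseteq> rooted_classes \<Delta> k" for U
    unfolding local_topology_def openin_mtopology by blast
  have "sets (local_borel \<Delta> k) = sigma_sets (rooted_classes \<Delta> k) {U. openin (local_topology \<Delta> k) U}"
    unfolding local_borel_def by (rule sets_measure_of) (use top in auto)
  also have "\<dots> = sigma_sets (rooted_classes \<Delta> k) {B. \<exists>r. local_event \<Delta> k r B}"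
  proof (rule sigma_sets_eqI)
    fix U assume "U \<in> {U. openin (local_topology \<Delta> k) U}"
    then have "openin (local_topology \<Delta> k) U" by simp
    from openin_eq_Union_local_events[OF assms this]
    obtain B where U: "U = (\<Union>r. B r)" and B: "\<forall>r. local_event \<Delta> k r (B r)"
      by (elim exE conjE)
    have "B r \<in> sigma_sets (rooted_classes \<Delta> k) {B. \<exists>r. local_event \<Delta> k r B}" for r
      using B by (intro sigma_sets.Basic) blast
    then show "U \<in> sigma_sets (rooted_classes \<Delta> k) {B. \<exists>r. local_event \<Delta> k r B}"
      unfolding U by (rule sigma_sets.Union)
  qed (use openin_local_event[OF assms] in auto)
  finally show ?thesis .
qed

lemma local_event_sets: "k > 0 \<Longrightarrow> local_event \<Delta> k r B \<Longrightarrow> B \<in> sets (local_borel \<Delta> k)"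
  unfolding sets_local_borel by blast

lemma measurable_local_borelI:
  assumes "k > 0" "f \<in> space M \<rightarrow> rooted_classes \<Delta> k"
    and "\<And>r B. local_event \<Delta> k r B \<Longrightarrow> f -` B \<inter> space M \<in> sets M"
  shows "f \<in> measurable M (local_borel \<Delta> k)"
  by (rule measurable_sigma_sets[OF sets_local_borel[OF assms(1)] local_events_subset assms(2)])
     (use assms(3) in blast)

definition class_set :: "nat \<Rightarrow> nat \<Rightarrow> (nat rooted \<Rightarrow> bool) \<Rightarrow> nat rooted set set" where
  "class_set \<Delta> k P = {iso_class R |R. R \<in> rooted_graphs \<Delta> k \<and> P R}"

text \<open>Isomorphic graphs have isomorphic balls, so a property that is local in the sense of the
  hypothesis is isomorphism invariant, and membership of a class can be tested on any
  representative.\<close>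

lemma local_event_class_set:
  assumes "\<And>R S. R \<in> rooted_graphs \<Delta> k \<Longrightarrow> S \<in> rooted_graphs \<Delta> k \<Longrightarrow>
      rooted_ball R r \<cong>\<^sub>r rooted_ball S r \<Longrightarrow> P R \<Longrightarrow> P S"
  shows "local_event \<Delta> k r (class_set \<Delta> k P)"
    and "R \<in> rooted_graphs \<Delta> k \<Longrightarrow> iso_class R \<in> class_set \<Delta> k P \<longleftrightarrow> P R"
proof -
  have *: "P R" if R: "R \<in> rooted_graphs \<Delta> k" and cl: "iso_class R \<in> class_set \<Delta> k P" for R
  proof -
    obtain S where S: "S \<in> rooted_graphs \<Delta> k" "P S" "iso_class R = iso_class S"
      using cl unfolding class_set_def by blast
    have "S \<cong>\<^sub>r R" using iso_class_self[OF R] unfolding S(3) iso_class_iff[OF S(1)] by blast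
    then have "rooted_ball S r \<cong>\<^sub>r rooted_ball R r"
      using iso_ball rooted_graphs_well_rooted R S(1) by blast
    then show ?thesis using assms R S by blast
  qed
  show "R \<in> rooted_graphs \<Delta> k \<Longrightarrow> iso_class R \<in> class_set \<Delta> k P \<longleftrightarrow> P R"
    using * unfolding class_set_def by blast
  show "local_event \<Delta> k r (class_set \<Delta> k P)"
    unfolding local_event_def using * assms unfolding class_set_def by blast
qed

text \<open>Approximation by a generating algebra: the approximable sets contain the local events
  and are closed under complements and countable disjoint unions.\<close>

lemma local_event_approx:
  assumes fin: "finite_measure M" and k: "k > 0" and M: "sets M = sets (local_borel \<Delta> k)" and A: "A \<in> sets M" and e: "e > 0"
  shows "\<exists>r B. local_event \<Delta> k r B \<and> measure M ((A - B) \<union> (B - A)) < e"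
proof -
  interpret finite_measure M by (rule fin)
  have S: "sets M = sigma_sets (rooted_classes \<Delta> k) {B. \<exists>r. local_event \<Delta> k r B}"
    using M sets_local_borel[OF k] by simp
  have le[measurable]: "B \<in> sets M" if "local_event \<Delta> k r B" for r B
    using that local_event_sets[OF k] M by blast
  show ?thesis using A[unfolded S] e
  proof (induction A arbitrary: e rule: sigma_sets_induct_disjoint[OF Int_stable_local_events local_events_subset, consumes 1, case_names basic empty compl union])
    case (basic A)
    then obtain r where "local_event \<Delta> k r A" by blast
    then show ?case using basic(2) by (intro exI[of _ r] exI[of _ A]) simp
  next
    case empty
    then show ?case using local_event_empty by (intro exI[of _ 0] exI[of _ "{}"]) auto
  next
    case (compl A)
    then obtain r B where B: "local_event \<Delta> k r B" "measure M ((A - B) \<union> (B - A)) < e" by blast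
    have "A \<subseteq> rooted_classes \<Delta> k" using compl(1) sets.sets_into_space[of A "local_borel \<Delta> k"] S M by simp
    then have "((rooted_classes \<Delta> k - A) - (rooted_classes \<Delta> k - B)) \<union>
        ((rooted_classes \<Delta> k - B) - (rooted_classes \<Delta> k - A)) = (A - B) \<union> (B - A)"
      using local_event_subset[OF B(1)] by blast
    then show ?case using B local_event_Compl by metis
  next
    case (union A)
    have A[measurable]: "A i \<in> sets M" for i using union(2) S by auto
    let ?U = "\<lambda>n. \<Union>i<n. A i"
    have "(\<lambda>n. measure M (?U n)) \<longlonglongrightarrow> measure M (\<Union>n. ?U n)"
      by (rule finite_Lim_measure_incseq) (auto simp: incseq_def, force)
    moreover have "(\<Union>n. ?U n) = (\<Union>i. A i)" by auto
    ultimately have "\<forall>\<^sub>F n in sequentially. dist (measure M (?U n)) (measure M (\<Union>i. A i)) < e / 2"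
      using union(4) tendstoD[of _ _ _ "e / 2"] by simp
    then obtain n where n: "dist (measure M (?U n)) (measure M (\<Union>i. A i)) < e / 2"
      by (meson eventually_sequentially order_refl)
    have "measure M ((\<Union>i. A i) - ?U n) = measure M (\<Union>i. A i) - measure M (?U n)"
      by (rule finite_measure_Diff) auto
    then have n': "measure M ((\<Union>i. A i) - ?U n) < e / 2" using n unfolding dist_real_def by linarith
    \<comment> \<open>Half of \<open>e\<close> is spent on cutting the union off at
      \<open>n\<close>; the other half is shared by the \<open>n\<close> remaining pieces. The
      \<open>+ 1\<close> covers \<open>n = 0\<close>.\<close>
    have "\<exists>r B. local_event \<Delta> k r B \<and> measure M ((A i - B) \<union> (B - A i)) < e / (2 * (real n + 1))" for i
      by (rule union(3)) (use union(4) in simp)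
    then obtain B where B: "\<And>i. \<exists>r. local_event \<Delta> k r (B i)"
      "\<And>i. measure M ((A i - B i) \<union> (B i - A i)) < e / (2 * (real n + 1))" by metis
    have [measurable]: "B i \<in> sets M" for i using B(1) le by blast
    obtain r where r: "local_event \<Delta> k r (\<Union>i<n. B i)" using local_event_UN[of "{..<n}"] B(1) by blast
    let ?D = "\<lambda>i. (A i - B i) \<union> (B i - A i)"
    have "measure M (((\<Union>i. A i) - (\<Union>i<n. B i)) \<union> ((\<Union>i<n. B i) - (\<Union>i. A i)))
        \<le> measure M (((\<Union>i. A i) - ?U n) \<union> (\<Union>i<n. ?D i))"
      by (rule finite_measure_mono) (blast, measurable)
    also have "\<dots> \<le> measure M ((\<Union>i. A i) - ?U n) + measure M (\<Union>i<n. ?D i)"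
      by (rule measure_subadditive) auto
    also have "measure M (\<Union>i<n. ?D i) \<le> (\<Sum>i<n. measure M (?D i))"
      by (rule measure_UNION_le) auto
    also have "\<dots> \<le> (\<Sum>i<n. e / (2 * (real n + 1)))"
      by (intro sum_mono less_imp_le B(2))
    also have "\<dots> \<le> e / 2" using union(4) by (simp add: field_simps)
    finally show ?case using n' r by (intro exI[of _ r] exI[of _ "\<Union>i<n. B i"]) auto
  qed
qed

section \<open>Rerooting and mass transport\<close>

text \<open>\<open>f v x\<close> lists roots built from the root \<open>v\<close> and a further vertex \<open>x\<close>; naturality makes the
  induced map on isomorphism classes well defined.\<close>
definition rerooting :: "(nat \<Rightarrow> nat \<Rightarrow> nat list) \<Rightarrow> nat \<Rightarrow> bool" where
  "rerooting f k \<longleftrightarrow> (\<forall>\<phi> u v. map \<phi> (f u v) = f (\<phi> u) (\<phi> v)) \<and> (\<forall>u v. set (f u v) \<subseteq> {u, v} \<and> length (f u v) = k)"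

text \<open>Listing the same pair in both orders turns the two sides of the mass-transport principle
  into one functional at two rerootings.\<close>

definition out_roots :: "nat \<Rightarrow> nat \<Rightarrow> nat list" where "out_roots u v = [u, v]"
definition in_roots :: "nat \<Rightarrow> nat \<Rightarrow> nat list" where "in_roots u v = [v, u]"

lemma rerooting_out: "rerooting out_roots 2" and rerooting_in: "rerooting in_roots 2"
  unfolding rerooting_def out_roots_def in_roots_def by auto

lemma rerooting_rooted_graphs:
  assumes "rerooting f k" "(G, [v]) \<in> rooted_graphs \<Delta> 1" "x \<in> Verts G"
  shows "(G, f v x) \<in> rooted_graphs \<Delta> k"
  using assms unfolding rerooting_def rooted_graphs_def by auto blast

text \<open>\<open>card\<close> would be 0 on an infinite set; the count is used together with
  \<open>reroots_within\<close>, which makes the set finite.\<close>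

definition reroot_count :: "(nat \<Rightarrow> nat \<Rightarrow> nat list) \<Rightarrow> nat rooted set set \<Rightarrow> nat rooted set \<Rightarrow> nat" where
  "reroot_count f B X = card {x \<in> Verts (graph_of X). iso_class (graph_of X, f (hd (roots_of X)) x) \<in> B}"

text \<open>Transport of range at most \<open>q\<close>. This makes the counts finite, bounded
  uniformly, and visible in a ball.\<close>

definition reroots_within :: "nat \<Rightarrow> (nat \<Rightarrow> nat \<Rightarrow> nat list) \<Rightarrow> nat \<Rightarrow> nat rooted set set \<Rightarrow> bool" where
  "reroots_within \<Delta> f q B \<longleftrightarrow> (\<forall>G v x. (G, [v]) \<in> rooted_graphs \<Delta> 1 \<longrightarrow> x \<in> Verts G \<longrightarrow>
     iso_class (G, f v x) \<in> B \<longrightarrow> x \<in> reach (G, [v]) q)"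

lemma reroots_within_subset: "reroots_within \<Delta> f q B \<Longrightarrow> A \<subseteq> B \<Longrightarrow> reroots_within \<Delta> f q A"
  unfolding reroots_within_def by blast

text \<open>By finite range only vertices within distance \<open>q\<close> of the root are counted.
  An isomorphism of balls of radius \<open>q + r\<close> maps these bijectively and preserves the
  balls of radius \<open>r\<close> around the new roots, hence membership in
  \<open>B\<close>.\<close>

lemma card_reroot_ball_iso:
  assumes f: "rerooting f k" and B: "local_event \<Delta> k r B" "reroots_within \<Delta> f q B"
    and R: "(G, [v]) \<in> rooted_graphs \<Delta> 1" and S: "(H, [w]) \<in> rooted_graphs \<Delta> 1"
    and i: "rooted_ball (G, [v]) (q + r) \<cong>\<^sub>r rooted_ball (H, [w]) (q + r)"
  shows "card {x \<in> Verts G. iso_class (G, f v x) \<in> B} = card {x \<in> Verts H. iso_class (H, f w x) \<in> B}"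
proof -
  note ok = rooted_graphs_well_rooted[OF R] rooted_graphs_well_rooted[OF S]
  obtain \<phi> where \<phi>: "graph_iso \<phi> (fst (rooted_ball (G, [v]) (q + r))) (fst (rooted_ball (H, [w]) (q + r)))"
      "map \<phi> (snd (G, [v])) = snd (H, [w])"
    using i by (rule ball_isoE)
  have \<phi>v: "\<phi> v = w" using \<phi>(2) by simp
  have b: "bij_betw \<phi> (reach (G, [v]) q) (reach (H, [w]) q)"
    by (rule ball_iso_mono_reach[OF ok \<phi>]) simp
  have r0: "v \<in> reach (G, [v]) q" using reach_mono[of 0 q "(G, [v])"] by (simp add: reach_0)
  have V: "reach (G, [v]) q \<subseteq> Verts G" "reach (H, [w]) q \<subseteq> Verts H"
    using reach_verts[OF ok(1)] reach_verts[OF ok(2)] by auto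
  have *: "iso_class (G, f v x) \<in> B \<longleftrightarrow> iso_class (H, f w (\<phi> x)) \<in> B" if x: "x \<in> reach (G, [v]) q" for x
  proof (rule local_eventD[OF B(1)])
    have "set (f v x) \<subseteq> {v, x}" "map \<phi> (f v x) = f w (\<phi> x)"
      using f \<phi>v unfolding rerooting_def by auto
    then show "rooted_ball (G, f v x) r \<cong>\<^sub>r rooted_ball (H, f w (\<phi> x)) r"
      using subroot_ball_iso[OF ok \<phi>, of "f v x" q r] r0 x by auto
    show "(G, f v x) \<in> rooted_graphs \<Delta> k" using rerooting_rooted_graphs[OF f R] x V by blast
    show "(H, f w (\<phi> x)) \<in> rooted_graphs \<Delta> k"
      using rerooting_rooted_graphs[OF f S] bij_betw_apply[OF b x] V by blast
  qed
  have 1: "{x \<in> Verts G. iso_class (G, f v x) \<in> B} = {x \<in> reach (G, [v]) q. iso_class (G, f v x) \<in> B}"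
    using B(2) R V(1) unfolding reroots_within_def by blast
  have 2: "{x \<in> Verts H. iso_class (H, f w x) \<in> B} = {x \<in> reach (H, [w]) q. iso_class (H, f w x) \<in> B}"
    using B(2) S V(2) unfolding reroots_within_def by blast
  have im: "\<phi> ` {x \<in> reach (G, [v]) q. iso_class (G, f v x) \<in> B} = {x \<in> reach (H, [w]) q. iso_class (H, f w x) \<in> B}"
    using * unfolding bij_betw_imp_surj_on[OF b, symmetric] by blast
  have "inj_on \<phi> {x \<in> reach (G, [v]) q. iso_class (G, f v x) \<in> B}"
    using bij_betw_imp_inj_on[OF b] by (rule inj_on_subset) blast
  from card_image[OF this] show ?thesis unfolding 1 2 im by simp
qed

text \<open>Independence of the representative: the graph and the chosen representative have
  isomorphic balls of every radius.\<close>

lemma reroot_count_iso_class: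
  assumes f: "rerooting f k" and B: "local_event \<Delta> k r B" "reroots_within \<Delta> f q B"
    and R: "(G, [v]) \<in> rooted_graphs \<Delta> 1"
  shows "reroot_count f B (iso_class (G, [v])) = card {x \<in> Verts G. iso_class (G, f v x) \<in> B}"
proof -
  let ?X = "iso_class (G, [v])"
  have X: "?X \<in> rooted_classes \<Delta> 1" using R by blast
  have rep: "(graph_of ?X, [hd (roots_of ?X)]) \<in> rooted_graphs \<Delta> 1"
    using rep_rooted_graph[OF X] rep_roots_1[OF X] by simp
  have "(G, [v]) \<cong>\<^sub>r (graph_of ?X, [hd (roots_of ?X)])"
    using rep_iso[OF R] rep_roots_1(1)[OF X] by simp
  from iso_ball[OF rooted_graphs_well_rooted[OF R] rooted_graphs_well_rooted[OF rep] this]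
  show ?thesis using card_reroot_ball_iso[OF f B R rep] unfolding reroot_count_def by simp
qed

definition local_function :: "nat \<Rightarrow> nat \<Rightarrow> nat \<Rightarrow> (nat rooted set \<Rightarrow> 'b) \<Rightarrow> bool" where
  "local_function \<Delta> k r h \<longleftrightarrow> (\<forall>R\<in>rooted_graphs \<Delta> k. \<forall>S\<in>rooted_graphs \<Delta> k.
     rooted_ball R r \<cong>\<^sub>r rooted_ball S r \<longrightarrow> h (iso_class R) = h (iso_class S))"

lemma local_event_vimage:
  assumes "local_function \<Delta> k r h"
  shows "local_event \<Delta> k r {X \<in> rooted_classes \<Delta> k. P (h X)}"
proof -
  have "P (h (iso_class S))" if "R \<in> rooted_graphs \<Delta> k" "S \<in> rooted_graphs \<Delta> k"
    "rooted_ball R r \<cong>\<^sub>r rooted_ball S r" "P (h (iso_class R))" for R S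
    using assms that unfolding local_function_def by metis
  then show ?thesis unfolding local_event_def by blast
qed

lemma measurable_local_function:
  fixes h :: "nat rooted set \<Rightarrow> 'b"
  assumes "k > 0" "local_function \<Delta> k r h"
  shows "h \<in> measurable (local_borel \<Delta> k) (count_space UNIV)"
proof (rule measurableI)
  fix A :: "'b set" assume "A \<in> sets (count_space UNIV)"
  have "local_event \<Delta> k r {X \<in> rooted_classes \<Delta> k. h X \<in> A}"
    by (rule local_event_vimage[OF assms(2)])
  moreover have "h -` A \<inter> space (local_borel \<Delta> k) = {X \<in> rooted_classes \<Delta> k. h X \<in> A}" by auto
  ultimately show "h -` A \<inter> space (local_borel \<Delta> k) \<in> sets (local_borel \<Delta> k)"
    using local_event_sets[OF assms(1)] by simp
qed simp

lemma local_function_reroot_count: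
  assumes f: "rerooting f k" and B: "local_event \<Delta> k r B" "reroots_within \<Delta> f q B"
  shows "local_function \<Delta> 1 (q + r) (reroot_count f B)"
  unfolding local_function_def
proof (intro ballI impI)
  fix R S assume RS: "R \<in> rooted_graphs \<Delta> 1" "S \<in> rooted_graphs \<Delta> 1"
    "rooted_ball R (q + r) \<cong>\<^sub>r rooted_ball S (q + r)"
  obtain G v H w where "R = (G, [v])" "S = (H, [w])" using RS(1,2) by (metis rooted_graphs_1E)
  then show "reroot_count f B (iso_class R) = reroot_count f B (iso_class S)"
    using reroot_count_iso_class[OF f B] card_reroot_ball_iso[OF f B] RS by simp
qed

lemma finite_reroot_within:
  assumes B: "reroots_within \<Delta> f q B" and R: "(G, [v]) \<in> rooted_graphs \<Delta> 1"
  shows "finite {x \<in> Verts G. iso_class (G, f v x) \<in> B}"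
    and "card {x \<in> Verts G. iso_class (G, f v x) \<in> B} \<le> (1 + \<Delta>) ^ q"
proof -
  have s: "{x \<in> Verts G. iso_class (G, f v x) \<in> B} \<subseteq> reach (G, [v]) q"
    using B R unfolding reroots_within_def by blast
  have d: "well_rooted (G, [v])" "degrees_le \<Delta> (fst (G, [v]))"
    using R rooted_graphs_well_rooted[OF R] unfolding rooted_graphs_def by auto
  show "finite {x \<in> Verts G. iso_class (G, f v x) \<in> B}"
    by (rule finite_subset[OF s reach_finite[OF d]])
  show "card {x \<in> Verts G. iso_class (G, f v x) \<in> B} \<le> (1 + \<Delta>) ^ q"
    using card_mono[OF reach_finite[OF d] s] card_reach_le[OF d, of q] by simp
qed

text \<open>The inner sum of the mass-transport principle: what the root sends for
  \<open>out_roots\<close>, what it receives for \<open>in_roots\<close>.\<close>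

definition mass :: "(nat \<Rightarrow> nat \<Rightarrow> nat list) \<Rightarrow> (nat rooted set \<Rightarrow> ennreal) \<Rightarrow> nat rooted set \<Rightarrow> ennreal" where
  "mass f F X = (\<integral>\<^sup>+x. F (iso_class (graph_of X, f (hd (roots_of X)) x)) \<partial>count_space (Verts (graph_of X)))"

lemma unimodular_mass:
  "unimodular \<Delta> \<mu> \<longleftrightarrow> random_rooted_graph \<Delta> \<mu> \<and> (\<forall>F\<in>borel_measurable (local_borel \<Delta> 2).
     (\<integral>\<^sup>+X. mass out_roots F X \<partial>\<mu>) = (\<integral>\<^sup>+X. mass in_roots F X \<partial>\<mu>))"
  unfolding unimodular_def mass_def Ball_def out_roots_def in_roots_def ..

lemma rep_graph_1:
  assumes "X \<in> rooted_classes \<Delta> 1"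
  shows "(graph_of X, [hd (roots_of X)]) \<in> rooted_graphs \<Delta> 1"
  using rep_rooted_graph[OF assms] rep_roots_1[OF assms] by simp

lemma reroot_class:
  assumes "rerooting f k" "X \<in> rooted_classes \<Delta> 1" "x \<in> Verts (graph_of X)"
  shows "iso_class (graph_of X, f (hd (roots_of X)) x) \<in> rooted_classes \<Delta> k"
  using rerooting_rooted_graphs[OF assms(1) rep_graph_1[OF assms(2)] assms(3)] by blast

lemma mass_indicator:
  assumes "reroots_within \<Delta> f q B" and "X \<in> rooted_classes \<Delta> 1"
  shows "mass f (indicator B) X = of_nat (reroot_count f B X)"
proof -
  let ?g = "\<lambda>x. iso_class (graph_of X, f (hd (roots_of X)) x)"
  have "mass f (indicator B) X = (\<integral>\<^sup>+x. indicator {x \<in> Verts (graph_of X). ?g x \<in> B} x \<partial>count_space (Verts (graph_of X)))"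
    unfolding mass_def by (rule nn_integral_cong) (auto split: split_indicator)
  also have "\<dots> = emeasure (count_space (Verts (graph_of X))) {x \<in> Verts (graph_of X). ?g x \<in> B}"
    by (rule nn_integral_indicator) auto
  also have "\<dots> = of_nat (reroot_count f B X)"
    unfolding reroot_count_def
    by (rule emeasure_count_space_finite) (use finite_reroot_within(1)[OF assms(1) rep_graph_1[OF assms(2)]] in auto)
  finally show ?thesis .
qed

lemma reroot_count_le:
  assumes "reroots_within \<Delta> f q B" and "X \<in> rooted_classes \<Delta> 1"
  shows "reroot_count f B X \<le> (1 + \<Delta>) ^ q"
  unfolding reroot_count_def by (rule finite_reroot_within(2)[OF assms(1) rep_graph_1[OF assms(2)]])

section \<open>The mass as a functional of the transport function\<close>

lemma mass_cong:
  assumes "rerooting f k" "X \<in> rooted_classes \<Delta> 1" "\<And>Z. Z \<in> rooted_classes \<Delta> k \<Longrightarrow> F Z = F' Z"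
  shows "mass f F X = mass f F' X"
  unfolding mass_def by (rule nn_integral_cong) (simp add: assms(3) reroot_class[OF assms(1,2)])

lemma mass_add: "mass f (\<lambda>Z. F Z + F' Z) X = mass f F X + mass f F' X"
  unfolding mass_def by (rule nn_integral_add) auto

lemma mass_cmult: "mass f (\<lambda>Z. c * F Z) X = c * mass f F X"
  unfolding mass_def by (rule nn_integral_cmult) auto

lemma mass_SUP: "incseq F \<Longrightarrow> mass f (\<lambda>Z. SUP i. F i Z) X = (SUP i. mass f (F i) X)"
  unfolding mass_def
  by (rule nn_integral_monotone_convergence_SUP) (auto simp: incseq_def le_fun_def)

lemma mass_mono: "F \<le> F' \<Longrightarrow> mass f F X \<le> mass f F' X"
  unfolding mass_def by (rule nn_integral_mono) (auto simp: le_fun_def)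

section \<open>Pairs of roots at bounded distance\<close>

definition near :: "nat \<Rightarrow> nat \<Rightarrow> nat rooted set set" where
  "near \<Delta> q = class_set \<Delta> 2 (\<lambda>R. snd R ! 1 \<in> reach (fst R, [snd R ! 0]) q)"

definition adjacent :: "nat \<Rightarrow> nat rooted set set" where
  "adjacent \<Delta> = class_set \<Delta> 2 (\<lambda>R. {snd R ! 0, snd R ! 1} \<in> Edges (fst R))"

lemma ball_iso_edges:
  assumes i: "graph_iso \<phi> (fst (rooted_ball R s)) (fst (rooted_ball S s))"
    and ok: "well_rooted R" "well_rooted S" and m: "map \<phi> (snd R) = snd S"
    and u: "u \<in> reach R s" "v \<in> reach R s"
  shows "{u, v} \<in> Edges (fst R) \<longleftrightarrow> {\<phi> u, \<phi> v} \<in> Edges (fst S)"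
proof -
  have "u \<in> Verts (fst R)" "v \<in> Verts (fst R)" using u reach_verts[OF ok(1)] by auto
  moreover have "\<phi> u \<in> reach S s" "\<phi> v \<in> reach S s"
    using bij_betw_apply[OF ball_iso_mono_reach[OF ok i m order_refl]] u by auto
  ultimately show ?thesis
    using i u unfolding graph_iso_def rooted_ball_eq by (auto simp: induced_subgraph_def)
qed

text \<open>The ball of radius \<open>q\<close> around both roots contains the one around the first
  root, together with all paths of length at most \<open>q\<close> that start there.\<close>

lemma
  shows local_event_near: "local_event \<Delta> 2 q (near \<Delta> q)"
    and near_iff: "(G, [u, v]) \<in> rooted_graphs \<Delta> 2 \<Longrightarrow> iso_class (G, [u, v]) \<in> near \<Delta> q \<longleftrightarrow> v \<in> reach (G, [u]) q"
proof -
  have *: "snd S ! 1 \<in> reach (fst S, [snd S ! 0]) q"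
    if R: "R \<in> rooted_graphs \<Delta> 2" and S: "S \<in> rooted_graphs \<Delta> 2"
      and i: "rooted_ball R q \<cong>\<^sub>r rooted_ball S q" and r: "snd R ! 1 \<in> reach (fst R, [snd R ! 0]) q" for R S
  proof -
    note ok = rooted_graphs_well_rooted[OF R] rooted_graphs_well_rooted[OF S]
    obtain \<phi> where \<phi>: "graph_iso \<phi> (fst (rooted_ball R q)) (fst (rooted_ball S q))" "map \<phi> (snd R) = snd S"
      using i by (rule ball_isoE)
    obtain G a b where G: "R = (G, [a, b])" using R by (rule rooted_graphs_2E)
    obtain H c d where H: "S = (H, [c, d])" using S by (rule rooted_graphs_2E)
    have sub: "reach (G, [a]) q \<subseteq> reach R q" using reach_trans[of "[a]" R 0 q] by (simp add: G reach_0)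
    have "\<phi> ` reach (G, [a]) q \<subseteq> reach (H, [c]) q"
      by (rule reach_image[where s = q])
         (use ball_iso_edges[OF \<phi>(1) ok \<phi>(2)] sub \<phi>(2) in \<open>auto simp: G H\<close>)
    then show ?thesis using r \<phi>(2) by (auto simp: G H)
  qed
  show "local_event \<Delta> 2 q (near \<Delta> q)" unfolding near_def by (rule local_event_class_set(1)) (rule *)
  show "(G, [u, v]) \<in> rooted_graphs \<Delta> 2 \<Longrightarrow> iso_class (G, [u, v]) \<in> near \<Delta> q \<longleftrightarrow> v \<in> reach (G, [u]) q"
    unfolding near_def by (subst local_event_class_set(2)[OF *]) auto
qed

text \<open>Radius 0 suffices because balls are induced subgraphs: around two roots the ball of
  radius 0 consists of the roots and the edge between them, if there is one.\<close>

lemma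
  shows local_event_adjacent: "local_event \<Delta> 2 0 (adjacent \<Delta>)"
    and adjacent_iff: "(G, [u, v]) \<in> rooted_graphs \<Delta> 2 \<Longrightarrow> iso_class (G, [u, v]) \<in> adjacent \<Delta> \<longleftrightarrow> {u, v} \<in> Edges G"
proof -
  have *: "{snd S ! 0, snd S ! 1} \<in> Edges (fst S)"
    if R: "R \<in> rooted_graphs \<Delta> 2" and S: "S \<in> rooted_graphs \<Delta> 2"
      and i: "rooted_ball R 0 \<cong>\<^sub>r rooted_ball S 0" and r: "{snd R ! 0, snd R ! 1} \<in> Edges (fst R)" for R S
  proof -
    note ok = rooted_graphs_well_rooted[OF R] rooted_graphs_well_rooted[OF S]
    obtain \<phi> where \<phi>: "graph_iso \<phi> (fst (rooted_ball R 0)) (fst (rooted_ball S 0))" "map \<phi> (snd R) = snd S"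
      using i by (rule ball_isoE)
    obtain G a b where G: "R = (G, [a, b])" using R by (rule rooted_graphs_2E)
    obtain H c d where H: "S = (H, [c, d])" using S by (rule rooted_graphs_2E)
    show ?thesis
      using ball_iso_edges[OF \<phi>(1) ok \<phi>(2), of a b] \<phi>(2) r by (auto simp: G H reach_0)
  qed
  show "local_event \<Delta> 2 0 (adjacent \<Delta>)" unfolding adjacent_def by (rule local_event_class_set(1)) (rule *)
  show "(G, [u, v]) \<in> rooted_graphs \<Delta> 2 \<Longrightarrow> iso_class (G, [u, v]) \<in> adjacent \<Delta> \<longleftrightarrow> {u, v} \<in> Edges G"
    unfolding adjacent_def by (subst local_event_class_set(2)[OF *]) auto
qed

lemma reroots_within_near_sets:
  shows "reroots_within \<Delta> out_roots q (near \<Delta> q)" and "reroots_within \<Delta> in_roots q (near \<Delta> q)"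
  using near_iff rerooting_rooted_graphs[OF rerooting_out] rerooting_rooted_graphs[OF rerooting_in] reach_sym
  unfolding reroots_within_def out_roots_def in_roots_def by metis+

lemma adjacent_subset_near: "adjacent \<Delta> \<subseteq> near \<Delta> 1"
proof
  fix Z assume Z: "Z \<in> adjacent \<Delta>"
  then have "Z \<in> rooted_classes \<Delta> 2" using local_event_subset[OF local_event_adjacent] by blast
  then obtain R where R: "R \<in> rooted_graphs \<Delta> 2" "Z = iso_class R" by (rule rooted_classes_cases)
  obtain G u v where G: "R = (G, [u, v])" using R(1) by (rule rooted_graphs_2E)
  have "{u, v} \<in> Edges G" using Z R adjacent_iff unfolding G by simp
  then have "v \<in> reach (G, [u]) 1" using reach_step[of u "(G, [u])" 0 v] by (simp add: reach_0)
  then show "Z \<in> near \<Delta> 1" using R near_iff unfolding G by simp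
qed

lemma near_mono:
  assumes "q \<le> q'" shows "near \<Delta> q \<subseteq> near \<Delta> q'"
proof -
  have "v \<in> reach R q'" if "v \<in> reach R q" for v and R :: "nat rooted"
    using that reach_mono[OF assms, of R] by (rule rev_subsetD)
  then show ?thesis unfolding near_def class_set_def by fast
qed

text \<open>Connectedness puts the two roots at finite distance, so truncations to bounded range
  exhaust the space.\<close>

lemma Union_near: "(\<Union>q. near \<Delta> q) = rooted_classes \<Delta> 2"
proof
  show "(\<Union>q. near \<Delta> q) \<subseteq> rooted_classes \<Delta> 2" using local_event_subset[OF local_event_near] by blast
  show "rooted_classes \<Delta> 2 \<subseteq> (\<Union>q. near \<Delta> q)"
  proof
    fix Z assume "Z \<in> rooted_classes \<Delta> 2"
    then obtain R where R: "R \<in> rooted_graphs \<Delta> 2" "Z = iso_class R" by (rule rooted_classes_cases)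
    obtain G u v where G: "R = (G, [u, v])" using R(1) by (rule rooted_graphs_2E)
    have "\<exists>q. v \<in> reach (G, [u]) q"
      by (rule reach_all) (use R in \<open>auto simp: G rooted_graphs_def well_rooted_def\<close>)
    then show "Z \<in> (\<Union>q. near \<Delta> q)" using R near_iff unfolding G by auto
  qed
qed

section \<open>Forgetting one of two roots\<close>

definition root_class :: "nat \<Rightarrow> nat rooted set \<Rightarrow> nat rooted set" where
  "root_class i Z = iso_class (graph_of Z, [roots_of Z ! i])"

text \<open>The ball of radius \<open>r\<close> around one root lies inside the ball around both, so
  no larger radius is required.\<close>

lemma local_event_root_class:
  assumes "i < 2" and A: "local_event \<Delta> 1 r A"
  shows "local_event \<Delta> 2 r {Z \<in> rooted_classes \<Delta> 2. root_class i Z \<in> A}"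
proof -
  have *: "iso_class (fst S, [snd S ! i]) \<in> A"
    if R: "R \<in> rooted_graphs \<Delta> 2" and S: "S \<in> rooted_graphs \<Delta> 2"
      and i: "rooted_ball R r \<cong>\<^sub>r rooted_ball S r" and r: "iso_class (fst R, [snd R ! i]) \<in> A" for R S
  proof -
    note ok = rooted_graphs_well_rooted[OF R] rooted_graphs_well_rooted[OF S]
    obtain \<phi> where \<phi>: "graph_iso \<phi> (fst (rooted_ball R r)) (fst (rooted_ball S r))" "map \<phi> (snd R) = snd S"
      using i by (rule ball_isoE)
    have l: "length (snd R) = 2" "length (snd S) = 2" using R S unfolding rooted_graphs_def by auto
    then have n: "snd R ! i \<in> set (snd R)" "snd S ! i \<in> set (snd S)" using assms(1) by auto
    have "rooted_ball (fst R, [snd R ! i]) r \<cong>\<^sub>r rooted_ball (fst S, map \<phi> [snd R ! i]) r"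
      by (rule subroot_ball_iso[OF ok \<phi>, of _ 0]) (use n in \<open>auto simp: reach_0\<close>)
    moreover have "map \<phi> [snd R ! i] = [snd S ! i]" using \<phi>(2)[symmetric] l assms(1) by simp
    moreover have "(fst R, [snd R ! i]) \<in> rooted_graphs \<Delta> 1" "(fst S, [snd S ! i]) \<in> rooted_graphs \<Delta> 1"
      using R S n unfolding rooted_graphs_def by auto
    ultimately show ?thesis using local_eventD[OF A] r by metis
  qed
  have "{Z \<in> rooted_classes \<Delta> 2. root_class i Z \<in> A} = class_set \<Delta> 2 (\<lambda>R. iso_class (fst R, [snd R ! i]) \<in> A)"
    (is "?L = ?R")
  proof -
    have "Z \<in> ?L \<longleftrightarrow> Z \<in> ?R" if Z: "Z \<in> rooted_classes \<Delta> 2" for Z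
      using local_event_class_set(2)[of \<Delta> 2 r "\<lambda>R. iso_class (fst R, [snd R ! i]) \<in> A", OF * rep_rooted_graph[OF Z]]
        iso_class_rep[OF Z] Z unfolding root_class_def by auto
    moreover have "?R \<subseteq> rooted_classes \<Delta> 2" unfolding class_set_def by blast
    ultimately show ?thesis by blast
  qed
  then show "local_event \<Delta> 2 r {Z \<in> rooted_classes \<Delta> 2. root_class i Z \<in> A}"
    using local_event_class_set(1)[of \<Delta> 2 r "\<lambda>R. iso_class (fst R, [snd R ! i]) \<in> A", OF *] by simp
qed

lemma root_class_iso_class:
  assumes "i < 2" and R: "(G, xs) \<in> rooted_graphs \<Delta> 2"
  shows "root_class i (iso_class (G, xs)) = iso_class (G, [xs ! i])"
proof -
  let ?Z = "iso_class (G, xs)"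
  have Z: "(graph_of ?Z, roots_of ?Z) \<in> rooted_graphs \<Delta> 2" by (rule rep_rooted_graph) (use R in blast)
  obtain \<phi> where \<phi>: "graph_iso \<phi> G (graph_of ?Z)" "map \<phi> xs = roots_of ?Z"
    using rep_iso[OF R] unfolding rooted_iso_def by auto
  have l: "xs ! i \<in> set xs" "roots_of ?Z ! i \<in> set (roots_of ?Z)" "length xs = 2"
    using R Z assms(1) unfolding rooted_graphs_def by auto
  have 1: "(G, [xs ! i]) \<in> rooted_graphs \<Delta> 1" "(graph_of ?Z, [roots_of ?Z ! i]) \<in> rooted_graphs \<Delta> 1"
    using R Z l unfolding rooted_graphs_def by auto
  have "(G, [xs ! i]) \<cong>\<^sub>r (graph_of ?Z, [roots_of ?Z ! i])"
    unfolding rooted_iso_def using \<phi> 1 l(3) assms(1) unfolding rooted_graphs_def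
    by (auto intro!: exI[of _ \<phi>] simp flip: \<phi>(2))
  from iso_class_eq[OF 1 this] show ?thesis unfolding root_class_def by simp
qed

lemma measurable_root_class:
  assumes "i < 2" shows "root_class i \<in> measurable (local_borel \<Delta> 2) (local_borel \<Delta> 1)"
proof (rule measurable_local_borelI)
  show "root_class i \<in> space (local_borel \<Delta> 2) \<rightarrow> rooted_classes \<Delta> 1"
  proof (rule Pi_I)
    fix Z assume "Z \<in> space (local_borel \<Delta> 2)"
    then have Z: "(graph_of Z, roots_of Z) \<in> rooted_graphs \<Delta> 2" by (intro rep_rooted_graph) simp
    then have "(graph_of Z, [roots_of Z ! i]) \<in> rooted_graphs \<Delta> 1"
      using assms unfolding rooted_graphs_def by (auto simp: subset_eq)
    then show "root_class i Z \<in> rooted_classes \<Delta> 1" unfolding root_class_def by blast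
  qed
  fix r B assume "local_event \<Delta> 1 r B"
  from local_event_sets[OF _ local_event_root_class[OF assms this]]
  show "root_class i -` B \<inter> space (local_borel \<Delta> 2) \<in> sets (local_borel \<Delta> 2)"
    by (simp add: vimage_def Int_def conj_commute)
qed simp

lemma near_sets: "near \<Delta> q \<in> sets (local_borel \<Delta> 2)"
  by (rule local_event_sets[OF _ local_event_near]) simp

text \<open>A monotone class argument over the algebra of local events of bounded range; the truncation
  to \<open>near \<Delta> q\<close> keeps the masses finite, so that differences can be formed.\<close>
lemma doubly_rooted_function_induct [consumes 1, case_names cong indicator diff mult add SUP]:
  fixes P :: "(nat rooted set \<Rightarrow> ennreal) \<Rightarrow> bool"
  assumes F: "F \<in> borel_measurable (local_borel \<Delta> 2)"
    and cong: "\<And>F F'. (\<And>Z. Z \<in> rooted_classes \<Delta> 2 \<Longrightarrow> F Z = F' Z) \<Longrightarrow> P F \<Longrightarrow> P F'"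
    and loc: "\<And>r B. local_event \<Delta> 2 r B \<Longrightarrow> B \<subseteq> near \<Delta> r \<Longrightarrow> P (indicator B)"
    and diff: "\<And>q A B. A \<in> sets (local_borel \<Delta> 2) \<Longrightarrow> B \<in> sets (local_borel \<Delta> 2) \<Longrightarrow> A \<subseteq> B \<Longrightarrow>
        B \<subseteq> near \<Delta> q \<Longrightarrow> P (indicator A) \<Longrightarrow> P (indicator B) \<Longrightarrow> P (indicator (B - A))"
    and mult: "\<And>F c. F \<in> borel_measurable (local_borel \<Delta> 2) \<Longrightarrow> P F \<Longrightarrow> P (\<lambda>Z. c * F Z)"
    and add: "\<And>F F'. F \<in> borel_measurable (local_borel \<Delta> 2) \<Longrightarrow> F' \<in> borel_measurable (local_borel \<Delta> 2) \<Longrightarrow>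
        P F \<Longrightarrow> P F' \<Longrightarrow> P (\<lambda>Z. F Z + F' Z)"
    and SUP: "\<And>F. (\<And>i. F i \<in> borel_measurable (local_borel \<Delta> 2)) \<Longrightarrow> incseq F \<Longrightarrow> (\<And>i. P (F i)) \<Longrightarrow>
        P (\<lambda>Z. SUP i::nat. F i Z)"
  shows "P F"
proof -
  let ?M = "local_borel \<Delta> 2"
  have ind: "indicator A \<in> borel_measurable ?M" if "A \<in> sets ?M" for A
    using that by simp
  have SUP_ind: "P (indicator (\<Union>i. A i))" if A: "\<And>i::nat. A i \<in> sets ?M" "incseq A" "\<And>i. P (indicator (A i))" for A
  proof -
    have *: "P (\<lambda>Z. SUP i. indicator (A i) Z)"
      by (rule SUP) (use A ind in \<open>auto simp: incseq_def le_fun_def split: split_indicator\<close>)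
    have "(SUP i. indicator (A i) Z) = (indicator (\<Union>i. A i) Z :: ennreal)" for Z
    proof (cases "Z \<in> (\<Union>i. A i)")
      case True
      then obtain i where "Z \<in> A i" by blast
      then show ?thesis using True
        by (intro antisym SUP_least SUP_upper2[of i]) (auto split: split_indicator)
    qed auto
    then have "(\<lambda>Z. SUP i. indicator (A i) Z) = (indicator (\<Union>i. A i) :: _ \<Rightarrow> ennreal)" by (rule ext)
    from subst[of _ _ P, OF this *] show ?thesis .
  qed
  have emp: "P (indicator {})" by (rule loc[OF local_event_empty[of _ _ 0]]) simp
  have truncated: "P (indicator (A \<inter> near \<Delta> q))" if A: "A \<in> sets ?M" for A q
    using A unfolding sets_local_borel[OF zero_less_numeral]
  proof (induction A rule: sigma_sets_induct_disjoint[OF Int_stable_local_events local_events_subset,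
        consumes 1, case_names basic empty compl union])
    case (basic A)
    then obtain r where r: "local_event \<Delta> 2 r A" by blast
    \<comment> \<open>The hypothesis \<open>loc\<close> uses one number both as radius of locality
      and as range, hence the maximum.\<close>
    have "local_event \<Delta> 2 (max q r) A" "local_event \<Delta> 2 (max q r) (near \<Delta> q)"
      by (auto intro: local_event_mono[OF r] local_event_mono[OF local_event_near])
    from local_event_Int[OF this] show ?case
      by (rule loc) (use near_mono[of q "max q r"] in auto)
  next
    case empty
    show ?case using emp by (simp only: Int_empty_left)
  next
    case (compl A)
    have "A \<in> sets ?M" using compl(1) by (simp add: sets_local_borel)
    then have "P (indicator (near \<Delta> q - A \<inter> near \<Delta> q))"
      using near_sets by (intro diff[OF _ _ _ order_refl compl(2)] loc[OF local_event_near]) auto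
    moreover have "near \<Delta> q - A \<inter> near \<Delta> q = (rooted_classes \<Delta> 2 - A) \<inter> near \<Delta> q"
      using local_event_subset[OF local_event_near] by blast
    ultimately show ?case by simp
  next
    case (union A)
    have A: "A i \<in> sets ?M" for i using union(2) by (auto simp: sets_local_borel)
    let ?B = "\<lambda>n. (\<Union>i<n. A i) \<inter> near \<Delta> q"
    have B: "?B n \<in> sets ?M" for n using A near_sets by auto
    \<comment> \<open>Disjointness lets the partial unions be built with \<open>add\<close>; the
      full union is then an increasing limit.\<close>
    have "P (indicator (?B n))" for n
    proof (induction n)
      case 0 show ?case using emp by (simp only: lessThan_0 UN_empty Int_empty_left)
    next
      case (Suc n)
      have "P (\<lambda>Z. indicator (A n \<inter> near \<Delta> q) Z + indicator (?B n) Z)"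
        by (rule add[OF _ _ union(3) Suc]) (use A near_sets B in \<open>auto intro!: ind\<close>)
      moreover have "indicator (A n \<inter> near \<Delta> q) Z + indicator (?B n) Z = (indicator (?B (Suc n)) Z :: ennreal)" for Z
      proof -
        have "A n \<inter> A i = {}" if "i < n" for i
          using union(1) that unfolding disjoint_family_on_def by auto
        then show ?thesis by (auto simp: lessThan_Suc split: split_indicator)
      qed
      ultimately show ?case by simp
    qed
    then have "P (indicator (\<Union>n. ?B n))"
      by (intro SUP_ind B) (auto simp: incseq_def, force)
    moreover have "(\<Union>n. ?B n) = (\<Union>i. A i) \<inter> near \<Delta> q" by auto
    ultimately show ?case by simp
  qed
  have ind_P: "P (indicator A)" if A: "A \<in> sets ?M" for A
  proof -
    have "P (indicator (\<Union>q. A \<inter> near \<Delta> q))"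
      by (intro SUP_ind truncated A sets.Int near_sets) (use near_mono in \<open>fastforce simp: incseq_def\<close>)
    moreover have "(\<Union>q. A \<inter> near \<Delta> q) = A"
      using sets.sets_into_space[OF A] Union_near[of \<Delta>] by auto
    ultimately show ?thesis by simp
  qed
  from F show ?thesis
  proof (induction F rule: borel_measurable_induct)
    case (cong f g) then show ?case using assms(2)[of g f] by simp
  next
    case (set A) then show ?case by (rule ind_P)
  next
    case (mult u c) then show ?case using assms(5) by blast
  next
    case (add u v)
    show ?case by (rule assms(6)) (fact add)+
  next
    case (seq U)
    have "(SUP i. U i) = (\<lambda>Z. SUP i. U i Z)" by (rule ext) (simp add: image_comp)
    then show ?case using SUP[of U] seq by simp
  qed
qed

section \<open>Reducing mass transport to local events of finite range\<close>

lemma reroots_within_near: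
  "f = out_roots \<or> f = in_roots \<Longrightarrow> B \<subseteq> near \<Delta> q \<Longrightarrow> reroots_within \<Delta> f q B"
  using reroots_within_near_sets reroots_within_subset by metis

lemma rerooting_pair: "f = out_roots \<or> f = in_roots \<Longrightarrow> rerooting f 2"
  using rerooting_out rerooting_in by blast

lemma mass_indicator_Diff:
  assumes f: "f = out_roots \<or> f = in_roots" and AB: "A \<subseteq> B" "B \<subseteq> near \<Delta> q" and X: "X \<in> rooted_classes \<Delta> 1"
  shows "mass f (indicator (B - A)) X = mass f (indicator B) X - mass f (indicator A) X"
proof -
  have "mass f (\<lambda>Z. indicator (B - A) Z + indicator A Z) X = mass f (indicator B) X"
    using AB(1) by (intro arg_cong[where f = "\<lambda>F. mass f F X"] ext) (auto split: split_indicator)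
  then have sum: "mass f (indicator B) X = mass f (indicator (B - A)) X + mass f (indicator A) X"
    unfolding mass_add by (rule sym)
  have "mass f (indicator A) X \<noteq> top"
    using mass_indicator[OF reroots_within_near[OF f subset_trans[OF AB]] X] by simp
  then show ?thesis unfolding sum by simp
qed

text \<open>Graphs enter only in the case of a local event of finite range, where the mass is a
  reroot count and hence a local function; the other cases are closure properties of
  measurability.\<close>

lemma measurable_mass:
  assumes f: "f = out_roots \<or> f = in_roots" and F: "F \<in> borel_measurable (local_borel \<Delta> 2)"
  shows "mass f F \<in> borel_measurable (local_borel \<Delta> 1)"
  using F
proof (induction F rule: doubly_rooted_function_induct)
  case (cong F F')
  have "mass f F X = mass f F' X" if "X \<in> space (local_borel \<Delta> 1)" for X
    by (rule mass_cong[OF rerooting_pair[OF f]]) (use that cong in auto)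
  then show ?case
    using cong(2) measurable_cong[of "local_borel \<Delta> 1" "mass f F" "mass f F'" borel] by blast
next
  case (indicator r B)
  note w = reroots_within_near[OF f indicator(2)]
  have "(\<lambda>X. of_nat (reroot_count f B X) :: ennreal) \<in> borel_measurable (local_borel \<Delta> 1)"
    by (rule measurable_compose[OF measurable_local_function[OF _ local_function_reroot_count[OF rerooting_pair[OF f] indicator(1) w]]]) auto
  then show ?case by (subst measurable_cong[OF mass_indicator[OF w]]) auto
next
  case (diff q A B)
  then show ?case by (subst measurable_cong[OF mass_indicator_Diff[OF f diff(3,4)]]) auto
next
  case (mult F c)
  then show ?case unfolding mass_cmult by measurable
next
  case (add F F')
  then show ?case unfolding mass_add by measurable
next
  case (SUP F)
  have "mass f (\<lambda>Z. SUP i. F i Z) = (\<lambda>X. SUP i. mass f (F i) X)"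
    by (rule ext) (rule mass_SUP[OF SUP(2)])
  then show ?case using SUP(3) by simp
qed

lemma nn_integral_mass_near_finite:
  assumes f: "f = out_roots \<or> f = in_roots" and \<mu>: "random_rooted_graph \<Delta> \<mu>" and B: "B \<subseteq> near \<Delta> q"
  shows "(\<integral>\<^sup>+X. mass f (indicator B) X \<partial>\<mu>) < \<infinity>"
proof -
  interpret prob_space \<mu> using \<mu> unfolding random_rooted_graph_def by simp
  have sp: "space \<mu> = rooted_classes \<Delta> 1"
    using \<mu> sets_eq_imp_space_eq[of \<mu> "local_borel \<Delta> 1"] unfolding random_rooted_graph_def by simp
  have "(\<integral>\<^sup>+X. mass f (indicator B) X \<partial>\<mu>) \<le> (\<integral>\<^sup>+X. of_nat ((1 + \<Delta>) ^ q) \<partial>\<mu>)"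
    using reroot_count_le[OF reroots_within_near[OF f B]] mass_indicator[OF reroots_within_near[OF f B]]
    by (intro nn_integral_mono) (simp add: sp del: of_nat_power of_nat_add of_nat_Suc)
  also have "\<dots> < \<infinity>" by (simp add: emeasure_space_1 of_nat_less_top del: of_nat_power)
  finally show ?thesis .
qed

text \<open>Both sides of the mass-transport principle respect every closure step of
  \<open>doubly_rooted_function_induct\<close>; in the step for differences the integrals are finite
  by bounded range.\<close>

lemma unimodularI:
  assumes \<mu>: "random_rooted_graph \<Delta> \<mu>"
    and loc: "\<And>r B. local_event \<Delta> 2 r B \<Longrightarrow> B \<subseteq> near \<Delta> r \<Longrightarrow>
      (\<integral>\<^sup>+X. mass out_roots (indicator B) X \<partial>\<mu>) = (\<integral>\<^sup>+X. mass in_roots (indicator B) X \<partial>\<mu>)"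
  shows "unimodular \<Delta> \<mu>"
  unfolding unimodular_mass
proof (intro conjI ballI \<mu>)
  have S: "sets \<mu> = sets (local_borel \<Delta> 1)" using \<mu> unfolding random_rooted_graph_def by simp
  then have sp: "space \<mu> = rooted_classes \<Delta> 1"
    using sets_eq_imp_space_eq[of \<mu> "local_borel \<Delta> 1"] by simp
  have m: "mass out_roots F \<in> borel_measurable \<mu>" "mass in_roots F \<in> borel_measurable \<mu>"
    if "F \<in> borel_measurable (local_borel \<Delta> 2)" for F
    using measurable_mass that by (auto simp: measurable_cong_sets[OF S refl])
  fix F :: "nat rooted set \<Rightarrow> ennreal" assume "F \<in> borel_measurable (local_borel \<Delta> 2)"
  then show "(\<integral>\<^sup>+X. mass out_roots F X \<partial>\<mu>) = (\<integral>\<^sup>+X. mass in_roots F X \<partial>\<mu>)"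
  proof (induction F rule: doubly_rooted_function_induct)
    case (cong F F')
    have "(\<integral>\<^sup>+X. mass f F X \<partial>\<mu>) = (\<integral>\<^sup>+X. mass f F' X \<partial>\<mu>)" if "rerooting f 2" for f
      by (rule nn_integral_cong) (auto intro!: mass_cong[OF that] cong simp: sp)
    then show ?case using cong(2) rerooting_out rerooting_in by simp
  next
    case (indicator r B)
    then show ?case by (rule loc)
  next
    case (diff q A B)
    have "(\<integral>\<^sup>+X. mass f (indicator (B - A)) X \<partial>\<mu>) = (\<integral>\<^sup>+X. mass f (indicator B) X \<partial>\<mu>) - (\<integral>\<^sup>+X. mass f (indicator A) X \<partial>\<mu>)"
      if f: "f = out_roots \<or> f = in_roots" for f
    proof -
      have "(\<integral>\<^sup>+X. mass f (indicator (B - A)) X \<partial>\<mu>) = (\<integral>\<^sup>+X. mass f (indicator B) X - mass f (indicator A) X \<partial>\<mu>)"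
        by (rule nn_integral_cong) (auto intro!: mass_indicator_Diff[OF f diff(3,4)] simp: sp)
      also have "\<dots> = (\<integral>\<^sup>+X. mass f (indicator B) X \<partial>\<mu>) - (\<integral>\<^sup>+X. mass f (indicator A) X \<partial>\<mu>)"
      proof (rule nn_integral_diff)
        have "indicator A \<in> borel_measurable (local_borel \<Delta> 2)" "indicator B \<in> borel_measurable (local_borel \<Delta> 2)"
          using diff(1,2) by auto
        then show "mass f (indicator B) \<in> borel_measurable \<mu>" "mass f (indicator A) \<in> borel_measurable \<mu>"
          using m f by auto
        show "(\<integral>\<^sup>+X. mass f (indicator A) X \<partial>\<mu>) \<noteq> \<infinity>"
          using nn_integral_mass_near_finite[OF f \<mu> subset_trans[OF diff(3,4)]] by simp
        show "AE X in \<mu>. mass f (indicator A) X \<le> mass f (indicator B) X"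
          using diff(3) by (intro AE_I2 mass_mono) (auto simp: le_fun_def split: split_indicator)
      qed
      finally show ?thesis .
    qed
    from this[OF disjI1[OF refl]] this[OF disjI2[OF refl]] show ?case by (simp only: diff(5,6))
  next
    case (mult F c)
    have "(\<integral>\<^sup>+X. mass f (\<lambda>Z. c * F Z) X \<partial>\<mu>) = c * (\<integral>\<^sup>+X. mass f F X \<partial>\<mu>)"
      if f: "f = out_roots \<or> f = in_roots" for f
      unfolding mass_cmult by (rule nn_integral_cmult) (use m[OF mult(1)] f in blast)
    from this[OF disjI1[OF refl]] this[OF disjI2[OF refl]] show ?case by (simp only: mult(2))
  next
    case (add F F')
    have "(\<integral>\<^sup>+X. mass f (\<lambda>Z. F Z + F' Z) X \<partial>\<mu>) = (\<integral>\<^sup>+X. mass f F X \<partial>\<mu>) + (\<integral>\<^sup>+X. mass f F' X \<partial>\<mu>)"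
      if f: "f = out_roots \<or> f = in_roots" for f
      unfolding mass_add by (rule nn_integral_add) (use m[OF add(1)] m[OF add(2)] f in blast)+
    from this[OF disjI1[OF refl]] this[OF disjI2[OF refl]] show ?case by (simp only: add(3,4))
  next
    case (SUP F)
    have "(\<integral>\<^sup>+X. mass f (\<lambda>Z. SUP i. F i Z) X \<partial>\<mu>) = (SUP i. \<integral>\<^sup>+X. mass f (F i) X \<partial>\<mu>)"
      if f: "f = out_roots \<or> f = in_roots" for f
      unfolding mass_SUP[OF SUP(2)]
    proof (rule nn_integral_monotone_convergence_SUP)
      show "incseq (\<lambda>i. mass f (F i))"
        using SUP(2) mass_mono unfolding incseq_def le_fun_def by blast
      show "mass f (F i) \<in> borel_measurable \<mu>" for i using m[OF SUP(1)] f by auto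
    qed
    from this[OF disjI1[OF refl]] this[OF disjI2[OF refl]] show ?case by (simp only: SUP(3))
  qed
qed

section \<open>Limits of finite graphs\<close>

definition cylinder :: "nat \<Rightarrow> nat \<Rightarrow> nat rooted \<Rightarrow> nat rooted set set" where
  "cylinder \<Delta> r C = {X \<in> rooted_classes \<Delta> 1. rooted_ball (graph_of X, roots_of X) r \<cong>\<^sub>r C}"

lemma ball_rep_iso:
  assumes "R \<in> rooted_graphs \<Delta> k"
  shows "rooted_ball R r \<cong>\<^sub>r rooted_ball (graph_of (iso_class R), roots_of (iso_class R)) r"
  using iso_ball[OF rooted_graphs_well_rooted[OF assms] rooted_graphs_well_rooted rep_iso[OF assms]]
    rep_rooted_graph[OF iso_class_in_rooted_classes[OF assms]] by blast

lemma iso_class_in_cylinder: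
  assumes "R \<in> rooted_graphs \<Delta> 1"
  shows "iso_class R \<in> cylinder \<Delta> r C \<longleftrightarrow> rooted_ball R r \<cong>\<^sub>r C"
  using ball_rep_iso[OF assms, of r] rooted_iso_trans rooted_iso_sym iso_class_in_rooted_classes[OF assms]
  unfolding cylinder_def by blast

lemma cylinder_cong: "C \<cong>\<^sub>r D \<Longrightarrow> cylinder \<Delta> r C = cylinder \<Delta> r D"
  unfolding cylinder_def using rooted_iso_trans rooted_iso_sym by blast

lemma local_event_cylinder: "local_event \<Delta> 1 r (cylinder \<Delta> r C)"
proof -
  have "iso_class S \<in> cylinder \<Delta> r C" if "R \<in> rooted_graphs \<Delta> 1" "S \<in> rooted_graphs \<Delta> 1"
    "rooted_ball R r \<cong>\<^sub>r rooted_ball S r" "iso_class R \<in> cylinder \<Delta> r C" for R S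
    using that iso_class_in_cylinder rooted_iso_trans rooted_iso_sym by metis
  moreover have "cylinder \<Delta> r C \<subseteq> rooted_classes \<Delta> 1" unfolding cylinder_def by blast
  ultimately show ?thesis unfolding local_event_def by blast
qed

text \<open>A ball of radius \<open>r\<close> has at most \<open>(1 + \<Delta>) ^ r\<close>
  vertices, so it has a copy on the numbers below that bound, where only finitely many edge sets and
  roots are available.\<close>

lemma finite_cylinders: "finite {cylinder \<Delta> r (rooted_ball R r) |R. R \<in> rooted_graphs \<Delta> 1}"
proof -
  define M where "M = (1 + \<Delta>) ^ r"
  \<comment> \<open>Some members of \<open>K\<close> are not rooted graphs; only finiteness and the
    presence of a copy of every ball matter.\<close>
  define K :: "nat rooted set" where
    "K = (\<lambda>(V, E, x). (\<lparr>Verts = V, Edges = E\<rparr>, [x])) ` (Pow {..<M} \<times> Pow (Pow {..<M}) \<times> {..<M})"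
  have "\<exists>C\<in>K. rooted_ball R r \<cong>\<^sub>r C" if R: "R \<in> rooted_graphs \<Delta> 1" for R
  proof -
    obtain G v where G: "R = (G, [v])" using R by (rule rooted_graphs_1E)
    let ?B = "rooted_ball R r"
    have ok: "well_rooted R" "degrees_le \<Delta> (fst R)"
      using R rooted_graphs_well_rooted[OF R] unfolding rooted_graphs_def by auto
    have okB: "well_rooted ?B" by (rule well_rooted_ball[OF ok(1)])
    have V: "Verts (fst ?B) = reach R r"
      using reach_verts[OF ok(1)] by (auto simp: rooted_ball_eq induced_subgraph_def)
    have M: "card (reach R r) \<le> M" using card_reach_le[OF ok, of r] by (simp add: G M_def)
    obtain f where f: "bij_betw f (reach R r) {0..<card (reach R r)}"
      using ex_bij_betw_finite_nat[OF reach_finite[OF ok]] by blast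
    then have inj: "inj_on f (Verts (fst ?B))" unfolding V by (rule bij_betw_imp_inj_on)
    have fM: "f x \<in> {..<M}" if "x \<in> Verts (fst ?B)" for x
      using bij_betw_apply[OF f] that M unfolding V by fastforce
    have uB: "ugraph (fst ?B)" and v: "v \<in> Verts (fst ?B)"
      using okB unfolding well_rooted_def by (auto simp: G rooted_ball_def)
    have "graph_iso f (fst ?B) (relabel f (fst ?B))" by (rule graph_iso_relabel[OF uB inj])
    then have "?B \<cong>\<^sub>r (relabel f (fst ?B), [f v])"
      using v unfolding rooted_iso_def by (auto simp: G rooted_ball_def)
    moreover have "(relabel f (fst ?B), [f v]) \<in> K"
    proof -
      have "e \<subseteq> Verts (fst ?B)" if "e \<in> Edges (fst ?B)" for e
        using that uB unfolding ugraph_def by auto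
      then have "(f ` Verts (fst ?B), (`) f ` Edges (fst ?B), f v) \<in> Pow {..<M} \<times> Pow (Pow {..<M}) \<times> {..<M}"
        using fM v by blast
      then show ?thesis unfolding K_def relabel_def by (rule rev_image_eqI) simp
    qed
    ultimately show ?thesis by blast
  qed
  then have "{cylinder \<Delta> r (rooted_ball R r) |R. R \<in> rooted_graphs \<Delta> 1} \<subseteq> cylinder \<Delta> r ` K"
    using cylinder_cong by blast
  moreover have "finite K" unfolding K_def by simp
  ultimately show ?thesis using finite_surj by blast
qed

text \<open>Cylinders of equal radius that meet are equal. Finiteness of the partition carries
  convergence from single cylinders to all local events.\<close>

lemma local_event_eq_Union_cylinders:
  assumes A: "local_event \<Delta> 1 r A"
  obtains \<C> where "finite \<C>" "A = \<Union>\<C>" "disjoint \<C>"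
    "\<And>C. C \<in> \<C> \<Longrightarrow> \<exists>R\<in>rooted_graphs \<Delta> 1. C = cylinder \<Delta> r (rooted_ball R r)"
proof
  let ?C = "{cylinder \<Delta> r (rooted_ball R r) |R. R \<in> rooted_graphs \<Delta> 1 \<and> iso_class R \<in> A}"
  show "finite ?C" by (rule finite_subset[OF _ finite_cylinders[of \<Delta> r]]) blast
  show "\<exists>R\<in>rooted_graphs \<Delta> 1. C = cylinder \<Delta> r (rooted_ball R r)" if "C \<in> ?C" for C
    using that by blast
  show "A = \<Union>?C"
  proof (intro equalityI subsetI)
    fix X assume X: "X \<in> A"
    then have "X \<in> rooted_classes \<Delta> 1" using local_event_subset[OF A] by blast
    then obtain R where R: "R \<in> rooted_graphs \<Delta> 1" "X = iso_class R" by (rule rooted_classes_cases)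
    have "X \<in> cylinder \<Delta> r (rooted_ball R r)"
      using iso_class_in_cylinder[OF R(1)] rooted_iso_refl[OF well_rooted_ball[OF rooted_graphs_well_rooted[OF R(1)]]] R(2)
      by blast
    then show "X \<in> \<Union>?C" using R X by blast
  next
    fix X assume "X \<in> \<Union>?C"
    then obtain R where R: "R \<in> rooted_graphs \<Delta> 1" "iso_class R \<in> A" "X \<in> cylinder \<Delta> r (rooted_ball R r)"
      by blast
    then have X: "X \<in> rooted_classes \<Delta> 1" "rooted_ball (graph_of X, roots_of X) r \<cong>\<^sub>r rooted_ball R r"
      unfolding cylinder_def by auto
    then show "X \<in> A"
      using local_eventD[OF A rep_rooted_graph[OF X(1)] R(1) X(2)] R(2) iso_class_rep[OF X(1)] by simp
  qed
  show "disjoint ?C"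
  proof (rule disjointI)
    fix C D assume CD: "C \<in> ?C" "D \<in> ?C" "C \<noteq> D"
    obtain R where R: "C = cylinder \<Delta> r (rooted_ball R r)" using CD(1) by blast
    obtain S where S: "D = cylinder \<Delta> r (rooted_ball S r)" using CD(2) by blast
    show "C \<inter> D = {}"
    proof (rule ccontr)
      assume "C \<inter> D \<noteq> {}"
      then obtain X where "rooted_ball (graph_of X, roots_of X) r \<cong>\<^sub>r rooted_ball R r"
        "rooted_ball (graph_of X, roots_of X) r \<cong>\<^sub>r rooted_ball S r"
        unfolding R S cylinder_def by blast
      then have "rooted_ball R r \<cong>\<^sub>r rooted_ball S r" using rooted_iso_sym rooted_iso_trans by blast
      then show False using cylinder_cong CD(3) unfolding R S by blast
    qed
  qed
qed

text \<open>The vertex type and \<open>connected\<close> make every rooted \<open>H n\<close> a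
  member of \<open>rooted_graphs\<close>, so that its class is a point of the space.\<close>

locale local_limit =
  fixes \<Delta> :: nat and H :: "nat \<Rightarrow> nat ugraph" and \<mu> :: "nat rooted set measure"
  assumes ugraph: "\<And>n. ugraph (H n)" and finite: "\<And>n. finite (Verts (H n))"
    and nonempty: "\<And>n. Verts (H n) \<noteq> {}" and connected: "\<And>n. graph_connected (H n)"
    and degrees: "\<And>n. degrees_le \<Delta> (H n)"
    and random: "random_rooted_graph \<Delta> \<mu>" and conv: "converges_locally_weakly H \<mu>"
begin

sublocale prob_space \<mu> using random unfolding random_rooted_graph_def by simp

lemma sets_\<mu>: "sets \<mu> = sets (local_borel \<Delta> 1)" using random unfolding random_rooted_graph_def by simp
lemma space_\<mu>: "space \<mu> = rooted_classes \<Delta> 1" using sets_eq_imp_space_eq[OF sets_\<mu>] by simp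

lemma card_pos: "0 < card (Verts (H n))" using finite nonempty by (simp add: card_gt_0_iff)

lemma H_rooted: "u \<in> Verts (H n) \<Longrightarrow> (H n, [u]) \<in> rooted_graphs \<Delta> 1"
  using ugraph connected degrees unfolding rooted_graphs_def by auto

definition density_of :: "nat \<Rightarrow> nat rooted set set \<Rightarrow> real" where
  "density_of n A = real (card {u \<in> Verts (H n). iso_class (H n, [u]) \<in> A}) / real (card (Verts (H n)))"

lemma cylinder_limit:
  assumes R: "R \<in> rooted_graphs \<Delta> 1" and r: "r > 0"
  shows "(\<lambda>n. density_of n (cylinder \<Delta> r (rooted_ball R r))) \<longlonglongrightarrow> prob (cylinder \<Delta> r (rooted_ball R r))"
proof -
  obtain G v where G: "R = (G, [v])" using R by (rule rooted_graphs_1E)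
  have ok: "well_rooted (G, [v])" "degrees_le \<Delta> (fst (G, [v]))"
    using R rooted_graphs_well_rooted[OF R] unfolding rooted_graphs_def G by auto
  define B where "B = fst (rooted_ball R r)"
  have eq: "rooted_ball R r = (B, [v])" unfolding B_def by (simp add: G rooted_ball_eq)
  have "v \<in> Verts B \<and> ugraph B"
    using well_rooted_ball[OF ok(1), of r] eq unfolding well_rooted_def G by auto
  moreover have "graph_connected B" using graph_connected_ball[OF ok(1)] unfolding B_def G .
  moreover have "finite (Verts B)"
    using reach_finite[OF ok, of r] unfolding B_def G by (simp add: rooted_ball_eq induced_subgraph_def)
  ultimately have "(\<lambda>n. measure_pmf.prob (pmf_of_set (Verts (H n))) {u. rooted_ball (H n, [u]) r \<cong>\<^sub>r (B, [v])})
      \<longlonglongrightarrow> prob {X \<in> space \<mu>. rooted_ball (graph_of X, roots_of X) r \<cong>\<^sub>r (B, [v])}"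
    using conv r unfolding converges_locally_weakly_def by blast
  moreover have "measure_pmf.prob (pmf_of_set (Verts (H n))) {u. rooted_ball (H n, [u]) r \<cong>\<^sub>r (B, [v])}
      = density_of n (cylinder \<Delta> r (rooted_ball R r))" for n
  proof -
    have "Verts (H n) \<inter> {u. rooted_ball (H n, [u]) r \<cong>\<^sub>r (B, [v])}
        = {u \<in> Verts (H n). iso_class (H n, [u]) \<in> cylinder \<Delta> r (rooted_ball R r)}"
      using iso_class_in_cylinder[OF H_rooted] unfolding eq by blast
    then show ?thesis
      using measure_pmf_of_set[OF nonempty finite] unfolding density_of_def by simp
  qed
  ultimately show ?thesis unfolding cylinder_def space_\<mu> eq by simp
qed

lemma local_event_limit:
  assumes "local_event \<Delta> 1 r A"
  shows "(\<lambda>n. density_of n A) \<longlonglongrightarrow> prob A"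
proof -
  \<comment> \<open>Passing to \<open>Suc r\<close> keeps the radius positive, as the definition of
    local weak convergence demands.\<close>
  obtain \<C> where C: "finite \<C>" "A = \<Union>\<C>" "disjoint \<C>"
    "\<And>C. C \<in> \<C> \<Longrightarrow> \<exists>R\<in>rooted_graphs \<Delta> 1. C = cylinder \<Delta> (Suc r) (rooted_ball R (Suc r))"
    using local_event_eq_Union_cylinders[OF local_event_mono[OF assms, of "Suc r"]] by (metis le_SucI order_refl)
  have Cs: "C \<in> sets \<mu>" if "C \<in> \<C>" for C
    using C(4)[OF that] local_event_sets[OF zero_less_one local_event_cylinder] unfolding sets_\<mu> by blast
  have "prob (\<Union>C\<in>\<C>. C) = (\<Sum>C\<in>\<C>. prob C)"
    by (rule finite_measure_finite_Union[OF C(1)])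
       (use Cs C(3) in \<open>auto simp: disjoint_family_on_def disjoint_def\<close>)
  moreover have "density_of n A = (\<Sum>C\<in>\<C>. density_of n C)" for n
  proof -
    have "{u \<in> Verts (H n). iso_class (H n, [u]) \<in> A} = (\<Union>C\<in>\<C>. {u \<in> Verts (H n). iso_class (H n, [u]) \<in> C})"
      unfolding C(2) by blast
    also have "card \<dots> = (\<Sum>C\<in>\<C>. card {u \<in> Verts (H n). iso_class (H n, [u]) \<in> C})"
      by (rule card_UN_disjoint[OF C(1)]) (use finite C(3) in \<open>auto simp: disjoint_def\<close>)
    finally show ?thesis unfolding density_of_def by (simp add: sum_divide_distrib)
  qed
  moreover have "(\<lambda>n. \<Sum>C\<in>\<C>. density_of n C) \<longlonglongrightarrow> (\<Sum>C\<in>\<C>. prob C)"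
    by (rule tendsto_sum) (use C(4) cylinder_limit in blast)
  ultimately show ?thesis using C(2) by simp
qed

lemma measurable_real_local_function:
  fixes h :: "nat rooted set \<Rightarrow> nat"
  assumes "local_function \<Delta> 1 r h" shows "(\<lambda>X. real (h X)) \<in> borel_measurable \<mu>"
  using measurable_compose[OF measurable_local_function[OF _ assms], of real borel]
  by (simp add: measurable_cong_sets[OF sets_\<mu> refl])

lemma integrable_local_function:
  fixes h :: "nat rooted set \<Rightarrow> nat"
  assumes "local_function \<Delta> 1 r h" "\<And>X. X \<in> rooted_classes \<Delta> 1 \<Longrightarrow> h X \<le> M"
  shows "integrable \<mu> (\<lambda>X. real (h X))"
  by (rule integrable_const_bound[of _ "real M", OF _ measurable_real_local_function[OF assms(1)]])
     (use assms(2) space_\<mu> in \<open>auto intro!: AE_I2\<close>)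

text \<open>A bounded local function with values in the natural numbers is a finite linear
  combination of indicators of its level sets, and these are local events.\<close>

lemma local_function_limit:
  fixes h :: "nat rooted set \<Rightarrow> nat"
  assumes h: "local_function \<Delta> 1 r h" and M: "\<And>X. X \<in> rooted_classes \<Delta> 1 \<Longrightarrow> h X \<le> M"
  shows "(\<lambda>n. (\<Sum>u\<in>Verts (H n). real (h (iso_class (H n, [u])))) / real (card (Verts (H n)))) \<longlonglongrightarrow> (\<integral>X. real (h X) \<partial>\<mu>)"
proof -
  define L where "L j = {X \<in> rooted_classes \<Delta> 1. h X = j}" for j
  have L: "local_event \<Delta> 1 r (L j)" for j unfolding L_def by (rule local_event_vimage[OF h])
  then have Ls: "L j \<in> sets \<mu>" for j using local_event_sets sets_\<mu> by auto
  have split: "real (h X) = (\<Sum>j\<le>M. real j * indicator (L j) X)" if X: "X \<in> rooted_classes \<Delta> 1" for X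
  proof -
    have "(\<Sum>j\<le>M. real j * indicator (L j) X) = (\<Sum>j\<le>M. if j = h X then real j else 0)"
      using X by (intro sum.cong) (auto simp: L_def indicator_def)
    then show ?thesis using M[OF X] by simp
  qed
  have "(\<integral>X. real (h X) \<partial>\<mu>) = (\<integral>X. (\<Sum>j\<le>M. real j * indicator (L j) X) \<partial>\<mu>)"
    by (rule Bochner_Integration.integral_cong) (use split space_\<mu> in auto)
  also have "\<dots> = (\<Sum>j\<le>M. \<integral>X. real j * indicator (L j) X \<partial>\<mu>)"
    by (intro Bochner_Integration.integral_sum integrable_mult_right integrable_real_indicator Ls)
      (simp add: less_top[symmetric])
  also have "\<dots> = (\<Sum>j\<le>M. real j * prob (L j))" using Ls by simp
  finally have int: "(\<integral>X. real (h X) \<partial>\<mu>) = (\<Sum>j\<le>M. real j * prob (L j))" .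
  have "(\<Sum>u\<in>Verts (H n). real (h (iso_class (H n, [u])))) / real (card (Verts (H n)))
      = (\<Sum>j\<le>M. real j * density_of n (L j))" for n
  proof -
    have "(\<Sum>u\<in>Verts (H n). real (h (iso_class (H n, [u]))))
        = (\<Sum>u\<in>Verts (H n). \<Sum>j\<le>M. real j * indicator (L j) (iso_class (H n, [u])))"
      using split H_rooted by (intro sum.cong) auto
    also have "\<dots> = (\<Sum>j\<le>M. real j * (\<Sum>u\<in>Verts (H n). indicator (L j) (iso_class (H n, [u]))))"
      by (subst sum.swap) (simp add: sum_distrib_left)
    also have "\<dots> = (\<Sum>j\<le>M. real j * real (card {u \<in> Verts (H n). iso_class (H n, [u]) \<in> L j}))"
      using finite by (intro sum.cong) (auto simp: indicator_def sum.If_cases Int_def)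
    finally show ?thesis unfolding density_of_def by (simp add: sum_divide_distrib)
  qed
  moreover have "(\<lambda>n. \<Sum>j\<le>M. real j * density_of n (L j)) \<longlonglongrightarrow> (\<Sum>j\<le>M. real j * prob (L j))"
    by (intro tendsto_sum tendsto_mult tendsto_const local_event_limit[OF L])
  ultimately show ?thesis unfolding int by simp
qed

text \<open>Finite range bounds the reroot count, so the mass has a finite expectation, and this is
  the limit of the corresponding averages over the finite graphs.\<close>

lemma nn_integral_mass_indicator:
  assumes f: "f = out_roots \<or> f = in_roots" and B: "local_event \<Delta> 2 r B" "B \<subseteq> near \<Delta> r"
  shows "(\<integral>\<^sup>+X. mass f (indicator B) X \<partial>\<mu>) = ennreal (\<integral>X. real (reroot_count f B X) \<partial>\<mu>)"
    and "(\<lambda>n. (\<Sum>u\<in>Verts (H n). real (card {x \<in> Verts (H n). iso_class (H n, f u x) \<in> B})) / real (card (Verts (H n))))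
      \<longlonglongrightarrow> (\<integral>X. real (reroot_count f B X) \<partial>\<mu>)"
proof -
  note w = reroots_within_near[OF f B(2)]
  note l = local_function_reroot_count[OF rerooting_pair[OF f] B(1) w]
  note M = reroot_count_le[OF w]
  have "(\<integral>\<^sup>+X. mass f (indicator B) X \<partial>\<mu>) = (\<integral>\<^sup>+X. ennreal (real (reroot_count f B X)) \<partial>\<mu>)"
    by (rule nn_integral_cong) (use mass_indicator[OF w] space_\<mu> in \<open>simp add: ennreal_of_nat_eq_real_of_nat\<close>)
  also have "\<dots> = ennreal (\<integral>X. real (reroot_count f B X) \<partial>\<mu>)"
    by (rule nn_integral_eq_integral[OF integrable_local_function[OF l M]]) simp_all
  finally show "(\<integral>\<^sup>+X. mass f (indicator B) X \<partial>\<mu>) = ennreal (\<integral>X. real (reroot_count f B X) \<partial>\<mu>)" .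
  have "(\<Sum>u\<in>Verts (H n). real (reroot_count f B (iso_class (H n, [u]))))
      = (\<Sum>u\<in>Verts (H n). real (card {x \<in> Verts (H n). iso_class (H n, f u x) \<in> B}))" for n
    using reroot_count_iso_class[OF rerooting_pair[OF f] B(1) w H_rooted] by (intro sum.cong) auto
  then show "(\<lambda>n. (\<Sum>u\<in>Verts (H n). real (card {x \<in> Verts (H n). iso_class (H n, f u x) \<in> B})) / real (card (Verts (H n))))
      \<longlonglongrightarrow> (\<integral>X. real (reroot_count f B X) \<partial>\<mu>)"
    using local_function_limit[OF l M] by simp
qed

text \<open>The root of a finite graph being uniform, both sides of the mass-transport principle are
  the number of pairs in \<open>B\<close>, divided by the number of vertices.\<close>
theorem unimodular: "unimodular \<Delta> \<mu>"
proof (rule unimodularI[OF random])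
  fix r B assume B: "local_event \<Delta> 2 r B" "B \<subseteq> near \<Delta> r"
  have swap: "(\<Sum>u\<in>V. real (card {x \<in> V. P u x})) = (\<Sum>u\<in>V. real (card {x \<in> V. P x u}))"
    if V: "Finite_Set.finite V" for V and P :: "nat \<Rightarrow> nat \<Rightarrow> bool"
  proof -
    have "real (card {x \<in> V. Q x}) = (\<Sum>x\<in>V. if Q x then 1 else 0)" for Q
      using V by (simp add: sum.If_cases Int_def)
    then show ?thesis by (simp only:) (rule sum.swap)
  qed
  have eq: "(\<Sum>u\<in>Verts (H n). real (card {x \<in> Verts (H n). iso_class (H n, out_roots u x) \<in> B}))
      = (\<Sum>u\<in>Verts (H n). real (card {x \<in> Verts (H n). iso_class (H n, in_roots u x) \<in> B}))" for n
    unfolding out_roots_def in_roots_def by (rule swap[OF finite])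
  have "(\<integral>X. real (reroot_count out_roots B X) \<partial>\<mu>) = (\<integral>X. real (reroot_count in_roots B X) \<partial>\<mu>)"
    using nn_integral_mass_indicator(2)[OF disjI1[OF refl] B] nn_integral_mass_indicator(2)[OF disjI2[OF refl] B]
    unfolding eq by (rule LIMSEQ_unique)
  then show "(\<integral>\<^sup>+X. mass out_roots (indicator B) X \<partial>\<mu>) = (\<integral>\<^sup>+X. mass in_roots (indicator B) X \<partial>\<mu>)"
    using nn_integral_mass_indicator(1)[OF _ B] by simp
qed

end

section \<open>The zero-one law\<close>

lemma doubly_rooted_classE:
  assumes "Z \<in> rooted_classes \<Delta> 2"
  obtains G u v where "(G, [u, v]) \<in> rooted_graphs \<Delta> 2" "Z = iso_class (G, [u, v])"
    "(G, [u]) \<in> rooted_graphs \<Delta> 1" "(G, [v]) \<in> rooted_graphs \<Delta> 1"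
    "root_class 0 Z = iso_class (G, [u])" "root_class 1 Z = iso_class (G, [v])"
proof -
  obtain R where R: "R \<in> rooted_graphs \<Delta> 2" "Z = iso_class R" using assms by (rule rooted_classes_cases)
  obtain G u v where G: "R = (G, [u, v])" using R(1) by (rule rooted_graphs_2E)
  show ?thesis
  proof (rule that)
    show "(G, [u, v]) \<in> rooted_graphs \<Delta> 2" "Z = iso_class (G, [u, v])" using R G by auto
    then show "(G, [u]) \<in> rooted_graphs \<Delta> 1" "(G, [v]) \<in> rooted_graphs \<Delta> 1"
      unfolding rooted_graphs_def by auto
    show "root_class 0 Z = iso_class (G, [u])" "root_class 1 Z = iso_class (G, [v])"
      using root_class_iso_class[of 0 G "[u, v]"] root_class_iso_class[of 1 G "[u, v]"] R G by auto
  qed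
qed

text \<open>The expected mass of this set is the limiting density of the edge boundary of \<open>A\<close> in the
  finite graphs.\<close>
definition crossing :: "nat \<Rightarrow> nat rooted set set \<Rightarrow> nat rooted set set" where
  "crossing \<Delta> A = {Z \<in> adjacent \<Delta>. root_class 0 Z \<in> A \<and> root_class 1 Z \<notin> A}"

section \<open>Measurability and mass of crossing edges\<close>

lemma adjacent_subset: "adjacent \<Delta> \<subseteq> rooted_classes \<Delta> 2"
  by (rule local_event_subset[OF local_event_adjacent])

lemma crossing_emptyI:
  assumes "\<And>G u v. (G, [u]) \<in> rooted_graphs \<Delta> 1 \<Longrightarrow> (G, [v]) \<in> rooted_graphs \<Delta> 1 \<Longrightarrow>
    iso_class (G, [u]) \<in> A \<Longrightarrow> iso_class (G, [v]) \<in> A"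
  shows "crossing \<Delta> A = {}"
proof -
  have "root_class 1 Z \<in> A" if Z: "Z \<in> adjacent \<Delta>" "root_class 0 Z \<in> A" for Z
  proof -
    have "Z \<in> rooted_classes \<Delta> 2" using Z(1) adjacent_subset by blast
    then obtain G u v where G: "(G, [u, v]) \<in> rooted_graphs \<Delta> 2" "Z = iso_class (G, [u, v])"
      "(G, [u]) \<in> rooted_graphs \<Delta> 1" "(G, [v]) \<in> rooted_graphs \<Delta> 1"
      "root_class 0 Z = iso_class (G, [u])" "root_class 1 Z = iso_class (G, [v])"
      by (rule doubly_rooted_classE)
    show ?thesis using assms[OF G(3,4)] Z(2) unfolding G(5,6) .
  qed
  then show ?thesis unfolding crossing_def by blast
qed

lemma adjacent_sets: "adjacent \<Delta> \<in> sets (local_borel \<Delta> 2)"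
  by (rule local_event_sets[OF _ local_event_adjacent]) simp

lemma root_class_sets:
  assumes "A \<in> sets (local_borel \<Delta> 1)" "i < 2"
  shows "{Z \<in> adjacent \<Delta>. root_class i Z \<in> A} \<in> sets (local_borel \<Delta> 2)"
proof -
  have "root_class i -` A \<inter> space (local_borel \<Delta> 2) \<in> sets (local_borel \<Delta> 2)"
    by (rule measurable_sets[OF measurable_root_class[OF assms(2)] assms(1)])
  from sets.Int[OF this adjacent_sets[of \<Delta>]] show ?thesis
    using adjacent_subset by (simp add: vimage_def Int_def conj_commute subset_eq cong: conj_cong)
qed

lemma crossing_sets:
  assumes "A \<in> sets (local_borel \<Delta> 1)"
  shows "crossing \<Delta> A \<in> sets (local_borel \<Delta> 2)"
proof -
  have "crossing \<Delta> A = {Z \<in> adjacent \<Delta>. root_class 0 Z \<in> A} - {Z \<in> adjacent \<Delta>. root_class 1 Z \<in> A}"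
    unfolding crossing_def by blast
  then show ?thesis using root_class_sets[OF assms] by simp
qed

lemma local_event_crossing:
  assumes "local_event \<Delta> 1 r A"
  shows "local_event \<Delta> 2 r (crossing \<Delta> A)"
proof -
  have "crossing \<Delta> A = adjacent \<Delta> \<inter> {Z \<in> rooted_classes \<Delta> 2. root_class 0 Z \<in> A} \<inter>
      (rooted_classes \<Delta> 2 - {Z \<in> rooted_classes \<Delta> 2. root_class 1 Z \<in> A})"
    unfolding crossing_def using adjacent_subset by blast
  then show ?thesis
    using local_event_Int[OF local_event_Int[OF local_event_mono[OF local_event_adjacent]
          local_event_root_class[OF _ assms]] local_event_Compl[OF local_event_root_class[OF _ assms]]]
    by simp
qed

lemma root_class_reroot:
  assumes "X \<in> rooted_classes \<Delta> 1" "x \<in> Verts (graph_of X)"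
  shows "root_class 0 (iso_class (graph_of X, out_roots (hd (roots_of X)) x)) = X"
    and "root_class 1 (iso_class (graph_of X, in_roots (hd (roots_of X)) x)) = X"
proof -
  have X: "iso_class (graph_of X, [hd (roots_of X)]) = X"
    using iso_class_rep[OF assms(1)] rep_roots_1(1)[OF assms(1)] by simp
  show "root_class 0 (iso_class (graph_of X, out_roots (hd (roots_of X)) x)) = X"
    using root_class_iso_class[OF _ rerooting_rooted_graphs[OF rerooting_out rep_graph_1[OF assms(1)] assms(2)], of 0] X
    by (simp add: out_roots_def)
  show "root_class 1 (iso_class (graph_of X, in_roots (hd (roots_of X)) x)) = X"
    using root_class_iso_class[OF _ rerooting_rooted_graphs[OF rerooting_in rep_graph_1[OF assms(1)] assms(2)], of 1] X
    by (simp add: in_roots_def)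
qed

text \<open>The root of \<open>X\<close> has index 0 in \<open>out_roots\<close> and index 1 in
  \<open>in_roots\<close>, so every pair in the sum projects to \<open>X\<close> under
  \<open>root_class i\<close>.\<close>

lemma mass_root_eq_0:
  assumes f: "(f, i) \<in> {(out_roots, 0), (in_roots, 1)}" and X: "X \<in> rooted_classes \<Delta> 1"
    and F: "\<And>Z. root_class i Z = X \<Longrightarrow> F Z = 0"
  shows "mass f F X = 0"
proof -
  have "mass f F X = (\<integral>\<^sup>+x. 0 \<partial>count_space (Verts (graph_of X)))"
    unfolding mass_def using f root_class_reroot[OF X] by (intro nn_integral_cong F) auto
  then show ?thesis by simp
qed

text \<open>The constant is the size bound of a ball of radius 1, the centre included.\<close>

lemma mass_adjacent_le:
  assumes f: "(f, i) \<in> {(out_roots, 0), (in_roots, 1)}" and X: "X \<in> rooted_classes \<Delta> 1"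
  shows "mass f (indicator {Z \<in> adjacent \<Delta>. root_class i Z \<in> D}) X \<le> of_nat (1 + \<Delta>) * indicator D X"
proof (cases "X \<in> D")
  case True
  let ?E = "{Z \<in> adjacent \<Delta>. root_class i Z \<in> D}"
  have w: "reroots_within \<Delta> f 1 ?E"
    by (rule reroots_within_near) (use f adjacent_subset_near in auto)
  have "mass f (indicator ?E) X = of_nat (reroot_count f ?E X)" by (rule mass_indicator[OF w X])
  also have "\<dots> \<le> of_nat (1 + \<Delta>)" using reroot_count_le[OF w X] by (intro of_nat_mono) simp
  finally show ?thesis using True by simp
next
  case False
  then show ?thesis using mass_root_eq_0[OF f X] by (simp add: indicator_def)
qed

text \<open>The probability that \<open>f\<close> exceeds \<open>q\<close> is decreasing in
  \<open>q\<close> and takes only the values 0 and 1. Its limits at both ends make the jump happen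
  at a finite level, and that level is the constant.\<close>

lemma (in prob_space) AE_const_of_zero_one:
  fixes f :: "'a \<Rightarrow> real"
  assumes f[measurable]: "f \<in> borel_measurable M"
    and zo: "\<And>q. prob {x \<in> space M. q < f x} = 0 \<or> prob {x \<in> space M. q < f x} = 1"
  shows "\<exists>a. AE x in M. f x = a"
proof -
  let ?P = "\<lambda>q. prob {x \<in> space M. q < f x}"
  define S where "S = {q. ?P q = 1}"
  have anti: "?P q' \<le> ?P q" if "q \<le> q'" for q q'
    using that by (intro finite_measure_mono) auto
  have lim0: "(\<lambda>n. ?P (real n)) \<longlonglongrightarrow> 0"
  proof -
    have "(\<lambda>n. ?P (real n)) \<longlonglongrightarrow> prob (\<Inter>n. {x \<in> space M. real n < f x})"
      by (rule finite_Lim_measure_decseq) (auto simp: decseq_def)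
    moreover have "\<exists>n. \<not> real n < f x" for x
      using reals_Archimedean2[of "f x"] by (meson less_asym)
    then have "(\<Inter>n. {x \<in> space M. real n < f x}) = {}" by blast
    ultimately show ?thesis by simp
  qed
  have lim1: "(\<lambda>n. ?P (- real n)) \<longlonglongrightarrow> 1"
  proof -
    have "(\<lambda>n. ?P (- real n)) \<longlonglongrightarrow> prob (\<Union>n. {x \<in> space M. - real n < f x})"
      by (rule finite_Lim_measure_incseq) (auto simp: incseq_def)
    moreover have "\<exists>n. - real n < f x" for x
      using reals_Archimedean2[of "- f x"] by (auto simp: minus_less_iff)
    then have "(\<Union>n. {x \<in> space M. - real n < f x}) = space M" by auto
    ultimately show ?thesis by (simp add: prob_space)
  qed
  have "\<exists>n. ?P (real n) < 1"
    using order_tendstoD(2)[OF lim0, of 1] by (auto simp: eventually_sequentially)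
  then obtain n where n: "?P (real n) < 1" by blast
  have "\<exists>m. 0 < ?P (- real m)"
    using order_tendstoD(1)[OF lim1, of 0] by (auto simp: eventually_sequentially)
  then obtain m where "0 < ?P (- real m)" by blast
  then have m: "- real m \<in> S" using zo[of "- real m"] unfolding S_def by auto
  have "q \<le> real n" if "q \<in> S" for q
  proof (rule ccontr)
    assume "\<not> q \<le> real n"
    then have "?P q \<le> ?P (real n)" by (intro anti) simp
    then show False using that n unfolding S_def by simp
  qed
  then have bdd: "bdd_above S" by (rule bdd_aboveI)
  define a where "a = Sup S"
  have "AE x in M. f x \<le> a + 1 / (real k + 1)" for k
  proof -
    have "a + 1 / (real k + 1) \<notin> S"
      using cSup_upper[OF _ bdd, of "a + 1 / (real k + 1)"] unfolding a_def[symmetric] by fastforce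
    then have "?P (a + 1 / (real k + 1)) = 0" using zo unfolding S_def by blast
    then have "AE x in M. x \<notin> {x \<in> space M. a + 1 / (real k + 1) < f x}"
      by (subst (asm) prob_eq_0) auto
    with AE_space show ?thesis by eventually_elim (auto simp: not_less)
  qed
  moreover have "AE x in M. a - 1 / (real k + 1) \<le> f x" for k
  proof -
    have "a - 1 / (real k + 1) < Sup S" unfolding a_def by simp
    then obtain q where q: "q \<in> S" "a - 1 / (real k + 1) < q"
      using less_cSup_iff[OF _ bdd] m by blast
    have "AE x in M. x \<in> {x \<in> space M. q < f x}"
      using q(1) unfolding S_def by (intro prob_eq_1[THEN iffD1]) auto
    then show ?thesis by eventually_elim (use q(2) in auto)
  qed
  ultimately have "AE x in M. \<forall>k. f x \<le> a + 1 / (real k + 1)" "AE x in M. \<forall>k. a - 1 / (real k + 1) \<le> f x"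
    by (simp_all add: AE_all_countable)
  then have "AE x in M. f x = a"
  proof eventually_elim
    case (elim x)
    have eps: "\<exists>k. 1 / (real k + 1) < e" if "e > 0" for e :: real
      using reals_Archimedean[OF that] by (auto simp: inverse_eq_divide add.commute)
    have "f x \<le> a"
    proof (rule field_le_epsilon)
      fix e :: real assume "e > 0"
      then obtain k where "1 / (real k + 1) < e" using eps by blast
      then show "f x \<le> a + e" using elim(1) by (meson add_left_mono less_imp_le order_trans)
    qed
    moreover have "a \<le> f x"
    proof (rule field_le_epsilon)
      fix e :: real assume "e > 0"
      then obtain k where "1 / (real k + 1) < e" using eps by blast
      then show "a \<le> f x + e" using elim(2)[rule_format, of k] by linarith
    qed
    ultimately show ?case by simp
  qed
  then show ?thesis by blast
qed

lemma ennreal_add_le_selfD: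
  fixes a b :: ennreal assumes "a + b \<le> a" "a < \<infinity>" shows "b = 0"
  using ennreal_add_left_cancel_le[of a b 0] assms by auto

text \<open>The Cheeger bound multiplied out, which covers the empty set and graphs with a single
  vertex without special values.\<close>

locale expander_limit = local_limit +
  fixes c :: real
  assumes c_pos: "c > 0"
    and expansion: "\<And>n A. A \<subseteq> Verts (H n) \<Longrightarrow> real (card A) \<le> real (card (Verts (H n))) / 2 \<Longrightarrow>
      c * real (card A) \<le> real (card (edge_boundary (H n) A))"
begin

text \<open>Expansion is applied to whichever of \<open>S\<close> and its complement is small, and
  boundary edges of the complement are boundary edges of \<open>S\<close>. The right side counts
  boundary edges from their endpoint in \<open>S\<close>, the form in which \<open>crossing\<close>
  appears as a reroot count.\<close>

lemma expansion_min:
  assumes S: "S \<subseteq> Verts (H n)"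
  shows "c * min (real (card S)) (real (card (Verts (H n))) - real (card S)) \<le>
    (\<Sum>u\<in>Verts (H n). real (card {x \<in> Verts (H n). u \<in> S \<and> x \<notin> S \<and> {u, x} \<in> Edges (H n)}))"
proof -
  let ?V = "Verts (H n)"
  let ?P = "SIGMA u:?V. {x \<in> ?V. u \<in> S \<and> x \<notin> S \<and> {u, x} \<in> Edges (H n)}"
  have "edge_boundary (H n) S \<subseteq> (\<lambda>(u, x). {u, x}) ` ?P"
    unfolding edge_boundary_def using S by (auto intro!: rev_image_eqI)
  then have "card (edge_boundary (H n) S) \<le> card ?P"
    using finite by (intro surj_card_le) auto
  then have 1: "real (card (edge_boundary (H n) S)) \<le>
      (\<Sum>u\<in>?V. real (card {x \<in> ?V. u \<in> S \<and> x \<notin> S \<and> {u, x} \<in> Edges (H n)}))"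
    using finite by (simp add: card_SigmaI flip: of_nat_sum)
  have "finite S" using finite S by (rule finite_subset[rotated])
  then have cV: "real (card (?V - S)) = real (card ?V) - real (card S)"
    using S finite by (simp add: card_Diff_subset card_mono of_nat_diff)
  show ?thesis
  proof (cases "real (card S) \<le> real (card ?V) / 2")
    case True
    then have "min (real (card S)) (real (card ?V) - real (card S)) = real (card S)" by simp
    then show ?thesis using expansion[OF S True] 1 by simp
  next
    case False
    then have m: "min (real (card S)) (real (card ?V) - real (card S)) = real (card (?V - S))"
      unfolding cV by simp
    have sub: "edge_boundary (H n) (?V - S) \<subseteq> edge_boundary (H n) S"
      unfolding edge_boundary_def by (fastforce simp: insert_commute)
    have "e \<subseteq> ?V" if "e \<in> Edges (H n)" for e
      using that ugraph[of n] unfolding ugraph_def by auto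
    then have "edge_boundary (H n) S \<subseteq> Pow ?V" unfolding edge_boundary_def by blast
    from finite_subset[OF this] have "finite (edge_boundary (H n) S)" using finite by simp
    then have "card (edge_boundary (H n) (?V - S)) \<le> card (edge_boundary (H n) S)"
      by (rule card_mono[OF _ sub])
    moreover have "c * real (card (?V - S)) \<le> real (card (edge_boundary (H n) (?V - S)))"
      by (rule expansion) (use False cV in auto)
    ultimately show ?thesis using 1 unfolding m by linarith
  qed
qed

text \<open>\<open>expansion_min\<close> divided by the number of vertices, in the limit: densities
  of \<open>A\<close> tend to its probability and edge counts per vertex to the expected
  mass.\<close>

lemma local_event_isoperimetry:
  assumes A: "local_event \<Delta> 1 r A"
  shows "ennreal (c * min (prob A) (1 - prob A)) \<le> (\<integral>\<^sup>+X. mass out_roots (indicator (crossing \<Delta> A)) X \<partial>\<mu>)"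
proof -
  let ?B = "crossing \<Delta> A"
  \<comment> \<open>\<open>Suc r\<close> because the radius must also bound the range, and adjacent
    roots are at distance 1.\<close>
  have B: "local_event \<Delta> 2 (Suc r) ?B" by (rule local_event_crossing[OF local_event_mono[OF A]]) simp
  have B': "?B \<subseteq> near \<Delta> (Suc r)"
    using adjacent_subset_near near_mono[of 1 "Suc r" \<Delta>] unfolding crossing_def by auto
  note I = nn_integral_mass_indicator[OF disjI1[OF refl] B B']
  have iff: "iso_class (H n, out_roots u x) \<in> ?B \<longleftrightarrow>
      iso_class (H n, [u]) \<in> A \<and> iso_class (H n, [x]) \<notin> A \<and> {u, x} \<in> Edges (H n)"
    if "u \<in> Verts (H n)" "x \<in> Verts (H n)" for n u x
  proof -
    have R: "(H n, [u, x]) \<in> rooted_graphs \<Delta> 2"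
      using rerooting_rooted_graphs[OF rerooting_out H_rooted[OF that(1)] that(2)] by (simp add: out_roots_def)
    show ?thesis
      using root_class_iso_class[OF _ R, of 0] root_class_iso_class[OF _ R, of 1] adjacent_iff[OF R]
      unfolding crossing_def out_roots_def by auto
  qed
  have "c * min (density_of n A) (1 - density_of n A) \<le>
      (\<Sum>u\<in>Verts (H n). real (card {x \<in> Verts (H n). iso_class (H n, out_roots u x) \<in> ?B})) / real (card (Verts (H n)))"
    (is "_ \<le> ?s / ?N") for n
  proof -
    let ?S = "{u \<in> Verts (H n). iso_class (H n, [u]) \<in> A}"
    have N: "?N > 0" using card_pos by simp
    have "c * min (real (card ?S)) (?N - real (card ?S)) \<le> ?s"
    proof -
      have "{x \<in> Verts (H n). u \<in> ?S \<and> x \<notin> ?S \<and> {u, x} \<in> Edges (H n)}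
          = {x \<in> Verts (H n). iso_class (H n, out_roots u x) \<in> ?B}" if "u \<in> Verts (H n)" for u
        using iff that by blast
      then show ?thesis using expansion_min[of ?S n] by simp
    qed
    moreover have "min (density_of n A) (1 - density_of n A) = min (real (card ?S)) (?N - real (card ?S)) / ?N"
      unfolding density_of_def using N by (simp add: min_def field_simps)
    ultimately show ?thesis using N by (simp add: divide_right_mono)
  qed
  moreover have "(\<lambda>n. c * min (density_of n A) (1 - density_of n A)) \<longlonglongrightarrow> c * min (prob A) (1 - prob A)"
    by (intro tendsto_intros local_event_limit[OF A])
  ultimately have "c * min (prob A) (1 - prob A) \<le> (\<integral>X. real (reroot_count out_roots ?B X) \<partial>\<mu>)"
    using LIMSEQ_le[OF _ I(2)] by blast
  then show ?thesis unfolding I(1) by (rule ennreal_leI)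
qed

theorem zero_one:
  assumes A: "A \<in> sets \<mu>" and inv: "(\<integral>\<^sup>+X. mass out_roots (indicator (crossing \<Delta> A)) X \<partial>\<mu>) = 0"
  shows "prob A = 0 \<or> prob A = 1"
proof (rule ccontr)
  define m where "m = min (prob A) (1 - prob A)"
  \<comment> \<open>Edges with an endpoint in the symmetric difference are counted once for each
    position of that endpoint, at a cost of at most \<open>1 + \<Delta>\<close> per root.\<close>
  define K where "K = 2 * (1 + real \<Delta>)"
  assume "\<not> ?thesis"
  then have m: "m > 0"
    using prob_le_1[of A] measure_nonneg[of \<mu> A] unfolding m_def by (auto simp: less_le)
  \<comment> \<open>Chosen so that the final estimate \<open>c * m \<le> (c + K) * prob D\<close>
    becomes \<open>c * m < c * m / 2\<close>.\<close>
  define e where "e = c * m / (2 * (c + K))"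
  have K: "K > 0" and e: "e > 0" using m c_pos unfolding K_def e_def by (auto intro!: divide_pos_pos add_pos_pos mult_pos_pos)
  obtain r A' where A': "local_event \<Delta> 1 r A'" and d: "prob ((A - A') \<union> (A' - A)) < e"
    using local_event_approx[OF finite_measure_axioms _ sets_\<mu> A e] by auto
  have A's: "A' \<in> sets \<mu>" using local_event_sets[OF _ A'] sets_\<mu> by simp
  define D where "D = (A - A') \<union> (A' - A)"
  have D: "D \<in> sets \<mu>" unfolding D_def using A A's by simp
  let ?E = "\<lambda>i. {Z \<in> adjacent \<Delta>. root_class i Z \<in> D}"
  have meas: "(indicator (?E i) :: _ \<Rightarrow> ennreal) \<in> borel_measurable (local_borel \<Delta> 2)" if "i < 2" for i
    using root_class_sets[of D \<Delta> i] D that unfolding sets_\<mu> by simp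
  have measc: "(indicator (crossing \<Delta> A) :: _ \<Rightarrow> ennreal) \<in> borel_measurable (local_borel \<Delta> 2)"
    using crossing_sets[of A \<Delta>] A unfolding sets_\<mu> by simp
  have mm: "mass out_roots F \<in> borel_measurable \<mu>" if "F \<in> borel_measurable (local_borel \<Delta> 2)" for F
    using measurable_mass[OF disjI1[OF refl] that] by (simp add: measurable_cong_sets[OF sets_\<mu> refl])
  have E: "(\<integral>\<^sup>+X. mass f (indicator (?E i)) X \<partial>\<mu>) \<le> of_nat (1 + \<Delta>) * emeasure \<mu> D"
    if "(f, i) \<in> {(out_roots, 0), (in_roots, 1)}" for f i
  proof -
    have "(\<integral>\<^sup>+X. mass f (indicator (?E i)) X \<partial>\<mu>) \<le> (\<integral>\<^sup>+X. of_nat (1 + \<Delta>) * indicator D X \<partial>\<mu>)"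
      by (rule nn_integral_mono) (use mass_adjacent_le[OF that] space_\<mu> in auto)
    also have "\<dots> = of_nat (1 + \<Delta>) * emeasure \<mu> D" by (rule nn_integral_cmult_indicator[OF D])
    finally show ?thesis .
  qed
  \<comment> \<open>An edge leaving \<open>A'\<close> starts in \<open>D\<close>, ends in \<open>D\<close>, or leaves \<open>A\<close>.\<close>
  have "(\<integral>\<^sup>+X. mass out_roots (indicator (crossing \<Delta> A')) X \<partial>\<mu>) \<le>
      (\<integral>\<^sup>+X. mass out_roots (\<lambda>Z. indicator (?E 0) Z + (indicator (?E 1) Z + indicator (crossing \<Delta> A) Z)) X \<partial>\<mu>)"
    by (intro nn_integral_mono mass_mono) (auto simp: le_fun_def crossing_def D_def split: split_indicator)
  also have "\<dots> = (\<integral>\<^sup>+X. mass out_roots (indicator (?E 0)) X \<partial>\<mu>) + (\<integral>\<^sup>+X. mass out_roots (indicator (?E 1)) X \<partial>\<mu>)"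
    unfolding mass_add using inv mm meas measc by (simp add: nn_integral_add)
  \<comment> \<open>The mass sent along edges that end in \<open>D\<close> is not controlled by the
    root; unimodularity replaces it by mass received at a root in \<open>D\<close>, which the degree
    bound controls.\<close>
  also have "(\<integral>\<^sup>+X. mass out_roots (indicator (?E 1)) X \<partial>\<mu>) = (\<integral>\<^sup>+X. mass in_roots (indicator (?E 1)) X \<partial>\<mu>)"
    using unimodular meas[of 1] unfolding unimodular_mass by simp
  also have "(\<integral>\<^sup>+X. mass out_roots (indicator (?E 0)) X \<partial>\<mu>) + \<dots> \<le>
      of_nat (1 + \<Delta>) * emeasure \<mu> D + of_nat (1 + \<Delta>) * emeasure \<mu> D"
    by (intro add_mono E) auto
  also have "\<dots> = ennreal (K * prob D)"
    unfolding K_def emeasure_eq_measure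
    by (simp add: ennreal_of_nat_eq_real_of_nat ennreal_mult[symmetric] ennreal_plus[symmetric] algebra_simps del: ennreal_plus)
  finally have "ennreal (c * min (prob A') (1 - prob A')) \<le> ennreal (K * prob D)"
    using local_event_isoperimetry[OF A'] by (rule order_trans[rotated])
  then have 1: "c * min (prob A') (1 - prob A') \<le> K * prob D"
    using K measure_nonneg[of \<mu> D] by (subst (asm) ennreal_le_iff) auto
  have "prob A \<le> prob (A' \<union> D)" "prob A' \<le> prob (A \<union> D)"
    using A A's D by (auto intro!: finite_measure_mono simp: D_def)
  then have "prob A \<le> prob A' + prob D" "prob A' \<le> prob A + prob D"
    using measure_Un_le[OF A's D] measure_Un_le[OF A D] by linarith+
  \<comment> \<open>Both arguments of the minimum change by at most \<open>prob D\<close> between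
    \<open>A\<close> and \<open>A'\<close>.\<close>
  then have "m - prob D \<le> min (prob A') (1 - prob A')" unfolding m_def by auto
  then have "c * (m - prob D) \<le> K * prob D" using 1 c_pos by (meson mult_left_mono less_imp_le order_trans)
  then have "c * m \<le> (c + K) * prob D" by (simp add: algebra_simps)
  also have "\<dots> < (c + K) * e" using d c_pos K unfolding D_def by (intro mult_strict_left_mono) auto
  also have "\<dots> = c * m / 2" using c_pos K unfolding e_def by (simp add: field_simps)
  finally show False using c_pos m by (simp add: mult_pos_pos not_less)
qed

section \<open>Ergodicity, invariant functions and extremality\<close>

lemma zero_one_of_crossing_empty:
  assumes "A \<in> sets \<mu>" "crossing \<Delta> A = {}" shows "prob A = 0 \<or> prob A = 1"
  by (rule zero_one[OF assms(1)]) (simp add: assms(2) mass_def)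

text \<open>With an empty list of roots, rooted isomorphism is plain graph isomorphism, so its
  symmetry and transitivity can be reused.\<close>

lemma graph_of_iso_class:
  assumes "(G, [u]) \<in> rooted_graphs \<Delta> 1"
  shows "(G, []) \<cong>\<^sub>r (graph_of (iso_class (G, [u])), [])"
  using rep_iso[OF assms] unfolding rooted_iso_def by auto

theorem ergodic: "ergodic \<Delta> \<mu>"
  unfolding ergodic_def
proof
  fix A assume A: "A \<in> invariant_events \<Delta>"
  have "crossing \<Delta> A = {}"
  proof (rule crossing_emptyI)
    fix G u v assume G: "(G, [u]) \<in> rooted_graphs \<Delta> 1" "(G, [v]) \<in> rooted_graphs \<Delta> 1"
      and u: "iso_class (G, [u]) \<in> A"
    have "(graph_of (iso_class (G, [u])), []) \<cong>\<^sub>r (graph_of (iso_class (G, [v])), [])"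
      using graph_of_iso_class[OF G(1)] graph_of_iso_class[OF G(2)] rooted_iso_sym rooted_iso_trans by blast
    then obtain \<phi> where "graph_iso \<phi> (graph_of (iso_class (G, [u]))) (graph_of (iso_class (G, [v])))"
      unfolding rooted_iso_def by auto
    then show "iso_class (G, [v]) \<in> A"
      using A u iso_class_in_rooted_classes[OF G(2)] unfolding invariant_events_def by blast
  qed
  then show "prob A = 0 \<or> prob A = 1"
    using A zero_one_of_crossing_empty unfolding invariant_events_def sets_\<mu> by blast
qed

theorem rerooting_invariant_const:
  assumes f: "f \<in> borel_measurable (local_borel \<Delta> 1)" and inv: "rerooting_invariant \<Delta> f"
  shows "\<exists>a. AE X in \<mu>. f X = a"
proof (rule AE_const_of_zero_one)
  have f_\<mu>[measurable]: "f \<in> borel_measurable \<mu>" using f measurable_cong_sets[OF sets_\<mu> refl] by blast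
  show "f \<in> borel_measurable \<mu>" by (rule f_\<mu>)
  show "prob {X \<in> space \<mu>. q < f X} = 0 \<or> prob {X \<in> space \<mu>. q < f X} = 1" for q
  proof (rule zero_one_of_crossing_empty)
    show "{X \<in> space \<mu>. q < f X} \<in> sets \<mu>" by measurable
    show "crossing \<Delta> {X \<in> space \<mu>. q < f X} = {}"
    proof (rule crossing_emptyI)
      fix G u v assume G: "(G, [u]) \<in> rooted_graphs \<Delta> 1" "(G, [v]) \<in> rooted_graphs \<Delta> 1"
        and u: "iso_class (G, [u]) \<in> {X \<in> space \<mu>. q < f X}"
      have "f (iso_class (G, [u])) = f (iso_class (G, [v]))"
        using inv G unfolding rerooting_invariant_def by blast
      then show "iso_class (G, [v]) \<in> {X \<in> space \<mu>. q < f X}"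
        using u iso_class_in_rooted_classes[OF G(2)] unfolding space_\<mu> by simp
    qed
  qed
qed

text \<open>Mass transport under \<open>\<nu>\<close> along the edges leaving \<open>{q < D}\<close>, for \<open>D\<close> the density of \<open>\<nu>\<close>: the mass sent
  out is weighted by values above \<open>q\<close>, the mass received by values at most \<open>q\<close>, so there are
  almost surely no such edges.\<close>
lemma unimodular_absolutely_continuous_eq:
  assumes \<nu>: "unimodular \<Delta> \<nu>" and ac: "absolutely_continuous \<mu> \<nu>"
  shows "\<nu> = \<mu>"
proof -
  interpret \<nu>: prob_space \<nu> using \<nu> unfolding unimodular_def random_rooted_graph_def by simp
  have sets_\<nu>: "sets \<nu> = sets \<mu>" using \<nu> sets_\<mu> unfolding unimodular_def random_rooted_graph_def by simp
  obtain D where D[measurable]: "D \<in> borel_measurable \<mu>" and RN: "AE X in \<mu>. RN_deriv \<mu> \<nu> X = ennreal (D X)"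
    and D0: "\<And>X. 0 \<le> D X"
    using real_RN_deriv[OF \<nu>.finite_measure_axioms ac sets_\<nu>] by metis
  have "density \<mu> (\<lambda>X. ennreal (D X)) = density \<mu> (RN_deriv \<mu> \<nu>)"
    using RN by (intro density_cong) auto
  then have dens: "\<nu> = density \<mu> (\<lambda>X. ennreal (D X))" using density_RN_deriv[OF ac sets_\<nu>] by simp
  have "\<exists>a. AE X in \<mu>. D X = a"
  proof (rule AE_const_of_zero_one[OF D])
    fix q
    let ?A = "{X \<in> space \<mu>. q < D X}"
    have A: "?A \<in> sets \<mu>" by measurable
    let ?F = "indicator (crossing \<Delta> ?A) :: _ \<Rightarrow> ennreal"
    let ?out = "mass out_roots ?F" and ?in = "mass in_roots ?F"
    have F: "?F \<in> borel_measurable (local_borel \<Delta> 2)"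
      using crossing_sets[of ?A \<Delta>] A unfolding sets_\<mu> by simp
    have [measurable]: "?out \<in> borel_measurable \<mu>" "?in \<in> borel_measurable \<mu>"
      using measurable_mass[OF disjI1[OF refl] F] measurable_mass[OF disjI2[OF refl] F]
      by (simp_all add: measurable_cong_sets[OF sets_\<mu> refl])
    have out0: "?out X = 0" if "X \<in> space \<mu>" "D X \<le> q" for X
      by (rule mass_root_eq_0[where i = 0]) (use that space_\<mu> in \<open>auto simp: crossing_def\<close>)
    have in0: "?in X = 0" if "X \<in> space \<mu>" "q < D X" for X
      by (rule mass_root_eq_0[where i = 1]) (use that space_\<mu> in \<open>auto simp: crossing_def\<close>)
    have "(\<integral>\<^sup>+X. ?out X \<partial>\<mu>) = 0"
    proof (cases "q < 0")
      \<comment> \<open>Separate because \<open>ennreal q\<close> is 0 for negative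
        \<open>q\<close>, which breaks the splitting used below. Here the superlevel set is the
        whole space and nothing crosses.\<close>
      case True
      then have "?in X = 0" if "X \<in> space \<mu>" for X
        using in0[OF that] D0[of X] by auto
      then have "(\<integral>\<^sup>+X. ?in X \<partial>\<mu>) = (\<integral>\<^sup>+X. 0 \<partial>\<mu>)" by (intro nn_integral_cong) auto
      then show ?thesis using unimodular F unfolding unimodular_mass by simp
    next
      case False
      \<comment> \<open>The excess over level \<open>q\<close> on the sending side. Transport under
        \<open>\<nu>\<close> moves the weighted mass to the receiving side, where the weight is at
        most \<open>q\<close>; transport under \<open>\<mu>\<close> brings it back as
        \<open>q\<close> times the mass sent, which leaves no room for the excess.\<close>
      let ?g = "\<lambda>X. ennreal (max 0 (D X - q)) * ?out X"
      \<comment> \<open>Crossing pairs are adjacent, so the range is 1. Finiteness permits the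
        cancellation at the end of the chain.\<close>
      have fin: "(\<integral>\<^sup>+X. ?out X \<partial>\<mu>) < \<infinity>"
        by (rule nn_integral_mass_near_finite[OF disjI1[OF refl] random, of _ 1])
           (use adjacent_subset_near in \<open>auto simp: crossing_def\<close>)
      have "(\<integral>\<^sup>+X. ennreal q * ?out X \<partial>\<mu>) + (\<integral>\<^sup>+X. ?g X \<partial>\<mu>) = (\<integral>\<^sup>+X. ennreal q * ?out X + ?g X \<partial>\<mu>)"
        by (rule nn_integral_add[symmetric]) measurable
      also have "\<dots> = (\<integral>\<^sup>+X. ennreal (D X) * ?out X \<partial>\<mu>)"
      proof (rule nn_integral_cong)
        fix X assume X: "X \<in> space \<mu>"
        show "ennreal q * ?out X + ?g X = ennreal (D X) * ?out X"
        proof (cases "D X \<le> q")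
          case True then show ?thesis using out0[OF X] by simp
        next
          case False
          then have "ennreal q + ennreal (max 0 (D X - q)) = ennreal (D X)"
            using \<open>\<not> q < 0\<close> by (subst ennreal_plus[symmetric]) auto
          then show ?thesis unfolding distrib_right[symmetric] by simp
        qed
      qed
      also have "\<dots> = (\<integral>\<^sup>+X. ?out X \<partial>\<nu>)" unfolding dens by (rule nn_integral_density[symmetric]) measurable
      also have "\<dots> = (\<integral>\<^sup>+X. ?in X \<partial>\<nu>)" using \<nu> F unfolding unimodular_mass by blast
      also have "\<dots> = (\<integral>\<^sup>+X. ennreal (D X) * ?in X \<partial>\<mu>)" unfolding dens by (rule nn_integral_density) measurable
      also have "\<dots> \<le> (\<integral>\<^sup>+X. ennreal q * ?in X \<partial>\<mu>)"
      proof (rule nn_integral_mono)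
        fix X assume X: "X \<in> space \<mu>"
        show "ennreal (D X) * ?in X \<le> ennreal q * ?in X"
          using in0[OF X] by (cases "q < D X") (auto intro!: mult_right_mono ennreal_leI)
      qed
      also have "\<dots> = ennreal q * (\<integral>\<^sup>+X. ?in X \<partial>\<mu>)" by (rule nn_integral_cmult) measurable
      also have "\<dots> = ennreal q * (\<integral>\<^sup>+X. ?out X \<partial>\<mu>)" using unimodular F unfolding unimodular_mass by simp
      also have "\<dots> = (\<integral>\<^sup>+X. ennreal q * ?out X \<partial>\<mu>)" by (rule nn_integral_cmult[symmetric]) measurable
      finally have le: "(\<integral>\<^sup>+X. ennreal q * ?out X \<partial>\<mu>) + (\<integral>\<^sup>+X. ?g X \<partial>\<mu>) \<le> (\<integral>\<^sup>+X. ennreal q * ?out X \<partial>\<mu>)" .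
      have "(\<integral>\<^sup>+X. ennreal q * ?out X \<partial>\<mu>) < \<infinity>"
        using fin by (subst nn_integral_cmult) (auto simp: ennreal_mult_less_top)
      then have "(\<integral>\<^sup>+X. ?g X \<partial>\<mu>) = 0"
        by (rule ennreal_add_le_selfD[OF le])
      then have "AE X in \<mu>. ?g X = 0" by (subst (asm) nn_integral_0_iff_AE) auto
      then have "AE X in \<mu>. ?out X = 0"
        using AE_space
      proof eventually_elim
        case (elim X)
        then show ?case using out0[of X] by (cases "D X \<le> q") auto
      qed
      then show ?thesis by (subst nn_integral_0_iff_AE) auto
    qed
    then show "prob ?A = 0 \<or> prob ?A = 1" by (rule zero_one[OF A])
  qed
  then obtain a where a: "AE X in \<mu>. D X = a" by blast
  then have \<nu>a: "\<nu> = density \<mu> (\<lambda>_. ennreal a)" unfolding dens by (intro density_cong) auto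
  have "1 = emeasure \<nu> (space \<mu>)" using \<nu>.emeasure_space_1 sets_eq_imp_space_eq[OF sets_\<nu>] by simp
  also have "\<dots> = ennreal a" unfolding \<nu>a by (subst emeasure_density) (auto simp: emeasure_space_1)
  finally show ?thesis unfolding \<nu>a using density_1 by metis
qed

text \<open>Both weights are positive, so each component of a convex combination is absolutely
  continuous with respect to \<open>\<mu>\<close>.\<close>

theorem extremal: "extremal_unimodular \<Delta> \<mu>"
  unfolding extremal_unimodular_def
proof (intro conjI allI impI unimodular; elim conjE)
  fix \<nu>1 \<nu>2 :: "nat rooted set measure" and t :: real
  assume \<nu>: "unimodular \<Delta> \<nu>1" "unimodular \<Delta> \<nu>2" and t: "0 < t" "t < 1"
    and mix: "\<forall>A\<in>sets \<mu>. prob A = t * measure \<nu>1 A + (1 - t) * measure \<nu>2 A"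
  have s: "sets \<nu>1 = sets \<mu>" "sets \<nu>2 = sets \<mu>" "finite_measure \<nu>1" "finite_measure \<nu>2"
    using \<nu> sets_\<mu> unfolding unimodular_def random_rooted_graph_def by (auto intro: prob_space.finite_measure)
  have ac: "absolutely_continuous \<mu> \<nu>1" "absolutely_continuous \<mu> \<nu>2"
  proof -
    have "measure \<nu>1 A = 0 \<and> measure \<nu>2 A = 0" if "A \<in> null_sets \<mu>" for A
    proof -
      have "prob A = 0" "A \<in> sets \<mu>" using that by (auto simp: measure_def)
      then have "t * measure \<nu>1 A + (1 - t) * measure \<nu>2 A = 0" using mix by simp
      moreover have "t * measure \<nu>1 A \<ge> 0" "(1 - t) * measure \<nu>2 A \<ge> 0" using t by simp_all
      ultimately have "t * measure \<nu>1 A = 0" "(1 - t) * measure \<nu>2 A = 0" by linarith+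
      then show ?thesis using t by simp
    qed
    then show "absolutely_continuous \<mu> \<nu>1" "absolutely_continuous \<mu> \<nu>2"
      using s unfolding absolutely_continuous_def
      by (auto simp: null_sets_def finite_measure.emeasure_eq_measure)
  qed
  show "\<nu>1 = \<mu>" by (rule unimodular_absolutely_continuous_eq[OF \<nu>(1) ac(1)])
  show "\<nu>2 = \<mu>" by (rule unimodular_absolutely_continuous_eq[OF \<nu>(2) ac(2)])
qed

end

section \<open>Percolation clusters\<close>

text \<open>Some vertex is at distance exactly \<open>r + 1\<close> from the roots. For finite balls
  this turns infiniteness of a component into countably many conditions on balls.\<close>

definition grows :: "'a rooted \<Rightarrow> nat \<Rightarrow> bool" where
  "grows R r \<longleftrightarrow> reach R r \<noteq> reach R (Suc r)"

text \<open>\<open>T\<close> may contain sets that are not edges, so the same set of open edges can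
  be applied to a graph and to its balls.\<close>

definition keep_edges :: "'a rooted \<Rightarrow> 'a set set \<Rightarrow> 'a rooted" where
  "keep_edges R T = (\<lparr>Verts = Verts (fst R), Edges = Edges (fst R) \<inter> T\<rparr>, snd R)"

text \<open>A ball that has stopped growing is closed under taking neighbours and never grows
  again.\<close>

lemma grows_antimono:
  assumes "grows R s" "r \<le> s" shows "grows R r"
proof -
  have *: "grows R r" if "grows R (Suc r)" for r
  proof (rule ccontr)
    assume "\<not> ?thesis"
    then have eq: "reach R r = reach R (Suc r)" by (simp add: grows_def)
    have "reach R (Suc (Suc r)) \<subseteq> reach R (Suc r)"
    proof
      fix z assume "z \<in> reach R (Suc (Suc r))"
      from reach_Suc_cases[OF this] show "z \<in> reach R (Suc r)"
        using reach_step[of _ R r z] eq by auto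
    qed
    then have "reach R (Suc r) = reach R (Suc (Suc r))"
      using reach_mono[of "Suc r" "Suc (Suc r)" R] by auto
    then show False using that by (simp add: grows_def)
  qed
  show ?thesis using assms(2,1) by (induction rule: inc_induct) (auto intro: *)
qed

text \<open>If growth stops, the component is a finite ball; if it never stops, each radius adds at
  least one vertex.\<close>

lemma infinite_component_iff_grows:
  assumes fin: "\<And>r. finite (reach (G, [v]) r)"
  shows "infinite {w. (v, w) \<in> (adj G)\<^sup>*} \<longleftrightarrow> (\<forall>r. grows (G, [v]) r)"
proof -
  have C: "{w. (v, w) \<in> (adj G)\<^sup>*} = (\<Union>r. reach (G, [v]) r)"
    unfolding reach_def by (auto simp: rtrancl_power)
  show ?thesis
  proof (intro iffI allI)
    fix r assume inf: "infinite {w. (v, w) \<in> (adj G)\<^sup>*}"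
    show "grows (G, [v]) r"
    proof (rule ccontr)
      assume n: "\<not> grows (G, [v]) r"
      have "reach (G, [v]) s \<subseteq> reach (G, [v]) r" for s
      proof (induction s)
        case 0 show ?case by (rule reach_mono) simp
      next
        case (Suc s)
        show ?case
        proof (cases "r \<le> s")
          case True
          then have "\<not> grows (G, [v]) s" using n grows_antimono by blast
          then show ?thesis using Suc by (simp add: grows_def)
        next
          case False
          then show ?thesis by (intro reach_mono) simp
        qed
      qed
      then have "{w. (v, w) \<in> (adj G)\<^sup>*} \<subseteq> reach (G, [v]) r" unfolding C by blast
      then show False using inf fin finite_subset by blast
    qed
  next
    assume g: "\<forall>r. grows (G, [v]) r"
    have card: "r \<le> card (reach (G, [v]) r)" for r
    proof (induction r)
      case (Suc r)
      have "reach (G, [v]) r \<subset> reach (G, [v]) (Suc r)"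
        using g reach_mono[of r "Suc r" "(G, [v])"] unfolding grows_def by auto
      from psubset_card_mono[OF fin this] show ?case using Suc by simp
    qed simp
    show "infinite {w. (v, w) \<in> (adj G)\<^sup>*}"
    proof
      assume "finite {w. (v, w) \<in> (adj G)\<^sup>*}"
      then have "card (reach (G, [v]) r) \<le> card {w. (v, w) \<in> (adj G)\<^sup>*}" for r
        by (rule card_mono) (auto simp: C)
      from this[of "Suc (card {w. (v, w) \<in> (adj G)\<^sup>*})"] card[of "Suc (card {w. (v, w) \<in> (adj G)\<^sup>*})"]
      show False by simp
    qed
  qed
qed

section \<open>Open clusters inside balls\<close>

lemma reach_keep_edges_subset: "reach (keep_edges R T) r \<subseteq> reach R r"
  using reach_image[of "keep_edges R T" r id R r] by (simp add: keep_edges_def)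

text \<open>Open paths of length at most \<open>s\<close> from a root never leave the ball of radius
  \<open>s\<close> of the full graph.\<close>

lemma reach_keep_edges_ball:
  assumes "r \<le> s"
  shows "reach (keep_edges (rooted_ball R s) T) r = reach (keep_edges R T) r"
proof
  have "id ` reach (keep_edges (rooted_ball R s) T) r \<subseteq> reach (keep_edges R T) r"
    by (rule reach_image[OF _ _ order_refl]) (auto simp: keep_edges_def rooted_ball_eq induced_subgraph_def)
  then show "reach (keep_edges (rooted_ball R s) T) r \<subseteq> reach (keep_edges R T) r" by simp
  have "id ` reach (keep_edges R T) r \<subseteq> reach (keep_edges (rooted_ball R s) T) r"
  proof (rule reach_image[OF _ _ assms])
    fix u v assume uv: "u \<in> reach (keep_edges R T) s" "v \<in> reach (keep_edges R T) s"
      "{u, v} \<in> Edges (fst (keep_edges R T))"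
    then have "u \<in> reach R s" "v \<in> reach R s" using uv(1,2)[THEN subsetD[OF reach_keep_edges_subset]] by auto
    then show "{id u, id v} \<in> Edges (fst (keep_edges (rooted_ball R s) T))"
      using uv(3) by (simp add: keep_edges_def rooted_ball_eq induced_subgraph_def)
  qed (simp add: keep_edges_def rooted_ball_eq)
  then show "reach (keep_edges R T) r \<subseteq> reach (keep_edges (rooted_ball R s) T) r" by simp
qed

lemma grows_keep_edges_ball: "grows (keep_edges (rooted_ball R (Suc r)) T) r \<longleftrightarrow> grows (keep_edges R T) r"
  unfolding grows_def by (simp add: reach_keep_edges_ball)

lemma grows_ball_iso:
  assumes ok: "well_rooted R" "well_rooted S" and i: "rooted_ball R (Suc r) \<cong>\<^sub>r rooted_ball S (Suc r)"
    and g: "grows R r"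
  shows "grows S r"
proof -
  obtain \<phi> where \<phi>: "graph_iso \<phi> (fst (rooted_ball R (Suc r))) (fst (rooted_ball S (Suc r)))" "map \<phi> (snd R) = snd S"
    using i by (rule ball_isoE)
  note b = ball_iso_mono_reach[OF ok \<phi>]
  have "\<phi> ` reach R r = reach S r" "\<phi> ` reach R (Suc r) = reach S (Suc r)"
    using b[of r] b[of "Suc r"] by (auto simp: bij_betw_imp_surj_on)
  moreover have "reach R r \<subseteq> reach R (Suc r)" by (rule reach_mono) simp
  moreover have "inj_on \<phi> (reach R (Suc r))" using b[of "Suc r"] by (simp add: bij_betw_def)
  ultimately show ?thesis using g unfolding grows_def by (metis inj_on_image_eq_iff order_refl)
qed

lemma well_rooted_keep_edges: "well_rooted R \<Longrightarrow> well_rooted (keep_edges R T)"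
  unfolding well_rooted_def keep_edges_def ugraph_def by auto

lemma edge_subset_verts: "ugraph G \<Longrightarrow> e \<in> Edges G \<Longrightarrow> e \<subseteq> Verts G"
  unfolding ugraph_def by auto

text \<open>The probability that the open cluster of the root contains a vertex at distance \<open>r + 1\<close> from
  it within the cluster, as an explicit polynomial in \<open>p\<close>.\<close>
definition reach_prob :: "'a rooted \<Rightarrow> nat \<Rightarrow> real \<Rightarrow> real" where
  "reach_prob R r p = (\<Sum>S\<in>Pow (Edges (fst R)). if grows (keep_edges R S) r
     then p ^ card S * (1 - p) ^ card (Edges (fst R) - S) else 0)"

lemma continuous_on_reach_prob: "continuous_on A (reach_prob R r)"
proof -
  have "continuous_on A (\<lambda>p. if b then p ^ m * (1 - p) ^ n else (0 :: real))" for b :: bool and m n :: nat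
    by (cases b) (auto intro!: continuous_intros)
  then show ?thesis unfolding reach_prob_def by (intro continuous_on_sum) auto
qed

text \<open>An isomorphism induces a bijection between sets of open edges that preserves the
  exponents of \<open>p\<close> and \<open>1 - p\<close> and the growth of the cluster, so the sums
  agree term by term.\<close>

lemma reach_prob_iso:
  assumes ok: "well_rooted R" "well_rooted S" and RS: "R \<cong>\<^sub>r S"
  shows "reach_prob R r p = reach_prob S r p"
proof -
  let ?E = "Edges (fst R)" and ?F = "Edges (fst S)" and ?V = "Verts (fst R)"
  obtain \<phi> where \<phi>: "graph_iso \<phi> (fst R) (fst S)" "map \<phi> (snd R) = snd S"
    using RS unfolding rooted_iso_def by blast
  have inj: "inj_on \<phi> ?V" and e: "\<And>u v. u \<in> ?V \<Longrightarrow> v \<in> ?V \<Longrightarrow> {u, v} \<in> ?E \<longleftrightarrow> {\<phi> u, \<phi> v} \<in> ?F"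
    and im: "\<phi> ` ?V = Verts (fst S)"
    using \<phi>(1) unfolding graph_iso_def bij_betw_def by auto
  have EV: "?E \<subseteq> Pow ?V" using ok(1) edge_subset_verts unfolding well_rooted_def by blast
  have injE: "inj_on ((`) \<phi>) ?E" by (rule inj_on_subset[OF inj_on_image_Pow[OF inj] EV])
  have imE: "(`) \<phi> ` ?E = ?F"
  proof (intro equalityI subsetI)
    fix f assume "f \<in> (`) \<phi> ` ?E"
    then obtain d where d: "d \<in> ?E" "f = \<phi> ` d" by blast
    then obtain u v where "u \<in> ?V" "v \<in> ?V" "d = {u, v}" using ok(1) unfolding well_rooted_def ugraph_def by blast
    then show "f \<in> ?F" using d e[of u v] by simp
  next
    fix f assume f: "f \<in> ?F"
    then obtain a b where ab: "a \<in> Verts (fst S)" "b \<in> Verts (fst S)" "f = {a, b}"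
      using ok(2) unfolding well_rooted_def ugraph_def by blast
    then obtain u v where uv: "u \<in> ?V" "v \<in> ?V" "a = \<phi> u" "b = \<phi> v" using im by blast
    then have "{u, v} \<in> ?E" using e f ab by blast
    moreover have "f = \<phi> ` {u, v}" using ab uv by simp
    ultimately show "f \<in> (`) \<phi> ` ?E" by blast
  qed
  have b: "bij_betw ((`) ((`) \<phi>)) (Pow ?E) (Pow ?F)"
    by (rule bij_betw_Pow) (simp add: bij_betw_def injE imE)
  have "grows (keep_edges R T) r \<longleftrightarrow> grows (keep_edges S ((`) \<phi> ` T)) r" if T: "T \<subseteq> ?E" for T
  proof -
    have "{u, v} \<in> ?E \<inter> T \<longleftrightarrow> {\<phi> u, \<phi> v} \<in> ?F \<inter> (`) \<phi> ` T" if uv: "u \<in> ?V" "v \<in> ?V" for u v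
    proof -
      have "{u, v} \<in> T \<longleftrightarrow> \<phi> ` {u, v} \<in> (`) \<phi> ` T" if "{u, v} \<in> ?E"
        using inj_on_image_mem_iff[OF injE that T] by simp
      then show ?thesis using e[OF uv] by auto
    qed
    then have "keep_edges R T \<cong>\<^sub>r keep_edges S ((`) \<phi> ` T)"
      using \<phi> ok(1) unfolding rooted_iso_def keep_edges_def graph_iso_def well_rooted_def
      by (intro conjI exI[of _ \<phi>]) auto
    note i = this rooted_iso_sym[OF this]
    note w = well_rooted_keep_edges[OF ok(1), of T] well_rooted_keep_edges[OF ok(2), of "(`) \<phi> ` T"]
    show ?thesis
      using grows_ball_iso[OF w iso_ball[OF w i(1)]] grows_ball_iso[OF w(2,1) iso_ball[OF w(2,1) i(2)]] by blast
  qed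
  moreover have "card ((`) \<phi> ` T) = card T" "card (?F - (`) \<phi> ` T) = card (?E - T)" if T: "T \<subseteq> ?E" for T
  proof -
    show "card ((`) \<phi> ` T) = card T" by (rule card_image[OF inj_on_subset[OF injE T]])
    have "?F - (`) \<phi> ` T = (`) \<phi> ` (?E - T)" using inj_on_image_set_diff[OF injE _ T, of ?E] imE by simp
    then show "card (?F - (`) \<phi> ` T) = card (?E - T)" using card_image[OF inj_on_subset[OF injE]] by simp
  qed
  ultimately show ?thesis
    unfolding reach_prob_def by (subst sum.reindex_bij_betw[OF b, symmetric]) (auto intro!: sum.cong)
qed

locale percolation_graph =
  fixes G :: "nat ugraph" and v0 :: nat and \<Delta> :: nat
  assumes R: "(G, [v0]) \<in> rooted_graphs \<Delta> 1"
begin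

lemma well: "well_rooted (G, [v])" if "v \<in> Verts G" for v
  using R that unfolding rooted_graphs_def well_rooted_def by simp

lemma degrees: "degrees_le \<Delta> G" using R unfolding rooted_graphs_def by simp

abbreviation ball_of :: "nat \<Rightarrow> nat \<Rightarrow> nat rooted" where "ball_of v r \<equiv> rooted_ball (G, [v]) (Suc r)"

definition grow_event :: "real \<Rightarrow> nat \<Rightarrow> nat \<Rightarrow> (nat set \<Rightarrow> bool) set" where
  "grow_event p v r = {\<omega> \<in> space (bond_percolation G p). grows (open_subgraph G \<omega>, [v]) r}"

lemma finite_ball_edges: "v \<in> Verts G \<Longrightarrow> finite (Edges (fst (ball_of v r)))"
proof -
  assume v: "v \<in> Verts G"
  have "Edges (fst (ball_of v r)) \<subseteq> Pow (reach (G, [v]) (Suc r))"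
    by (auto simp: rooted_ball_eq induced_subgraph_def)
  moreover have "finite (reach (G, [v]) (Suc r))" using reach_finite[OF well[OF v]] degrees by simp
  ultimately show ?thesis by (meson finite_Pow_iff finite_subset)
qed

lemma prob_space_bond: "prob_space (bond_percolation G p)"
  unfolding bond_percolation_def by (intro prob_space_PiM measure_pmf.prob_space_axioms)

text \<open>Growth at radius \<open>r\<close> is decided by the edges of the ball of radius
  \<open>r + 1\<close>, of which there are finitely many. The event is the disjoint union of the
  events \<open>C S\<close> that exactly the edges in \<open>S\<close> are open in this
  ball.\<close>

lemma
  assumes v: "v \<in> Verts G" and p: "0 \<le> p" "p \<le> 1"
  shows grow_event_sets: "grow_event p v r \<in> sets (bond_percolation G p)"
    and measure_grow_event: "measure (bond_percolation G p) (grow_event p v r) = reach_prob (ball_of v r) r p"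
proof -
  let ?M = "bond_percolation G p" and ?B = "ball_of v r"
  let ?F = "Edges (fst ?B)"
  interpret product_prob_space "\<lambda>_. measure_pmf (bernoulli_pmf p)" "Edges G"
    by unfold_locales
  interpret bond: prob_space ?M by (rule prob_space_bond)
  have F: "finite ?F" "?F \<subseteq> Edges G"
    using finite_ball_edges[OF v] by (auto simp: rooted_ball_eq induced_subgraph_def)
  define C where "C S = {\<omega> \<in> space ?M. \<forall>e\<in>?F. \<omega> e \<in> {e \<in> S}}" for S
  have C: "C S \<in> sets ?M" for S
  proof -
    have "C S = prod_emb (Edges G) (\<lambda>_. measure_pmf (bernoulli_pmf p)) ?F (Pi\<^sub>E ?F (\<lambda>e. {e \<in> S}))"
      unfolding C_def bond_percolation_def using F(2)
      by (auto simp: prod_emb_def space_PiM PiE_iff restrict_def extensional_def)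
    then show ?thesis unfolding bond_percolation_def
      by (auto intro!: sets_PiM_I F)
  qed
  have mC: "measure ?M (C S) = p ^ card S * (1 - p) ^ card (?F - S)" if S: "S \<subseteq> ?F" for S
  proof -
    have "emeasure ?M (C S) = (\<Prod>e\<in>?F. emeasure (measure_pmf (bernoulli_pmf p)) {e \<in> S})"
      unfolding C_def bond_percolation_def using F by (intro emeasure_PiM_Collect) auto
    also have "\<dots> = (\<Prod>e\<in>?F. ennreal (if e \<in> S then p else 1 - p))"
      using p by (intro prod.cong) (auto simp: emeasure_pmf_single)
    also have "\<dots> = ennreal (\<Prod>e\<in>?F. if e \<in> S then p else 1 - p)"
      using p by (intro prod_ennreal) auto
    also have "(\<Prod>e\<in>?F. if e \<in> S then p else 1 - p) = p ^ card S * (1 - p) ^ card (?F - S)"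
      using F(1) S by (simp add: prod.If_cases Int_absorb1 Diff_eq)
    finally show ?thesis using p by (simp add: measure_def)
  qed
  have eq: "grow_event p v r = (\<Union>S\<in>{S \<in> Pow ?F. grows (keep_edges ?B S) r}. C S)"
  proof -
    have *: "grows (open_subgraph G \<omega>, [v]) r \<longleftrightarrow> grows (keep_edges ?B S) r"
      if "\<omega> \<in> C S" "S \<subseteq> ?F" for \<omega> S
    proof -
      have "(open_subgraph G \<omega>, [v]) = keep_edges (G, [v]) {e. \<omega> e}"
        by (auto simp: open_subgraph_def keep_edges_def)
      moreover have "keep_edges ?B {e. \<omega> e} = keep_edges ?B S"
        using that by (auto simp: keep_edges_def C_def)
      ultimately show ?thesis using grows_keep_edges_ball by metis
    qed
    show ?thesis
    proof (intro equalityI subsetI)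
      fix \<omega> assume \<omega>: "\<omega> \<in> grow_event p v r"
      let ?S = "{e \<in> ?F. \<omega> e}"
      have "\<omega> \<in> C ?S" using \<omega> by (auto simp: grow_event_def C_def)
      moreover have "grows (keep_edges ?B ?S) r"
        using *[OF \<open>\<omega> \<in> C ?S\<close>] \<omega> by (auto simp: grow_event_def)
      ultimately show "\<omega> \<in> (\<Union>S\<in>{S \<in> Pow ?F. grows (keep_edges ?B S) r}. C S)"
        by (intro UN_I[of ?S]) simp_all
    next
      fix \<omega> assume "\<omega> \<in> (\<Union>S\<in>{S \<in> Pow ?F. grows (keep_edges ?B S) r}. C S)"
      then obtain S where S: "S \<subseteq> ?F" "grows (keep_edges ?B S) r" "\<omega> \<in> C S" by auto
      then show "\<omega> \<in> grow_event p v r"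
        using *[OF S(3,1)] by (simp add: grow_event_def C_def)
    qed
  qed
  have fin: "finite {S \<in> Pow ?F. grows (keep_edges ?B S) r}" using F by simp
  show "grow_event p v r \<in> sets ?M" unfolding eq using C fin by auto
  have "measure ?M (grow_event p v r) = (\<Sum>S | S \<in> Pow ?F \<and> grows (keep_edges ?B S) r. measure ?M (C S))"
    unfolding eq
  proof (rule bond.finite_measure_finite_Union[OF fin])
    show "disjoint_family_on C {S \<in> Pow ?F. grows (keep_edges ?B S) r}"
      unfolding disjoint_family_on_def C_def by auto
  qed (use C in auto)
  also have "\<dots> = (\<Sum>S | S \<in> Pow ?F \<and> grows (keep_edges ?B S) r. p ^ card S * (1 - p) ^ card (?F - S))"
    by (intro sum.cong mC) auto
  also have "\<dots> = reach_prob ?B r p"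
    unfolding reach_prob_def using F by (subst sum.inter_filter) auto
  finally show "measure ?M (grow_event p v r) = reach_prob ?B r p" .
qed

lemma grow_event_antimono: "r \<le> s \<Longrightarrow> grow_event p v s \<subseteq> grow_event p v r"
  unfolding grow_event_def using grows_antimono by blast

lemma reach_prob_antimono:
  assumes "v \<in> Verts G" "0 \<le> p" "p \<le> 1" "r \<le> s"
  shows "reach_prob (ball_of v s) s p \<le> reach_prob (ball_of v r) r p"
proof -
  interpret prob_space "bond_percolation G p" by (rule prob_space_bond)
  show ?thesis
    unfolding measure_grow_event[OF assms(1-3), symmetric]
    by (rule finite_measure_mono[OF grow_event_antimono[OF assms(4)] grow_event_sets[OF assms(1-3)]])
qed

text \<open>There are countably many vertices, so percolation has positive probability iff some
  vertex has an infinite cluster with positive probability. That probability is the limit of a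
  decreasing sequence, and the uniform bound \<open>1 / (real k + 1)\<close> expresses its
  positivity through closed conditions.\<close>

lemma percolates_iff:
  assumes p: "0 \<le> p" "p \<le> 1"
  shows "0 < measure (bond_percolation G p) {\<omega> \<in> space (bond_percolation G p). has_infinite_component (open_subgraph G \<omega>)}
    \<longleftrightarrow> (\<exists>v\<in>Verts G. \<exists>k. \<forall>r. 1 / (real k + 1) \<le> reach_prob (ball_of v r) r p)"
    (is "0 < measure ?M ?I \<longleftrightarrow> ?rhs")
proof -
  interpret prob_space ?M by (rule prob_space_bond)
  let ?A = "\<lambda>v. \<Inter>r. grow_event p v r"
  note s = grow_event_sets[OF _ p]
  have As: "?A v \<in> sets ?M" if "v \<in> Verts G" for v using s[OF that] by auto
  have I: "?I = (\<Union>v\<in>Verts G. ?A v)"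
  proof -
    have fin: "finite (reach (open_subgraph G \<omega>, [v]) r)" if "v \<in> Verts G" for \<omega> v r
    proof -
      have "reach (keep_edges (G, [v]) {e. \<omega> e}) r \<subseteq> reach (G, [v]) r" by (rule reach_keep_edges_subset)
      moreover have "keep_edges (G, [v]) {e. \<omega> e} = (open_subgraph G \<omega>, [v])"
        by (auto simp: open_subgraph_def keep_edges_def)
      ultimately show ?thesis
        using reach_finite[OF well[OF that], of \<Delta> r] degrees finite_subset by auto
    qed
    have "Verts (open_subgraph G \<omega>) = Verts G" for \<omega> by (simp add: open_subgraph_def)
    then have "has_infinite_component (open_subgraph G \<omega>) \<longleftrightarrow> (\<exists>v\<in>Verts G. \<forall>r. grows (open_subgraph G \<omega>, [v]) r)" for \<omega>
      unfolding has_infinite_component_def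
      by (intro bex_cong infinite_component_iff_grows fin) auto
    then show ?thesis by (simp add: set_eq_iff grow_event_def)
  qed
  have "measure ?M (?A v) > 0 \<longleftrightarrow> (\<exists>k. \<forall>r. 1 / (real k + 1) \<le> reach_prob (ball_of v r) r p)" if v: "v \<in> Verts G" for v
  proof
    assume "measure ?M (?A v) > 0"
    then obtain k where "1 / (real k + 1) < measure ?M (?A v)"
      using reals_Archimedean by (auto simp: inverse_eq_divide add.commute)
    moreover have "measure ?M (?A v) \<le> reach_prob (ball_of v r) r p" for r
      unfolding measure_grow_event[OF v p, symmetric] by (rule finite_measure_mono) (use s[OF v] in auto)
    ultimately show "\<exists>k. \<forall>r. 1 / (real k + 1) \<le> reach_prob (ball_of v r) r p"
      by (meson less_imp_le order_trans)
  next
    assume "\<exists>k. \<forall>r. 1 / (real k + 1) \<le> reach_prob (ball_of v r) r p"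
    then obtain k where k: "\<And>r. 1 / (real k + 1) \<le> measure ?M (grow_event p v r)"
      unfolding measure_grow_event[OF v p] by blast
    have "(\<lambda>r. measure ?M (grow_event p v r)) \<longlonglongrightarrow> measure ?M (?A v)"
      using s[OF v] grow_event_antimono by (intro finite_Lim_measure_decseq) (auto simp: decseq_def)
    then have "1 / (real k + 1) \<le> measure ?M (?A v)" by (rule LIMSEQ_le_const) (use k in auto)
    then show "measure ?M (?A v) > 0" by (rule less_le_trans[rotated]) simp
  qed
  moreover have "measure ?M ?I > 0 \<longleftrightarrow> (\<exists>v\<in>Verts G. measure ?M (?A v) > 0)"
  proof
    assume pos: "measure ?M ?I > 0"
    show "\<exists>v\<in>Verts G. measure ?M (?A v) > 0"
    proof (rule ccontr)
      assume not: "\<not> ?thesis"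
      have "measure ?M (?A v) = 0" if "v \<in> Verts G" for v
      proof -
        have "\<not> 0 < measure ?M (?A v)" using not that by blast
        then show ?thesis using measure_nonneg[of ?M "?A v"] by linarith
      qed
      then have "?A v \<in> null_sets ?M" if "v \<in> Verts G" for v
        using that As by (auto simp: null_sets_def emeasure_eq_measure)
      then have "?I \<in> null_sets ?M" unfolding I by (intro null_sets_UN') auto
      then show False using pos by (simp add: measure_eq_0_null_sets)
    qed
  next
    assume "\<exists>v\<in>Verts G. measure ?M (?A v) > 0"
    then obtain v where v: "v \<in> Verts G" "measure ?M (?A v) > 0" by blast
    have "measure ?M (?A v) \<le> measure ?M ?I" unfolding I
      by (rule finite_measure_mono) (use v As in \<open>auto intro!: sets.countable_UN'\<close>)
    then show "measure ?M ?I > 0" using v by simp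
  qed
  ultimately show ?thesis by blast
qed

lemma infinite_iff_grows: "infinite (Verts G) \<longleftrightarrow> (\<forall>r. grows (G, [v]) r)" if v: "v \<in> Verts G"
proof -
  have "{w. (v, w) \<in> (adj G)\<^sup>*} = Verts G"
  proof
    show "Verts G \<subseteq> {w. (v, w) \<in> (adj G)\<^sup>*}"
      using R v unfolding rooted_graphs_def graph_connected_def by auto
    show "{w. (v, w) \<in> (adj G)\<^sup>*} \<subseteq> Verts G"
      using reach_verts[OF well[OF v]] by (auto simp: rtrancl_power reach_def)
  qed
  then show ?thesis
    using infinite_component_iff_grows[of G v] reach_finite[OF well[OF v], of \<Delta>] degrees by simp
qed

text \<open>Compactness in \<open>p\<close> exchanges the quantifiers over \<open>p\<close> and \<open>r\<close>, so that only countably many local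
  events are involved.\<close>
lemma p_crit_less_iff:
  assumes inf: "infinite (Verts G)"
  shows "p_crit G < a \<longleftrightarrow> (\<exists>v\<in>Verts G. \<exists>n k. \<forall>r. \<exists>p\<in>{0..min 1 (a - 1 / (real n + 1))}.
    1 / (real k + 1) \<le> reach_prob (ball_of v r) r p)"
proof -
  define good where "good p \<longleftrightarrow> (\<exists>v\<in>Verts G. \<exists>k. \<forall>r. 1 / (real k + 1) \<le> reach_prob (ball_of v r) r p)" for p
  have pc: "p_crit G = Inf {p \<in> {0..1}. good p}"
    unfolding p_crit_def good_def using percolates_iff by (intro arg_cong[where f = Inf]) auto
  \<comment> \<open>Keeps the infimum away from the empty set: with all edges open the cluster is
    the whole infinite graph.\<close>
  have "good 1"
  proof -
    have v: "v0 \<in> Verts G" using R unfolding rooted_graphs_def by simp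
    have "1 \<le> reach_prob (ball_of v0 r) r 1" for r
    proof -
      let ?B = "ball_of v0 r"
      have "grows (keep_edges ?B (Edges (fst ?B))) r"
      proof -
        have "keep_edges ?B (Edges (fst ?B)) = keep_edges ?B UNIV" by (simp add: keep_edges_def)
        moreover have "keep_edges (G, [v0]) UNIV = (G, [v0])" by (simp add: keep_edges_def)
        ultimately show ?thesis using grows_keep_edges_ball infinite_iff_grows[OF v] inf by metis
      qed
      then have "1 = (if grows (keep_edges ?B (Edges (fst ?B))) r
          then 1 ^ card (Edges (fst ?B)) * (1 - 1) ^ card (Edges (fst ?B) - Edges (fst ?B)) else (0 :: real))" by simp
      also have "\<dots> \<le> reach_prob ?B r 1" unfolding reach_prob_def
        by (rule member_le_sum) (use finite_ball_edges[OF v] in auto)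
      finally show ?thesis .
    qed
    then show ?thesis unfolding good_def using v by (intro bexI[of _ v0] exI[of _ 0]) auto
  qed
  then have ne: "{p \<in> {0..1}. good p} \<noteq> {}" by (intro ex_in_conv[THEN iffD1] exI[of _ 1]) simp
  have "p_crit G < a \<longleftrightarrow> (\<exists>p\<in>{p \<in> {0..1}. good p}. p < a)"
    unfolding pc by (rule cInf_less_iff[OF ne]) (auto intro: bdd_belowI[of _ 0])
  \<comment> \<open>The strict bound on \<open>p\<close> becomes membership in one of countably many
    compact intervals, some of which may be empty.\<close>
  also have "\<dots> \<longleftrightarrow> (\<exists>n. \<exists>p\<in>{0..min 1 (a - 1 / (real n + 1))}. good p)"
  proof
    assume "\<exists>p\<in>{p \<in> {0..1}. good p}. p < a"
    then obtain p where p: "0 \<le> p" "p \<le> 1" "good p" "p < a" by auto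
    obtain n where "1 / (real n + 1) < a - p"
      using reals_Archimedean[of "a - p"] p(4) by (auto simp: inverse_eq_divide add.commute)
    then show "\<exists>n. \<exists>p\<in>{0..min 1 (a - 1 / (real n + 1))}. good p" using p by (intro exI[of _ n] bexI[of _ p]) auto
  next
    assume "\<exists>n. \<exists>p\<in>{0..min 1 (a - 1 / (real n + 1))}. good p"
    then obtain n p where p: "0 \<le> p" "p \<le> 1" "p \<le> a - 1 / (real n + 1)" "good p" by auto
    have "a - 1 / (real n + 1) < a" by simp
    then have "p < a" using p(3) by linarith
    then show "\<exists>p\<in>{p \<in> {0..1}. good p}. p < a" using p by auto
  qed
  also have "\<dots> \<longleftrightarrow> (\<exists>v\<in>Verts G. \<exists>n k. \<exists>p\<in>{0..min 1 (a - 1 / (real n + 1))}. \<forall>r. 1 / (real k + 1) \<le> reach_prob (ball_of v r) r p)"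
    unfolding good_def by blast
  also have "\<dots> \<longleftrightarrow> (\<exists>v\<in>Verts G. \<exists>n k. \<forall>r. \<exists>p\<in>{0..min 1 (a - 1 / (real n + 1))}. 1 / (real k + 1) \<le> reach_prob (ball_of v r) r p)"
  proof (intro bex_cong refl iff_exI)
    fix v and n k :: nat assume v: "v \<in> Verts G"
    let ?b = "min 1 (a - 1 / (real n + 1))"
    let ?K = "\<lambda>r. {p \<in> {0..?b}. 1 / (real k + 1) \<le> reach_prob (ball_of v r) r p}"
    have "compact (?K r)" for r
    proof -
      have "closed (?K r)"
        by (rule continuous_on_closed_Collect_le)
           (auto intro: continuous_on_reach_prob continuous_intros)
      then show ?thesis using compact_Int_closed[of "{0..?b}" "?K r"] by (simp add: Int_absorb1 subset_eq)
    qed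
    moreover have "?K s \<subseteq> ?K r" if "r \<le> s" for r s
      using reach_prob_antimono[OF v _ _ that] by (auto intro: order_trans)
    \<comment> \<open>The sets \<open>?K r\<close> are compact and, since \<open>reach_prob\<close>
      decreases with the radius, nested; if none is empty, they have a common point.\<close>
    ultimately have "(\<forall>r. ?K r \<noteq> {}) \<Longrightarrow> \<Inter>(range ?K) \<noteq> {}" by (intro compact_nest) auto
    then show "(\<exists>p\<in>{0..?b}. \<forall>r. 1 / (real k + 1) \<le> reach_prob (ball_of v r) r p) \<longleftrightarrow>
        (\<forall>r. \<exists>p\<in>{0..?b}. 1 / (real k + 1) \<le> reach_prob (ball_of v r) r p)"
      by blast
  qed
  finally show ?thesis .
qed

end

text \<open>The condition of \<open>p_crit_less_iff\<close> with the root in place of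
  \<open>v\<close>, written as a countable combination of local events. The remaining quantifier
  over vertices becomes one over rerootings.\<close>

definition percolating_before :: "nat \<Rightarrow> real \<Rightarrow> nat rooted set set" where
  "percolating_before \<Delta> a = (\<Union>n k. \<Inter>r. class_set \<Delta> 1
     (\<lambda>R. \<exists>p\<in>{0..min 1 (a - 1 / (real n + 1))}. 1 / (real k + 1) \<le> reach_prob (rooted_ball R (Suc r)) r p))"

lemma
  shows percolating_before_sets: "percolating_before \<Delta> a \<in> sets (local_borel \<Delta> 1)"
    and percolating_before_iff: "R \<in> rooted_graphs \<Delta> 1 \<Longrightarrow> iso_class R \<in> percolating_before \<Delta> a \<longleftrightarrow>
      (\<exists>n k. \<forall>r. \<exists>p\<in>{0..min 1 (a - 1 / (real n + 1))}. 1 / (real k + 1) \<le> reach_prob (rooted_ball R (Suc r)) r p)"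
proof -
  let ?P = "\<lambda>n k r R. \<exists>p\<in>{0..min 1 (a - 1 / (real n + 1))}. 1 / (real k + 1) \<le> reach_prob (rooted_ball R (Suc r)) r p"
  have *: "?P n k r S" if "R \<in> rooted_graphs \<Delta> 1" "S \<in> rooted_graphs \<Delta> 1"
    "rooted_ball R (Suc r) \<cong>\<^sub>r rooted_ball S (Suc r)" "?P n k r R" for n k r R S
    using that(4) reach_prob_iso[OF well_rooted_ball[OF rooted_graphs_well_rooted[OF that(1)]]
        well_rooted_ball[OF rooted_graphs_well_rooted[OF that(2)]] that(3)] by simp
  have "class_set \<Delta> 1 (?P n k r) \<in> sets (local_borel \<Delta> 1)" for n k r
    by (rule local_event_sets[OF zero_less_one local_event_class_set(1)[where r = "Suc r"]]) (rule *)
  then have "(\<Inter>r. class_set \<Delta> 1 (?P n k r)) \<in> sets (local_borel \<Delta> 1)" for n k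
    by (intro sets.countable_INT) auto
  then show "percolating_before \<Delta> a \<in> sets (local_borel \<Delta> 1)"
    unfolding percolating_before_def by (intro sets.countable_UN'') auto
  assume R: "R \<in> rooted_graphs \<Delta> 1"
  have "iso_class R \<in> class_set \<Delta> 1 (?P n k r) \<longleftrightarrow> ?P n k r R" for n k r
    by (rule local_event_class_set(2)[where r = "Suc r", OF * R])
  then show "iso_class R \<in> percolating_before \<Delta> a \<longleftrightarrow> (\<exists>n k. \<forall>r. ?P n k r R)"
    unfolding percolating_before_def by simp
qed

lemma p_crit_less_iff_class:
  assumes R: "(G, [v]) \<in> rooted_graphs \<Delta> 1" and inf: "infinite (Verts G)"
  shows "p_crit G < a \<longleftrightarrow> (\<exists>x\<in>Verts G. iso_class (G, [x]) \<in> percolating_before \<Delta> a)"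
proof -
  interpret percolation_graph G v \<Delta> by unfold_locales (rule R)
  have "(G, [x]) \<in> rooted_graphs \<Delta> 1" if "x \<in> Verts G" for x
    using R that unfolding rooted_graphs_def by simp
  then show ?thesis unfolding p_crit_less_iff[OF inf] using percolating_before_iff by (intro bex_cong) auto
qed

text \<open>A vertex witnessing \<open>p_crit G < a\<close> is mapped to a vertex with the same
  rooted class, so both numbers have the same strict upper bounds. This avoids transporting the
  percolation measures.\<close>

lemma p_crit_iso:
  assumes R: "(G, [v]) \<in> rooted_graphs \<Delta> 1" and S: "(H, [w]) \<in> rooted_graphs \<Delta> 1"
    and i: "(G, []) \<cong>\<^sub>r (H, [])" and inf: "infinite (Verts G)"
  shows "p_crit G = p_crit H"
proof -
  have le: "p_crit H < a" if R: "(G, [v]) \<in> rooted_graphs \<Delta> 1" and S: "(H, [w]) \<in> rooted_graphs \<Delta> 1"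
    and i: "(G, []) \<cong>\<^sub>r (H, [])" and inf: "infinite (Verts G)" "infinite (Verts H)" and a: "p_crit G < a"
    for G H v w a
  proof -
    obtain \<phi> where \<phi>: "graph_iso \<phi> G H" using i unfolding rooted_iso_def by auto
    obtain x where x: "x \<in> Verts G" "iso_class (G, [x]) \<in> percolating_before \<Delta> a"
      using a p_crit_less_iff_class[OF R inf(1)] by blast
    have y: "\<phi> x \<in> Verts H" using \<phi> x(1) unfolding graph_iso_def by (auto intro: bij_betw_apply)
    have "(G, [x]) \<cong>\<^sub>r (H, [\<phi> x])" using \<phi> x(1) unfolding rooted_iso_def by auto
    moreover have "(G, [x]) \<in> rooted_graphs \<Delta> 1" "(H, [\<phi> x]) \<in> rooted_graphs \<Delta> 1"
      using R S x(1) y unfolding rooted_graphs_def by simp_all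
    ultimately have "iso_class (G, [x]) = iso_class (H, [\<phi> x])" using iso_class_eq by blast
    then show ?thesis using p_crit_less_iff_class[OF S inf(2)] x(2) y by auto
  qed
  have inf': "infinite (Verts H)"
    using i inf bij_betw_finite unfolding rooted_iso_def graph_iso_def by fastforce
  have "p_crit G < a \<longleftrightarrow> p_crit H < a" for a
    using le[OF R S i inf inf'] le[OF S R rooted_iso_sym[OF i] inf' inf] by blast
  then show ?thesis by (metis less_irrefl linorder_neqE)
qed

section \<open>Measurability and invariance of the critical probability\<close>

definition infinite_classes :: "nat \<Rightarrow> nat rooted set set" where
  "infinite_classes \<Delta> = {X \<in> rooted_classes \<Delta> 1. infinite (Verts (graph_of X))}"

lemma infinite_classes_sets: "infinite_classes \<Delta> \<in> sets (local_borel \<Delta> 1)"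
proof -
  have *: "grows S r" if "R \<in> rooted_graphs \<Delta> 1" "S \<in> rooted_graphs \<Delta> 1"
    "rooted_ball R (Suc r) \<cong>\<^sub>r rooted_ball S (Suc r)" "grows R r" for R S :: "nat rooted" and r
    by (rule grows_ball_iso[OF rooted_graphs_well_rooted[OF that(1)] rooted_graphs_well_rooted[OF that(2)] that(3,4)])
  have s: "class_set \<Delta> 1 (\<lambda>R. grows R r) \<in> sets (local_borel \<Delta> 1)" for r
    by (rule local_event_sets[OF zero_less_one local_event_class_set(1)[where r = "Suc r"]]) (rule *)
  have "infinite (Verts (graph_of X)) \<longleftrightarrow> (\<forall>r. X \<in> class_set \<Delta> 1 (\<lambda>R. grows R r))"
    if X: "X \<in> rooted_classes \<Delta> 1" for X
  proof -
    let ?R = "(graph_of X, [hd (roots_of X)])"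
    interpret percolation_graph "graph_of X" "hd (roots_of X)" \<Delta>
      by unfold_locales (rule rep_graph_1[OF X])
    have "iso_class ?R \<in> class_set \<Delta> 1 (\<lambda>R. grows R r) \<longleftrightarrow> grows ?R r" for r
      by (rule local_event_class_set(2)[where r = "Suc r", OF * R])
    moreover have "iso_class ?R = X" using iso_class_rep[OF X] rep_roots_1(1)[OF X] by simp
    ultimately show ?thesis using infinite_iff_grows[OF rep_roots_1(2)[OF X]] by simp
  qed
  moreover have "(\<Inter>r. class_set \<Delta> 1 (\<lambda>R. grows R r)) \<subseteq> rooted_classes \<Delta> 1"
    using sets.sets_into_space[OF s[of 0]] unfolding space_local_borel by (rule INF_lower2[OF UNIV_I])
  ultimately have "infinite_classes \<Delta> = (\<Inter>r. class_set \<Delta> 1 (\<lambda>R. grows R r))"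
    unfolding infinite_classes_def by blast
  then show ?thesis using s by auto
qed

text \<open>On finite graphs \<open>p_crit\<close> is the infimum of the empty set, whence the case distinction.\<close>
lemma measurable_p_crit:
  "(\<lambda>X. if X \<in> infinite_classes \<Delta> then p_crit (graph_of X) else 0) \<in> borel_measurable (local_borel \<Delta> 1)"
  (is "?f \<in> _")
  unfolding borel_measurable_iff_less
proof
  fix a
  \<comment> \<open>For \<open>out_roots\<close> the index 1 belongs to the vertex summed over. The
    mass is therefore nonzero iff rerooting at some vertex lands in
    \<open>percolating_before\<close>, which reduces an existential quantifier over vertices to
    \<open>measurable_mass\<close>.\<close>
  let ?F = "indicator (root_class 1 -` percolating_before \<Delta> a \<inter> space (local_borel \<Delta> 2)) :: _ \<Rightarrow> ennreal"
  have "?F \<in> borel_measurable (local_borel \<Delta> 2)"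
    using measurable_sets[OF measurable_root_class percolating_before_sets] by simp
  from measurable_mass[OF disjI1[OF refl] this]
  have m: "{X \<in> space (local_borel \<Delta> 1). mass out_roots ?F X \<noteq> 0} \<in> sets (local_borel \<Delta> 1)"
    by (rule borel_measurable_neq) simp
  have "p_crit (graph_of X) < a \<longleftrightarrow> mass out_roots ?F X \<noteq> 0" if X: "X \<in> infinite_classes \<Delta>" for X
  proof -
    let ?G = "graph_of X" and ?v = "hd (roots_of X)"
    have X1: "X \<in> rooted_classes \<Delta> 1" and inf: "infinite (Verts ?G)" using X unfolding infinite_classes_def by auto
    note R = rep_graph_1[OF X1]
    have "?F (iso_class (?G, out_roots ?v x)) = indicator (percolating_before \<Delta> a) (iso_class (?G, [x]))"
      if x: "x \<in> Verts ?G" for x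
    proof -
      have Z: "(?G, [?v, x]) \<in> rooted_graphs \<Delta> 2"
        using rerooting_rooted_graphs[OF rerooting_out R x] by (simp add: out_roots_def)
      show ?thesis
        using root_class_iso_class[OF _ Z, of 1] iso_class_in_rooted_classes[OF Z]
        by (simp add: out_roots_def split: split_indicator)
    qed
    then have "mass out_roots ?F X = 0 \<longleftrightarrow> (\<forall>x\<in>Verts ?G. iso_class (?G, [x]) \<notin> percolating_before \<Delta> a)"
      unfolding mass_def by (subst nn_integral_0_iff_AE) (auto simp: AE_count_space split: split_indicator_asm)
    then show ?thesis using p_crit_less_iff_class[OF R inf] by auto
  qed
  then have "{X \<in> space (local_borel \<Delta> 1). ?f X < a} =
      (infinite_classes \<Delta> \<inter> {X \<in> space (local_borel \<Delta> 1). mass out_roots ?F X \<noteq> 0}) \<union>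
      ((space (local_borel \<Delta> 1) - infinite_classes \<Delta>) \<inter> (if 0 < a then space (local_borel \<Delta> 1) else {}))"
    unfolding infinite_classes_def by auto
  also have "\<dots> \<in> sets (local_borel \<Delta> 1)"
    by (intro sets.Un sets.Int sets.Diff sets.top m infinite_classes_sets) (auto simp del: space_local_borel)
  finally show "{X \<in> space (local_borel \<Delta> 1). ?f X < a} \<in> sets (local_borel \<Delta> 1)" .
qed

lemma rerooting_invariant_p_crit:
  "rerooting_invariant \<Delta> (\<lambda>X. if X \<in> infinite_classes \<Delta> then p_crit (graph_of X) else 0)"
  unfolding rerooting_invariant_def
proof (intro allI impI; elim conjE)
  fix G v w assume R: "(G, [v]) \<in> rooted_graphs \<Delta> 1" "(G, [w]) \<in> rooted_graphs \<Delta> 1"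
  let ?X = "iso_class (G, [v])" and ?Y = "iso_class (G, [w])"
  have XY: "?X \<in> rooted_classes \<Delta> 1" "?Y \<in> rooted_classes \<Delta> 1" using R by blast+
  have "(G, []) \<cong>\<^sub>r (graph_of ?X, [])" "(G, []) \<cong>\<^sub>r (graph_of ?Y, [])"
    using rep_iso[OF R(1)] rep_iso[OF R(2)] unfolding rooted_iso_def by auto
  then have i: "(graph_of ?X, []) \<cong>\<^sub>r (graph_of ?Y, [])" using rooted_iso_sym rooted_iso_trans by blast
  then have "finite (Verts (graph_of ?X)) \<longleftrightarrow> finite (Verts (graph_of ?Y))"
    using bij_betw_finite unfolding rooted_iso_def graph_iso_def by fastforce
  then show "(if ?X \<in> infinite_classes \<Delta> then p_crit (graph_of ?X) else 0)
      = (if ?Y \<in> infinite_classes \<Delta> then p_crit (graph_of ?Y) else 0)"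
    using p_crit_iso[OF rep_graph_1[OF XY(1)] rep_graph_1[OF XY(2)] i] XY
    unfolding infinite_classes_def by auto
qed

theorem (in expander_limit) p_crit_const:
  assumes "AE X in \<mu>. infinite (Verts (graph_of X))"
  shows "\<exists>p. AE X in \<mu>. p_crit (graph_of X) = p"
proof -
  obtain p where "AE X in \<mu>. (if X \<in> infinite_classes \<Delta> then p_crit (graph_of X) else 0) = p"
    using rerooting_invariant_const[OF measurable_p_crit rerooting_invariant_p_crit] by blast
  with assms AE_space have "AE X in \<mu>. p_crit (graph_of X) = p"
    by eventually_elim (auto simp: infinite_classes_def space_\<mu>)
  then show ?thesis by blast
qed

section \<open>Reduction to graphs on the natural numbers\<close>

lemma cheeger_expansion:
  assumes "cheeger G \<ge> ereal c" "A \<subseteq> Verts G" "real (card A) \<le> real (card (Verts G)) / 2"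
  shows "c * real (card A) \<le> real (card (edge_boundary G A))"
proof (cases "card A = 0")
  case False
  have "cheeger G \<le> ereal (real (card (edge_boundary G A)) / real (card A))"
    unfolding cheeger_def by (rule INF_lower) (use assms False in simp)
  with assms(1) have "ereal c \<le> ereal (real (card (edge_boundary G A)) / real (card A))" by (rule order_trans)
  then show ?thesis using False by (simp add: pos_le_divide_eq)
qed simp

text \<open>Otherwise a component or its complement would contain at most half of the vertices, be
  nonempty, and have no boundary edge.\<close>

lemma connected_of_expansion:
  fixes G :: "'a ugraph"
  assumes G: "ugraph G" "finite (Verts G)" and c: "c > 0"
    and exp: "\<And>A. A \<subseteq> Verts G \<Longrightarrow> real (card A) \<le> real (card (Verts G)) / 2 \<Longrightarrow>
      c * real (card A) \<le> real (card (edge_boundary G A))"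
  shows "graph_connected G"
  unfolding graph_connected_def
proof (intro ballI, rule ccontr)
  fix u v assume uv: "u \<in> Verts G" "v \<in> Verts G" "(u, v) \<notin> (adj G)\<^sup>*"
  define C where "C = {w \<in> Verts G. (u, w) \<in> (adj G)\<^sup>*}"
  have closed: "a \<in> C \<longleftrightarrow> b \<in> C" if "{a, b} \<in> Edges G" for a b
  proof -
    have ab: "(a, b) \<in> adj G" "(b, a) \<in> adj G" using that by (auto simp: adj_def insert_commute)
    show ?thesis using edge_verts[OF G(1) that] rtrancl_into_rtrancl[OF _ ab(1)] rtrancl_into_rtrancl[OF _ ab(2)]
      unfolding C_def by blast
  qed
  have e: "edge_boundary G C = {}" "edge_boundary G (Verts G - C) = {}"
    using closed unfolding edge_boundary_def by blast+
  have C: "C \<subseteq> Verts G" "u \<in> C" "v \<in> Verts G - C" using uv unfolding C_def by auto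
  have fin: "finite C" by (rule finite_subset[OF C(1) G(2)])
  have "card C > 0" "card (Verts G - C) > 0" using C(2,3) fin G(2) unfolding card_gt_0_iff by blast+
  moreover have "card C + card (Verts G - C) = card (Verts G)"
    using card_Diff_subset[OF fin C(1)] card_mono[OF G(2) C(1)] by simp
  ultimately consider "real (card C) \<le> real (card (Verts G)) / 2" "card C > 0"
    | "real (card (Verts G - C)) \<le> real (card (Verts G)) / 2" "card (Verts G - C) > 0" by linarith
  then show False
  proof cases
    case 1
    then show False using exp[OF C(1)] c e(1) by (simp add: mult_le_0_iff)
  next
    case 2
    then show False using exp[OF Diff_subset 2(1)] c e(2) by (simp add: mult_le_0_iff)
  qed
qed

text \<open>Boundary edges of a set map injectively to boundary edges of its image, which is the
  direction a lower bound asks for.\<close>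

lemma expansion_relabel:
  fixes G :: "'a ugraph" and f :: "'a \<Rightarrow> 'b"
  assumes G: "ugraph G" "finite (Verts G)" and f: "inj_on f (Verts G)"
    and exp: "\<And>A. A \<subseteq> Verts G \<Longrightarrow> real (card A) \<le> real (card (Verts G)) / 2 \<Longrightarrow>
      c * real (card A) \<le> real (card (edge_boundary G A))"
    and B: "B \<subseteq> Verts (relabel f G)" "real (card B) \<le> real (card (Verts (relabel f G))) / 2"
  shows "c * real (card B) \<le> real (card (edge_boundary (relabel f G) B))"
proof -
  obtain A where A: "A \<subseteq> Verts G" "B = f ` A"
    using B(1) by (auto simp: relabel_def subset_image_iff)
  have card: "card B = card A" "card (Verts (relabel f G)) = card (Verts G)"
    unfolding A(2) relabel_def by (auto intro!: card_image f inj_on_subset[OF f A(1)])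
  have EV: "edge_boundary G A \<subseteq> Pow (Verts G)"
    using edge_subset_verts[OF G(1)] unfolding edge_boundary_def by blast
  have "(`) f ` edge_boundary G A \<subseteq> edge_boundary (relabel f G) B"
  proof
    fix e assume "e \<in> (`) f ` edge_boundary G A"
    then obtain a b where ab: "{a, b} \<in> Edges G" "a \<in> A" "b \<in> Verts G - A" "e = {f a, f b}"
      unfolding edge_boundary_def by auto
    have "f b \<notin> B" using ab(3) A inj_onD[OF f] by blast
    moreover have "e \<in> Edges (relabel f G)"
      using graph_iso_relabel[OF G(1) f] ab A(1) unfolding graph_iso_def by blast
    ultimately show "e \<in> edge_boundary (relabel f G) B"
      using ab A(2) unfolding edge_boundary_def by (auto simp: relabel_def)
  qed
  moreover have "finite (edge_boundary (relabel f G) B)"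
  proof -
    have "edge_boundary (relabel f G) B \<subseteq> Pow (Verts (relabel f G))"
      using edge_subset_verts[OF ugraph_relabel[OF G(1) f]] unfolding edge_boundary_def by blast
    moreover have "finite (Verts (relabel f G))" using G(2) by (simp add: relabel_def)
    ultimately show ?thesis by (meson finite_Pow_iff finite_subset)
  qed
  ultimately have "card ((`) f ` edge_boundary G A) \<le> card (edge_boundary (relabel f G) B)" by (rule card_mono[rotated])
  moreover have "card ((`) f ` edge_boundary G A) = card (edge_boundary G A)"
    by (rule card_image[OF inj_on_subset[OF inj_on_image_Pow[OF f] EV]])
  ultimately show ?thesis using exp[OF A(1)] B(2) unfolding card by linarith
qed

text \<open>Relabelling changes neither the law of the uniform root nor the types of the balls, so
  the probabilities agree for every \<open>n\<close>.\<close>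

lemma converges_locally_weakly_relabel:
  fixes G :: "nat \<Rightarrow> 'a ugraph" and f :: "nat \<Rightarrow> 'a \<Rightarrow> nat"
  assumes G: "\<And>n. ugraph (G n)" "\<And>n. finite (Verts (G n))" "\<And>n. Verts (G n) \<noteq> {}"
    and f: "\<And>n. inj_on (f n) (Verts (G n))" and conv: "converges_locally_weakly G \<mu>"
  shows "converges_locally_weakly (\<lambda>n. relabel (f n) (G n)) \<mu>"
proof -
  have "measure_pmf.prob (pmf_of_set (Verts (relabel (f n) (G n)))) {u. rooted_ball (relabel (f n) (G n), [u]) R \<cong>\<^sub>r C}
      = measure_pmf.prob (pmf_of_set (Verts (G n))) {u. rooted_ball (G n, [u]) R \<cong>\<^sub>r C}" for n R and C :: "nat rooted"
  proof -
    let ?H = "relabel (f n) (G n)"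
    have iff: "rooted_ball (?H, [f n u]) R \<cong>\<^sub>r C \<longleftrightarrow> rooted_ball (G n, [u]) R \<cong>\<^sub>r C" if u: "u \<in> Verts (G n)" for u
    proof -
      have "well_rooted (G n, [u])" "well_rooted (?H, [f n u])"
        using G(1)[of n] ugraph_relabel[OF G(1) f] u unfolding well_rooted_def by (auto simp: relabel_def)
      moreover have "(G n, [u]) \<cong>\<^sub>r (?H, [f n u])"
        using graph_iso_relabel[OF G(1) f] u unfolding rooted_iso_def by auto
      ultimately have "rooted_ball (G n, [u]) R \<cong>\<^sub>r rooted_ball (?H, [f n u]) R" by (rule iso_ball)
      from rooted_iso_trans[OF this, of C] rooted_iso_trans[OF rooted_iso_sym[OF this], of C]
      show ?thesis by blast
    qed
    have V: "Verts ?H = f n ` Verts (G n)" by (simp add: relabel_def)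
    have "Verts ?H \<inter> {u. rooted_ball (?H, [u]) R \<cong>\<^sub>r C} = f n ` (Verts (G n) \<inter> {u. rooted_ball (G n, [u]) R \<cong>\<^sub>r C})"
      unfolding V using iff by auto
    also have "card \<dots> = card (Verts (G n) \<inter> {u. rooted_ball (G n, [u]) R \<cong>\<^sub>r C})"
      by (rule card_image[OF inj_on_subset[OF f]]) simp
    finally show ?thesis
      using measure_pmf_of_set[OF G(3,2)] measure_pmf_of_set[of "Verts ?H"] G(2,3) card_image[OF f]
      unfolding V by simp
  qed
  then show ?thesis using conv unfolding converges_locally_weakly_def by simp
qed

theorem theorem1p1:
  fixes \<Delta> :: nat and c :: real
    and G :: "nat \<Rightarrow> 'a ugraph" and \<mu> :: "nat rooted set measure"
  assumes "\<Delta> > 0" and "c > 0"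
    and "\<And>n. ugraph (G n) \<and> finite (Verts (G n)) \<and> Verts (G n) \<noteq> {}"
    and "\<And>n. degrees_le \<Delta> (G n)"
    and "\<And>n. cheeger (G n) \<ge> ereal c"
    and "random_rooted_graph \<Delta> \<mu>"
    and "AE X in \<mu>. infinite (Verts (graph_of X))"
    and "converges_locally_weakly G \<mu>"
  shows "unimodular \<Delta> \<mu> \<and> ergodic \<Delta> \<mu> \<and> extremal_unimodular \<Delta> \<mu> \<and>
    (\<forall>f. f \<in> borel_measurable (local_borel \<Delta> 1) \<and> rerooting_invariant \<Delta> f \<longrightarrow>
       (\<exists>a. AE X in \<mu>. f X = a)) \<and>
    (\<exists>p. AE X in \<mu>. p_crit (graph_of X) = p)"
proof -
  have G: "ugraph (G n)" "finite (Verts (G n))" "Verts (G n) \<noteq> {}" for n using assms(3) by auto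
  have "\<exists>f :: 'a \<Rightarrow> nat. inj_on f (Verts (G n))" for n
    using finite_imp_inj_to_nat_seg[OF G(2)] by blast
  then obtain f :: "nat \<Rightarrow> 'a \<Rightarrow> nat" where f: "\<And>n. inj_on (f n) (Verts (G n))" by metis
  define H where "H n = relabel (f n) (G n)" for n
  have u: "ugraph (H n)" for n unfolding H_def by (rule ugraph_relabel[OF G(1) f])
  have fin: "finite (Verts (H n))" "Verts (H n) \<noteq> {}" for n
    using G by (auto simp: H_def relabel_def)
  have exp: "c * real (card A) \<le> real (card (edge_boundary (H n) A))"
    if "A \<subseteq> Verts (H n)" "real (card A) \<le> real (card (Verts (H n))) / 2" for n A
    using that unfolding H_def
    by (intro expansion_relabel[OF G(1,2) f] cheeger_expansion[OF assms(5)]) auto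
  interpret expander_limit \<Delta> H \<mu> c
  proof
    show "graph_connected (H n)" for n
      by (rule connected_of_expansion[OF u fin(1) assms(2) exp])
    show "degrees_le \<Delta> (H n)" for n
      unfolding H_def
      by (rule degrees_le_iso[OF G(1) ugraph_relabel[OF G(1) f] graph_iso_relabel[OF G(1) f] assms(4)])
    show "converges_locally_weakly H \<mu>"
      unfolding H_def by (rule converges_locally_weakly_relabel[OF G f assms(8)])
  qed (use u fin assms(2,6) exp in auto)
  show ?thesis
    using unimodular ergodic extremal rerooting_invariant_const p_crit_const[OF assms(7)] by blast
qed

end
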